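(* Let $d\ge 2$ and let $g$ be a random Riemannian metric on $\mathbb{R}^d$ satisfying the standing assumptions listed in the context, and suppose in addition that $g$ is a $C^2$-smooth random Riemannian metric, i.e. $g\in C^2(\mathbb{R}^d,\mathrm{SPD})$ with probability one. Then, with probability one, $g$ is geodesically complete. Consequently, for all $x,y\in\mathbb{R}^d$, there is a finite length-minimizing geodesic $\gamma$ connecting $x$ to $y$ such that $d(x,y)=R(\gamma)$.
   Context: Setting. Let $d\ge2$, let $\mathrm{SPD}$ be the set of symmetric positive-definite $d\times d$ real matrices, let $\Omega=C(\mathbb{R}^d,\mathrm{SPD})$ with the $\sigma$-algebra generated by cylinder sets, and let $\mathbb{P}$ be a probability measure on $\Omega$; $g\in\Omega$ denotes the random Riemannian metric with law $\mathbb{P}$. Standing assumptions: (i) $\mathbb{P}$ is translation-invariant; (ii) $\mathbb{P}$ has finite-range dependence: there exists $R>0$ such that if $|x-y|\ge R$, then $g(x)$ and $g(y)$ are independent; (iii) with $C_0=[-1/2,1/2)^d$ and $\Lambda_0=\sup_{x\in C_0}(\text{maximum eigenvalue of }g(x))$, one has $\mathbb{E}[e^{r\Lambda_0}]<\infty$ for all $r\in\mathbb{R}$. Distance. For a $C^1$-curve $\gamma:[a,b]\to\mathbb{R}^d$, its Riemannian length is $R(\gamma)=\int_a^b\sqrt{\langle\dot\gamma(t),g(\gamma(t))\dot\gamma(t)\rangle}\,dt$; $d(x,y)=\inf_\gamma R(\gamma)$ over all $C^1$-curves $\gamma$ connecting $x$ to $y$. $|\cdot|$ is the Euclidean norm.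 A curve is finite if it has finite Euclidean length $\int_a^b|\dot\gamma(t)|\,dt$. Geodesics. For a $C^2$ metric $g$, a geodesic is a solution of the geodesic equations of $g$ (the Euler–Lagrange equations of the functional $R$); it is uniquely determined by its starting point and velocity. The metric is geodesically complete if for all $x\in\mathbb{R}^d$ and $v\in T_x\mathbb{R}^d$ the unique geodesic at $x$ in direction $v$ can be continued for all time. A geodesic $\gamma$ is length-minimizing if for all points $p,q$ on $\gamma$, the distance $d(p,q)$ is realized as the Riemannian length of the part of $\gamma$ which connects $p$ and $q$.
   Formalization: Finite-range dependence is assumed for the field: the families (g(x)), x in A, and (g(y)), y in B, are independent whenever A and B are at distance at least R; with independence only of the single matrices g(x) and g(y) the claim is false. *)

theory Defs
  imports "HOL-Probability.Probability"
begin

section \<open>Metrics and the path space\<close>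

definition SPD :: "(real ^ 'n ^ 'n) set" where
  "SPD = {A. transpose A = A \<and> (\<forall>v. v \<noteq> 0 \<longrightarrow> v \<bullet> (A *v v) > 0)}"

definition Omega :: "(real ^ 'n \<Rightarrow> real ^ 'n ^ 'n) set" where
  "Omega = {g. continuous_on UNIV g \<and> range g \<subseteq> SPD}"

text \<open>The sub-\<open>\<sigma>\<close>-algebra of events that depend only on \<open>g\<close> restricted to \<open>A\<close>;
  for \<open>A = UNIV\<close> it is the \<open>\<sigma>\<close>-algebra generated by all cylinder sets.\<close>

definition field_events :: "(real ^ 'n) set \<Rightarrow> (real ^ 'n \<Rightarrow> real ^ 'n ^ 'n) set set" where
  "field_events A = sigma_sets Omega {{g \<in> Omega. g x \<in> S} | x S. x \<in> A \<and> S \<in> sets borel}"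

definition Omega_space :: "(real ^ 'n \<Rightarrow> real ^ 'n ^ 'n) measure" where
  "Omega_space = sigma Omega (field_events UNIV)"

section \<open>Assumptions on the law of the random metric\<close>

definition translation_invariant :: "(real ^ 'n \<Rightarrow> real ^ 'n ^ 'n) measure \<Rightarrow> bool" where
  "translation_invariant P \<longleftrightarrow> (\<forall>z. distr P Omega_space (\<lambda>g x. g (x + z)) = P)"

text \<open>Independence at distance \<open>R\<close> is meant for the random field: the families
  \<open>(g(x))\<close>, \<open>x \<in> A\<close>, and \<open>(g(y))\<close>, \<open>y \<in> B\<close>, are independent whenever all
  \<open>x \<in> A\<close> and \<open>y \<in> B\<close> are at distance at least \<open>R\<close>. Independence of the pairs of single
  matrices \<open>g(x)\<close>, \<open>g(y)\<close> alone would leave the joint behaviour of \<open>g\<close> on two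
  separated regions unconstrained.\<close>

definition finite_range_dependence :: "(real ^ 'n \<Rightarrow> real ^ 'n ^ 'n) measure \<Rightarrow> bool" where
  "finite_range_dependence P \<longleftrightarrow>
    (\<exists>R>0. \<forall>A B. (\<forall>x\<in>A. \<forall>y\<in>B. norm (x - y) \<ge> R) \<longrightarrow>
      prob_space.indep_set P (field_events A) (field_events B))"

definition max_eigenvalue :: "real ^ 'n ^ 'n \<Rightarrow> real" where
  "max_eigenvalue A = Max {l. \<exists>v. v \<noteq> 0 \<and> A *v v = l *\<^sub>R v}"

definition unit_cube :: "(real ^ 'n) set" where
  "unit_cube = {x. \<forall>i. - 1 / 2 \<le> x $ i \<and> x $ i < 1 / 2}"

definition Lambda0 :: "(real ^ 'n \<Rightarrow> real ^ 'n ^ 'n) \<Rightarrow> real" where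
  "Lambda0 g = (SUP x\<in>unit_cube. max_eigenvalue (g x))"

definition C1_map :: "('a::real_normed_vector \<Rightarrow> 'b::real_normed_vector) \<Rightarrow> bool" where
  "C1_map f \<longleftrightarrow>
    (\<exists>f'. (\<forall>x. (f has_derivative blinfun_apply (f' x)) (at x)) \<and> continuous_on UNIV f')"

definition C2_map :: "('a::real_normed_vector \<Rightarrow> 'b::real_normed_vector) \<Rightarrow> bool" where
  "C2_map f \<longleftrightarrow>
    (\<exists>f'. (\<forall>x. (f has_derivative blinfun_apply (f' x)) (at x)) \<and> C1_map f')"

section \<open>Length and distance\<close>

text \<open>One-sided derivatives at the endpoints, so values of \<open>\<gamma>\<close> outside \<open>{a..b}\<close> are
  irrelevant (the library predicate \<open>C1_differentiable_on\<close> uses two-sided ones).\<close>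

definition C1_curve :: "real \<Rightarrow> real \<Rightarrow> (real \<Rightarrow> real ^ 'n) \<Rightarrow> bool" where
  "C1_curve a b \<gamma> \<longleftrightarrow> a < b \<and>
    (\<exists>D. (\<forall>t\<in>{a..b}. (\<gamma> has_vector_derivative D t) (at t within {a..b})) \<and>
         continuous_on {a..b} D)"

definition riem_length ::
  "(real ^ 'n \<Rightarrow> real ^ 'n ^ 'n) \<Rightarrow> real \<Rightarrow> real \<Rightarrow> (real \<Rightarrow> real ^ 'n) \<Rightarrow> real" where
  "riem_length g a b \<gamma> =
    integral {a..b} (\<lambda>t. let v = vector_derivative \<gamma> (at t within {a..b})
                        in sqrt (v \<bullet> (g (\<gamma> t) *v v)))"

definition riem_dist ::
  "(real ^ 'n \<Rightarrow> real ^ 'n ^ 'n) \<Rightarrow> real ^ 'n \<Rightarrow> real ^ 'n \<Rightarrow> real" where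
  "riem_dist g x y =
    Inf {riem_length g a b \<gamma> | a b \<gamma>. C1_curve a b \<gamma> \<and> \<gamma> a = x \<and> \<gamma> b = y}"

definition finite_curve :: "real \<Rightarrow> real \<Rightarrow> (real \<Rightarrow> real ^ 'n) \<Rightarrow> bool" where
  "finite_curve a b \<gamma> \<longleftrightarrow>
    (\<lambda>t. norm (vector_derivative \<gamma> (at t within {a..b}))) integrable_on {a..b}"

section \<open>Geodesics\<close>

text \<open>\<open>partial_metric g x i j k\<close> is the partial derivative \<open>\<partial>\<^sub>i g\<^sub>j\<^sub>k\<close> at \<open>x\<close>.\<close>

definition partial_metric ::
  "(real ^ 'n \<Rightarrow> real ^ 'n ^ 'n) \<Rightarrow> real ^ 'n \<Rightarrow> 'n \<Rightarrow> 'n \<Rightarrow> 'n \<Rightarrow> real" where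
  "partial_metric g x i j k = frechet_derivative (\<lambda>y. g y $ j $ k) (at x) (axis i 1)"

text \<open>The Christoffel symbol with upper index \<open>k\<close> and lower indices \<open>i\<close>, \<open>j\<close>.\<close>

definition christoffel ::
  "(real ^ 'n \<Rightarrow> real ^ 'n ^ 'n) \<Rightarrow> real ^ 'n \<Rightarrow> 'n \<Rightarrow> 'n \<Rightarrow> 'n \<Rightarrow> real" where
  "christoffel g x k i j =
    (\<Sum>l\<in>UNIV. matrix_inv (g x) $ k $ l *
      (partial_metric g x i j l + partial_metric g x j i l - partial_metric g x l i j)) / 2"

text \<open>The geodesic equations are the Euler--Lagrange equations of the length functional in
  the affine parametrization, in which the initial point and velocity determine the solution.\<close>

definition geodesic_on ::
  "(real ^ 'n \<Rightarrow> real ^ 'n ^ 'n) \<Rightarrow> real set \<Rightarrow> (real \<Rightarrow> real ^ 'n) \<Rightarrow> bool" where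
  "geodesic_on g J \<gamma> \<longleftrightarrow>
    (\<exists>v. \<forall>t\<in>J.
      (\<gamma> has_vector_derivative v t) (at t within J) \<and>
      (v has_vector_derivative
        (\<chi> k. - (\<Sum>i\<in>UNIV. \<Sum>j\<in>UNIV. christoffel g (\<gamma> t) k i j * v t $ i * v t $ j)))
        (at t within J))"

definition geodesically_complete :: "(real ^ 'n \<Rightarrow> real ^ 'n ^ 'n) \<Rightarrow> bool" where
  "geodesically_complete g \<longleftrightarrow>
    (\<forall>x v. \<exists>\<gamma>. geodesic_on g UNIV \<gamma> \<and> \<gamma> 0 = x \<and> (\<gamma> has_vector_derivative v) (at 0))"

definition length_minimizing ::
  "(real ^ 'n \<Rightarrow> real ^ 'n ^ 'n) \<Rightarrow> real \<Rightarrow> real \<Rightarrow> (real \<Rightarrow> real ^ 'n) \<Rightarrow> bool" where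
  "length_minimizing g a b \<gamma> \<longleftrightarrow>
    (\<forall>s t. a \<le> s \<and> s \<le> t \<and> t \<le> b \<longrightarrow> riem_dist g (\<gamma> s) (\<gamma> t) = riem_length g s t \<gamma>)"

end

theory Submission
  imports Defs "HOL-Complex_Analysis.Great_Picard"
begin

text \<open>Completeness holds as soon as curves of bounded length starting at a point stay bounded,
  which a renormalization argument gives. A crossing of an annulus of radius \<open>12 L\<close> contains two crossings of
  annuli of radius \<open>L\<close> around points of a finite net, so far apart that \<open>g\<close> is independent on them. If
  \<open>p\<^sub>k\<close> bounds the probability that annuli at scale \<open>k\<close> can be crossed with length less than a
  constant \<open>\<delta>\<close>, then \<open>p\<^sub>k\<^sub>+\<^sub>1 \<le> C p\<^sub>k\<^sup>2\<close>, and \<open>p\<^sub>0\<close> is small for small \<open>\<delta>\<close> because \<open>g\<close> is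
  positive definite. By Borel--Cantelli, almost surely all large annuli cost at least \<open>\<delta>\<close>.

  The geodesic equations are used in Hamiltonian form. Conservation of energy and the boundedness of
  short curves keep solutions in a compact set, so they extend for all time; existence comes from Peano's
  theorem, and uniqueness is never needed. For minimizers, the metric is first made uniformly elliptic by
  enlarging it outside a ball. There one minimizes the discrete energy
  \<open>m \<Sum> \<langle>X\<^sub>i\<^sub>+\<^sub>1 - X\<^sub>i, g(X\<^sub>i) (X\<^sub>i\<^sub>+\<^sub>1 - X\<^sub>i)\<rangle>\<close> over chains of \<open>m\<close> steps. Its Euler--Lagrange equations are a
  symplectic Euler scheme for the Hamiltonian flow, so by Arzela--Ascoli the minimizing chains converge to a
  solution of the geodesic equations, with no regularity theory for weak minimizers. Sampling a curve of length
  \<open>L\<close> by arc length gives a chain of energy about \<open>L\<^sup>2\<close>, which is why the limit minimizes length.\<close>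

subsection \<open>Positive definite matrices\<close>

text \<open>Positive definiteness gives no lower bound on \<open>g\<close> that is uniform in space,
  so regions where curves are almost free must be expected everywhere. What survives is a cost
  \<open>sqrt \<epsilon> * R\<close> per annulus that does not grow with the scale: of two far-apart
  crossings of smaller annuli one expensive one suffices, so a cheap large crossing needs two
  independent bad events. As the radii grow geometrically, reaching radius r costs at least of order
  log r, which still tends to infinity.

  In position and momentum \<open>p = g x *v v\<close>, the geodesic equations become a continuous
  vector field built from \<open>g\<close> and its first derivative. Euler polygons and minimizing
  chains are both one-step schemes for it, so \<open>one_step_scheme_limit\<close> serves for both
  limits. The energy controls only the mean of the squared velocities of a chain; the momentum
  equation upgrades this to a uniform bound (\<open>discrete_momentum_bound\<close>), which is what
  gives compactness in phase space.\<close>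

lemma bounded_bilinear_matrix_vector_mult:
  "bounded_bilinear ((*v) :: real ^ 'n ^ 'm \<Rightarrow> real ^ 'n \<Rightarrow> real ^ 'm)"
  unfolding bilinear_conv_bounded_bilinear [symmetric] bilinear_def
  by (auto intro!: linearI simp: matrix_vector_mult_add_rdistrib matrix_vector_right_distrib
      scaleR_matrix_vector_assoc matrix_vector_mult_scaleR)

lemmas continuous_on_matrix_vector_mult [continuous_intros] =
  bounded_bilinear.continuous_on [OF bounded_bilinear_matrix_vector_mult]

lemmas tendsto_matrix_vector_mult [tendsto_intros] =
  bounded_bilinear.tendsto [OF bounded_bilinear_matrix_vector_mult]

lemma norm_matrix_vector_mult_le:
  fixes A :: "real ^ 'n ^ 'm"
  shows "norm (A *v x) \<le> norm A * norm x"
proof (rule power2_le_imp_le)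
  have "(norm (A *v x))\<^sup>2 = (\<Sum>i\<in>UNIV. (A $ i \<bullet> x)\<^sup>2)"
    by (simp add: norm_vec_def L2_set_def sum_nonneg matrix_vector_mult_def inner_vec_def)
  also have "\<dots> \<le> (\<Sum>i\<in>UNIV. (norm (A $ i))\<^sup>2 * (norm x)\<^sup>2)"
    by (intro sum_mono) (metis Cauchy_Schwarz_ineq2 abs_le_square_iff abs_norm_cancel abs_mult power_mult_distrib)
  also have "\<dots> = (norm A * norm x)\<^sup>2"
    by (simp add: norm_vec_def [of A] L2_set_def sum_nonneg power_mult_distrib sum_distrib_right)
  finally show "(norm (A *v x))\<^sup>2 \<le> (norm A * norm x)\<^sup>2" .
qed simp

lemma matrix_vector_mult_minus: "(A :: real ^ 'n ^ 'm) *v (- x) = - (A *v x)"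
  using linear_neg[OF matrix_vector_mul_linear] .

lemma SPD_pos: "A \<in> SPD \<Longrightarrow> v \<noteq> 0 \<Longrightarrow> v \<bullet> (A *v v) > 0"
  by (simp add: SPD_def)

lemma SPD_nonneg: "A \<in> SPD \<Longrightarrow> v \<bullet> (A *v v) \<ge> 0"
  by (cases "v = 0") (auto dest: SPD_pos[of A v])

lemma SPD_sym:
  assumes "A \<in> SPD"
  shows "v \<bullet> (A *v w) = (A *v v) \<bullet> w"
  using assms by (metis (mono_tags, lifting) SPD_def dot_lmul_matrix mem_Collect_eq transpose_matrix_vector)

lemma SPD_comm:
  assumes "A \<in> SPD"
  shows "v \<bullet> (A *v w) = w \<bullet> (A *v v)"
  using SPD_sym[OF assms] by (simp add: inner_commute)

lemma SPD_nth_sym: "A \<in> SPD \<Longrightarrow> A $ i $ j = A $ j $ i"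
  by (auto simp: SPD_def transpose_def vec_eq_iff)

text \<open>The form is evaluated at \<open>q v *\<^sub>R w - q w *\<^sub>R v\<close>, with
  \<open>q\<close> the norm of \<open>A\<close>; it collapses to
  \<open>2 * (q v * q w) * (q v * q w - v \<bullet> (A *v w))\<close>, and the positive factor can
  be cancelled.\<close>

lemma SPD_Cauchy_Schwarz:
  assumes "A \<in> SPD"
  shows "v \<bullet> (A *v w) \<le> sqrt (v \<bullet> (A *v v)) * sqrt (w \<bullet> (A *v w))"
proof -
  define q where "q u = sqrt (u \<bullet> (A *v u))" for u
  have q0: "q u \<ge> 0" "(q u)\<^sup>2 = u \<bullet> (A *v u)" for u
    using SPD_nonneg[OF assms] by (auto simp: q_def)
  have "0 \<le> (q v *\<^sub>R w - q w *\<^sub>R v) \<bullet> (A *v (q v *\<^sub>R w - q w *\<^sub>R v))"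
    by (rule SPD_nonneg[OF assms])
  also have "\<dots> = (q v)\<^sup>2 * (w \<bullet> (A *v w)) - q v * q w * (w \<bullet> (A *v v))
      - q v * q w * (v \<bullet> (A *v w)) + (q w)\<^sup>2 * (v \<bullet> (A *v v))"
    by (simp add: matrix_vector_mult_diff_distrib matrix_vector_mult_scaleR inner_diff_left inner_diff_right
        power2_eq_square algebra_simps)
  also have "\<dots> = 2 * (q v * q w) * (q v * q w - v \<bullet> (A *v w))"
    unfolding q0(2)[symmetric] SPD_comm[OF assms, of w v] by (simp add: power2_eq_square algebra_simps)
  finally have *: "0 \<le> 2 * (q v * q w) * (q v * q w - v \<bullet> (A *v w))" .
  show ?thesis
  proof (cases "v = 0 \<or> w = 0")
    case True then show ?thesis by auto
  next
    case False
    then have "q v * q w > 0" using SPD_pos[OF assms] by (auto simp: q_def)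
    with * have "0 \<le> q v * q w - v \<bullet> (A *v w)" by (simp add: zero_le_mult_iff)
    then show ?thesis by (simp add: q_def)
  qed
qed

lemma SPD_invertible:
  assumes "A \<in> SPD" shows "invertible A"
proof -
  have "A *v x = 0 \<Longrightarrow> x = 0" for x
    using SPD_pos[OF assms, of x] by fastforce
  then show ?thesis
    by (metis matrix_left_invertible_ker invertible_left_inverse)
qed

lemma SPD_inv [simp]:
  assumes "A \<in> SPD"
  shows "A *v (matrix_inv A *v x) = x" "matrix_inv A *v (A *v x) = x"
proof -
  have "A ** matrix_inv A = mat 1 \<and> matrix_inv A ** A = mat 1"
    unfolding matrix_inv_def using SPD_invertible[OF assms] unfolding invertible_def by (rule someI_ex)
  then show "A *v (matrix_inv A *v x) = x" "matrix_inv A *v (A *v x) = x"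
    by (simp_all add: matrix_vector_mul_assoc)
qed

text \<open>By homogeneity only unit vectors matter, and on \<open>S\<close> times the unit sphere,
  which is compact, the form attains a positive minimum.\<close>

lemma SPD_uniform_lower:
  fixes g :: "real ^ 'n \<Rightarrow> real ^ 'n ^ 'n"
  assumes g: "continuous_on S g" "\<And>x. x \<in> S \<Longrightarrow> g x \<in> SPD" and S: "compact S"
  obtains c where "c > 0" "\<And>x v. x \<in> S \<Longrightarrow> c * (norm v)\<^sup>2 \<le> v \<bullet> (g x *v v)"
proof (cases "S = {}")
  case True
  then show ?thesis using that[of 1] by auto
next
  case False
  let ?K = "S \<times> sphere (0 :: real ^ 'n) 1"
  let ?f = "\<lambda>(x, v). v \<bullet> (g x *v v)"
  have K: "compact ?K" by (intro compact_Times S compact_sphere)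
  obtain e :: "real ^ 'n" where "norm e = 1" using vector_choose_size[of 1] by auto
  then have ne: "?K \<noteq> {}" using False by auto
  have cont: "continuous_on ?K ?f"
    unfolding case_prod_unfold
    by (intro continuous_intros continuous_on_compose2[OF g(1)]) auto
  obtain z where z: "z \<in> ?K" "\<And>y. y \<in> ?K \<Longrightarrow> ?f z \<le> ?f y"
    using continuous_attains_inf[OF K ne cont] by blast
  show ?thesis
  proof (rule that[of "?f z"])
    show "?f z > 0" using z(1) by (cases z) (auto intro!: SPD_pos[OF g(2)])
    show "?f z * (norm v)\<^sup>2 \<le> v \<bullet> (g x *v v)" if "x \<in> S" for x v
    proof (cases "v = 0")
      case False
      have "?f z \<le> ?f (x, v /\<^sub>R norm v)" using that False by (intro z(2)) auto
      also have "\<dots> = (v \<bullet> (g x *v v)) / (norm v)\<^sup>2"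
        by (simp add: matrix_vector_mult_scaleR power2_eq_square divide_simps)
      finally show ?thesis using False by (simp add: field_simps)
    qed auto
  qed
qed

lemma norm_SPD_inv_le:
  assumes "A \<in> SPD" and c: "c > 0" "\<And>v. c * (norm v)\<^sup>2 \<le> v \<bullet> (A *v v)"
  shows "norm (matrix_inv A *v x) \<le> norm x / c"
proof -
  let ?y = "matrix_inv A *v x"
  have "c * (norm ?y)\<^sup>2 \<le> ?y \<bullet> x" using c(2)[of ?y] assms(1) by simp
  also have "\<dots> \<le> norm ?y * norm x" by (rule norm_cauchy_schwarz)
  finally have "norm ?y * (c * norm ?y) \<le> norm ?y * norm x" by (simp add: power2_eq_square algebra_simps)
  then have "c * norm ?y \<le> norm x"
    by (cases "norm ?y = 0") (auto simp: mult_le_cancel_left)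
  then show ?thesis using c(1) by (simp add: field_simps)
qed

text \<open>With \<open>y = matrix_inv A0 *v v0\<close> one has
  \<open>A^-1 v - y = A^-1 (v - A y)\<close>. Here \<open>v - A y\<close> tends to 0, and
  \<open>A^-1\<close> stays bounded because \<open>A\<close> is elliptic with constant
  \<open>c / 2\<close> once it is within \<open>c / 2\<close> of \<open>A0\<close>.\<close>

lemma tendsto_SPD_inv:
  fixes A :: "'a \<Rightarrow> real ^ 'n ^ 'n"
  assumes lim: "(A \<longlongrightarrow> A0) F" "(v \<longlongrightarrow> v0) F" and A: "\<And>x. A x \<in> SPD" "A0 \<in> SPD"
  shows "((\<lambda>x. matrix_inv (A x) *v v x) \<longlongrightarrow> matrix_inv A0 *v v0) F"
proof -
  obtain c where c: "c > 0" "\<And>v. c * (norm v)\<^sup>2 \<le> v \<bullet> (A0 *v v)"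
    using SPD_uniform_lower[of "{0}" "\<lambda>_. A0"] A(2) by (metis compact_sing continuous_on_sing singletonI)
  let ?y = "matrix_inv A0 *v v0"
  have "\<forall>\<^sub>F x in F. dist (A x) A0 < c / 2"
    using lim(1) c(1) by (intro tendstoD) auto
  then have "\<forall>\<^sub>F x in F. norm (matrix_inv (A x) *v v x - ?y) \<le>
      norm (v x - A x *v ?y) * (2 / c)"
  proof eventually_elim
    case (elim x)
    have "(c / 2) * (norm w)\<^sup>2 \<le> w \<bullet> (A x *v w)" for w
    proof -
      have "w \<bullet> ((A0 - A x) *v w) \<le> norm w * (norm (A0 - A x) * norm w)"
        by (intro order_trans[OF norm_cauchy_schwarz] mult_left_mono norm_matrix_vector_mult_le) auto
      also have "\<dots> \<le> norm w * (c / 2 * norm w)"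
        using elim by (intro mult_left_mono mult_right_mono) (auto simp: dist_norm norm_minus_commute)
      finally have "w \<bullet> (A0 *v w) - w \<bullet> (A x *v w) \<le> c / 2 * (norm w)\<^sup>2"
        by (simp add: matrix_vector_mult_diff_rdistrib inner_diff_right power2_eq_square algebra_simps)
      with c(2)[of w] show ?thesis by (simp add: field_simps)
    qed
    then have "norm (matrix_inv (A x) *v (v x - A x *v ?y)) \<le> norm (v x - A x *v ?y) / (c/2)"
      using A(1) c(1) by (intro norm_SPD_inv_le) auto
    then show ?case using A(1) by (simp add: matrix_vector_mult_diff_distrib field_simps)
  qed
  moreover have "((\<lambda>x. norm (v x - A x *v ?y) * (2 / c)) \<longlongrightarrow> 0) F"
  proof -
    have "((\<lambda>x. norm (v x - A x *v ?y) * (2 / c)) \<longlongrightarrow> norm (v0 - A0 *v ?y) * (2 / c)) F"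
      by (intro tendsto_intros lim)
    then show ?thesis using A(2) by simp
  qed
  ultimately have "((\<lambda>x. matrix_inv (A x) *v v x - ?y) \<longlongrightarrow> 0) F"
    by (rule Lim_null_comparison)
  then show ?thesis by (simp add: LIM_zero_iff)
qed

text \<open>The formula comes from differentiating \<open>A w = p\<close>, which gives
  \<open>A w' = p' - A' w\<close>. Differentiability of \<open>w\<close> is obtained from continuity
  of the inverse alone.\<close>

lemma SPD_inv_has_vector_derivative:
  fixes A :: "real \<Rightarrow> real ^ 'n ^ 'n"
  assumes A: "(A has_vector_derivative A') (at t within S)" "\<And>s. A s \<in> SPD"
    and p: "(p has_vector_derivative p') (at t within S)"
  defines "w \<equiv> matrix_inv (A t) *v p t"
  shows "((\<lambda>s. matrix_inv (A s) *v p s) has_vector_derivative matrix_inv (A t) *v (p' - A' *v w)) (at t within S)"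
proof -
  let ?u = "p' - A' *v w"
  let ?e = "\<lambda>f f' s. (1 / norm (s - t)) *\<^sub>R (f s - (f t + (s - t) *\<^sub>R f'))"
  have lim: "(?e A A' \<longlongrightarrow> 0) (at t within S)" "(?e p p' \<longlongrightarrow> 0) (at t within S)"
    using A(1) p by (auto simp: has_vector_derivative_def has_derivative_within)
  have limA: "(A \<longlongrightarrow> A t) (at t within S)"
    using has_vector_derivative_continuous[OF A(1)] by (simp add: continuous_within)
  have 1: "((\<lambda>s. matrix_inv (A s) *v (?e p p' s - ?e A A' s *v w)) \<longlongrightarrow> matrix_inv (A t) *v (0 - 0 *v w)) (at t within S)"
    by (intro tendsto_SPD_inv limA tendsto_intros lim A(2))
  have "((\<lambda>s. matrix_inv (A s) *v ?u - matrix_inv (A t) *v ?u) \<longlongrightarrow> 0) (at t within S)"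
    by (intro LIM_zero tendsto_SPD_inv limA tendsto_intros A(2))
  then have 2: "((\<lambda>s. ((s - t) / norm (s - t)) *\<^sub>R (matrix_inv (A s) *v ?u - matrix_inv (A t) *v ?u)) \<longlongrightarrow> 0) (at t within S)"
    by (rule Lim_null_comparison[rotated, OF tendsto_norm_zero]) (auto intro!: always_eventually mult_left_le_one_le)
  \<comment> \<open>An exact identity: the error of the difference quotient is the inverse applied
    to the errors of \<open>p\<close> and \<open>A\<close>, plus the change of the inverse on the
    fixed vector \<open>?u\<close>.\<close>
  have "?e (\<lambda>s. matrix_inv (A s) *v p s) (matrix_inv (A t) *v ?u) s =
     matrix_inv (A s) *v (?e p p' s - ?e A A' s *v w) +
     ((s - t) / norm (s - t)) *\<^sub>R (matrix_inv (A s) *v ?u - matrix_inv (A t) *v ?u)" for s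
  proof -
    have pt: "p t = A t *v w" using A(2) by (simp add: w_def)
    have 1: "matrix_inv (A s) *v p s - (w + (s - t) *\<^sub>R (matrix_inv (A t) *v ?u)) =
       matrix_inv (A s) *v (p s - A s *v w) - (s - t) *\<^sub>R (matrix_inv (A t) *v ?u)"
      using A(2) by (simp add: matrix_vector_mult_diff_distrib)
    have 2: "p s - A s *v w = ((p s - (p t + (s - t) *\<^sub>R p')) - (A s - (A t + (s - t) *\<^sub>R A')) *v w) + (s - t) *\<^sub>R ?u"
      by (simp add: pt matrix_vector_mult_diff_rdistrib matrix_vector_mult_add_rdistrib algebra_simps
          flip: scaleR_matrix_vector_assoc)
    have 3: "matrix_inv (A s) *v p s - (w + (s - t) *\<^sub>R (matrix_inv (A t) *v ?u)) =
        matrix_inv (A s) *v ((p s - (p t + (s - t) *\<^sub>R p')) - (A s - (A t + (s - t) *\<^sub>R A')) *v w) +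
        (s - t) *\<^sub>R (matrix_inv (A s) *v ?u - matrix_inv (A t) *v ?u)"
      unfolding 1 2 matrix_vector_right_distrib matrix_vector_mult_scaleR
      by (simp only: scaleR_right_diff_distrib add_diff_eq)
    have 4: "matrix_inv B *v (k *\<^sub>R E - (k *\<^sub>R E') *v w) = k *\<^sub>R (matrix_inv B *v (E - E' *v w))"
      for B :: "real ^ 'n ^ 'n" and E E' k
      by (simp add: matrix_vector_mult_scaleR scaleR_right_diff_distrib matrix_vector_mult_diff_distrib
          flip: scaleR_matrix_vector_assoc)
    show ?thesis unfolding w_def[symmetric] 3 4 by (simp add: scaleR_right_distrib)
  qed
  then have "(?e (\<lambda>s. matrix_inv (A s) *v p s) (matrix_inv (A t) *v ?u) \<longlongrightarrow> 0) (at t within S)"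
    using tendsto_add[OF 1 2] by simp
  then show ?thesis
    by (simp add: has_vector_derivative_def has_derivative_within bounded_linear_scaleR_left)
qed

subsection \<open>Ordinary differential equations\<close>

definition integral_curve :: "('a::real_normed_vector \<Rightarrow> 'a) \<Rightarrow> real set \<Rightarrow> (real \<Rightarrow> 'a) \<Rightarrow> bool" where
  "integral_curve F J \<zeta> \<longleftrightarrow> (\<forall>t\<in>J. (\<zeta> has_vector_derivative F (\<zeta> t)) (at t within J))"

section \<open>Linear interpolation and limits of one-step schemes\<close>

definition ramp :: "real \<Rightarrow> real" where
  "ramp u = max 0 (min 1 u)"

text \<open>\<open>ramp (m * t - k)\<close> is the fraction of step \<open>k\<close> completed by
  time \<open>t\<close>, so this interpolates linearly between the values \<open>z i\<close> at
  times \<open>i / m\<close>. As a weighted sum of increments it can be compared with a constant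
  velocity term by term.\<close>

definition polygon :: "nat \<Rightarrow> (nat \<Rightarrow> 'a::real_normed_vector) \<Rightarrow> real \<Rightarrow> 'a" where
  "polygon m z t = z 0 + (\<Sum>k<m. ramp (m * t - k) *\<^sub>R (z (Suc k) - z k))"

lemma sum_ramp: "(\<Sum>k<m. ramp (u - real k)) = max 0 (min (real m) u)"
  by (induction m) (auto simp: ramp_def max_def min_def)

lemma ramp_mono: "s \<le> t \<Longrightarrow> ramp s \<le> ramp t"
  by (auto simp: ramp_def)

lemma sum_ramp_diff:
  fixes m :: nat and s t :: real
  assumes "s \<in> {0..1}" "t \<in> {0..1}"
  shows "(\<Sum>k<m. ramp (m * t - k) - ramp (m * s - k)) = m * (t - s)"
proof -
  have "m * t \<le> m" "m * s \<le> m" "0 \<le> m * t" "0 \<le> m * s"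
    using assms by (auto simp: mult_left_le)
  then show ?thesis by (simp add: sum_subtractf sum_ramp right_diff_distrib max_def min_def)
qed

lemma sum_abs_ramp_diff:
  fixes m :: nat and s t :: real
  assumes "s \<in> {0..1}" "t \<in> {0..1}"
  shows "(\<Sum>k<m. \<bar>ramp (m * t - k) - ramp (m * s - k)\<bar>) = m * \<bar>t - s\<bar>"
proof -
  have *: "(\<Sum>k<m. \<bar>ramp (m * t - k) - ramp (m * s - k)\<bar>) = m * \<bar>t - s\<bar>"
    if "s \<le> t" "s \<in> {0..1}" "t \<in> {0..1}" for s t :: real
  proof -
    have "\<bar>ramp (m * t - k) - ramp (m * s - k)\<bar> = ramp (m * t - k) - ramp (m * s - k)" for k :: nat
      using that by (intro abs_of_nonneg) (simp add: ramp_mono mult_left_mono)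
    then show ?thesis using that by (simp add: sum_ramp_diff)
  qed
  show ?thesis
  proof (cases "s \<le> t")
    case True then show ?thesis using * assms by blast
  next
    case False
    then show ?thesis using *[of t s] assms by (simp add: abs_minus_commute)
  qed
qed

text \<open>From \<open>s\<close> to \<open>t\<close> the weights change by amounts with sum
  \<open>m * (t - s)\<close>, so \<open>(t - s) *\<^sub>R w\<close> is the same combination of
  copies of \<open>w / m\<close>. Only steps running between the two times have nonzero weight,
  which allows the hypothesis on the increments to be local in \<open>k\<close>.\<close>

lemma polygon_diff_le:
  assumes st: "s \<in> {0..1}" "t \<in> {0..1}" and m: "m > 0"
    and w: "\<And>k. k < m \<Longrightarrow> \<bar>k / m - s\<bar> \<le> \<bar>t - s\<bar> + 1 / m \<Longrightarrow> norm (z (Suc k) - z k - (1 / m) *\<^sub>R w) \<le> e / m"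
  shows "norm (polygon m z t - polygon m z s - (t - s) *\<^sub>R w) \<le> e * \<bar>t - s\<bar>"
proof -
  define a where "a k = ramp (m * t - real k) - ramp (m * s - real k)" for k
  have 1: "(t - s) *\<^sub>R w = (\<Sum>k<m. a k *\<^sub>R ((1 / m) *\<^sub>R w))"
    unfolding scaleR_sum_left [symmetric] a_def sum_ramp_diff[OF st] using m by simp
  have 2: "polygon m z t - polygon m z s = (\<Sum>k<m. a k *\<^sub>R (z (Suc k) - z k))"
    by (simp add: polygon_def a_def sum_subtractf [symmetric] scaleR_left_diff_distrib)
  have "polygon m z t - polygon m z s - (t - s) *\<^sub>R w = (\<Sum>k<m. a k *\<^sub>R (z (Suc k) - z k - (1 / m) *\<^sub>R w))"
    unfolding 1 2 sum_subtractf [symmetric] by (simp add: scaleR_right_diff_distrib)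
  also have "norm \<dots> \<le> (\<Sum>k<m. \<bar>a k\<bar> * (e / m))"
  proof (rule sum_norm_le)
    fix k assume k: "k \<in> {..<m}"
    show "norm (a k *\<^sub>R (z (Suc k) - z k - (1 / m) *\<^sub>R w)) \<le> \<bar>a k\<bar> * (e / m)"
    proof (cases "a k = 0")
      case False
      \<comment> \<open>A nonzero weight means that the interval from \<open>k\<close> to
        \<open>k + 1\<close> meets the range between \<open>m * s\<close> and
        \<open>m * t\<close>.\<close>
      have "\<bar>real k - m * s\<bar> \<le> \<bar>m * t - m * s\<bar> + 1"
        using False by (auto simp: a_def ramp_def max_def min_def split: if_splits)
      also have "\<dots> = m * (\<bar>t - s\<bar> + 1 / m)"
        using m by (simp add: right_diff_distrib[symmetric] abs_mult distrib_left)
      finally have "\<bar>real k - m * s\<bar> / m \<le> m * (\<bar>t - s\<bar> + 1 / m) / m"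
        by (rule divide_right_mono) simp
      then have "\<bar>real k - m * s\<bar> / m \<le> \<bar>t - s\<bar> + 1 / m"
        using m by (simp only: nonzero_mult_div_cancel_left of_nat_eq_0_iff)
      moreover have "k / m - s = (real k - m * s) / m" using m by (simp add: field_simps)
      then have "\<bar>k / m - s\<bar> = \<bar>real k - m * s\<bar> / m" by (simp add: abs_divide)
      ultimately have "norm (z (Suc k) - z k - (1 / m) *\<^sub>R w) \<le> e / m" using w[of k] k by simp
      then show ?thesis unfolding norm_scaleR by (rule mult_left_mono) simp
    qed auto
  qed
  also have "\<dots> = e * \<bar>t - s\<bar>"
    unfolding sum_distrib_right[symmetric] a_def sum_abs_ramp_diff[OF st] using m by simp
  finally show ?thesis .
qed

lemma polygon_Lipschitz:
  assumes "s \<in> {0..1}" "t \<in> {0..1}" "m > 0"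
    and "\<And>k. k < m \<Longrightarrow> norm (z (Suc k) - z k) \<le> C / m"
  shows "norm (polygon m z t - polygon m z s) \<le> C * \<bar>t - s\<bar>"
  using polygon_diff_le[OF assms(1-3), of z 0 C] assms(4) by simp

lemma polygon_grid:
  assumes "i \<le> m" "m > 0"
  shows "polygon m z (i / m) = z i"
proof -
  have "polygon m z (i / m) = z 0 + (\<Sum>k<m. if k < i then z (Suc k) - z k else 0)"
    using assms by (auto simp: polygon_def ramp_def intro!: sum.cong)
  also have "(\<Sum>k<m. if k < i then z (Suc k) - z k else 0) = (\<Sum>k<i. z (Suc k) - z k)"
    using assms by (intro sum.mono_neutral_cong_right) auto
  also have "\<dots> = z i - z 0" by (rule sum_lessThan_telescope)
  finally show ?thesis by simp
qed

text \<open>\<open>e n\<close> is the consistency error per unit of time. The polygons are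
  equi-Lipschitz, and continuity of \<open>F\<close> identifies the derivative of a uniform limit.
  The bound \<open>K\<close> is asked only where \<open>F\<close> is evaluated, so the last node
  needs no estimate of its own.\<close>

lemma one_step_scheme_limit:
  fixes F :: "'a::euclidean_space \<Rightarrow> 'a" and z :: "nat \<Rightarrow> nat \<Rightarrow> 'a"
  assumes F: "continuous_on UNIV F"
    and m: "filterlim m at_top sequentially" "\<And>n. m n > (0::nat)"
    and K: "\<And>n i. i < m n \<Longrightarrow> norm (z n i) \<le> K"
    and step: "\<And>n i. i < m n \<Longrightarrow> norm (z n (Suc i) - z n i - (1 / m n) *\<^sub>R F (z n i)) \<le> e n / m n"
    and e: "e \<longlonglongrightarrow> 0"
  obtains \<zeta> r where "strict_mono (r :: nat \<Rightarrow> nat)" "integral_curve F {0..1} \<zeta>"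
    "\<And>\<epsilon>. \<epsilon> > 0 \<Longrightarrow> \<forall>\<^sub>F n in sequentially. \<forall>i\<le>m (r n). norm (z (r n) i - \<zeta> (i / m (r n))) < \<epsilon>"
proof -
  have "bounded (F ` cball 0 K)"
    by (intro compact_imp_bounded compact_continuous_image continuous_on_subset[OF F]) auto
  then obtain B where "\<forall>u\<in>cball 0 K. norm (F u) \<le> B"
    by (auto simp: bounded_iff)
  then have B: "norm (F u) \<le> B" if "norm u \<le> K" for u using that by simp
  obtain E where E: "\<And>n. \<bar>e n\<bar> \<le> E"
    using convergent_imp_Bseq[OF convergentI[OF e]] by (auto simp: Bseq_def)
  define C where "C = B + E"
  have stepC: "norm (z n (Suc k) - z n k) \<le> C / m n" if "k < m n" for n k
  proof -
    have "norm (z n (Suc k) - z n k) \<le> norm ((1 / m n) *\<^sub>R F (z n k)) + e n / m n"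
      using step[OF that] norm_triangle_sub[of "z n (Suc k) - z n k" "(1 / m n) *\<^sub>R F (z n k)"] by linarith
    also have "\<dots> \<le> B / m n + E / m n"
      using B[OF K[OF that]] E[of n] by (intro add_mono) (auto simp: divide_right_mono)
    finally show ?thesis by (simp add: C_def add_divide_distrib)
  qed
  define P where "P n = polygon (m n) (z n)" for n
  have lip: "norm (P n t - P n s) \<le> C * \<bar>t - s\<bar>" if "s \<in> {0..1}" "t \<in> {0..1}" for n s t
    unfolding P_def using that m(2) stepC by (intro polygon_Lipschitz)
  have grid: "P n (i / m n) = z n i" if "i \<le> m n" for n i
    unfolding P_def using that m(2) by (intro polygon_grid)
  have C0: "C \<ge> 0" using order_trans[OF norm_ge_zero lip[of 0 1]] by simp
  have PK: "norm (P n t) \<le> K + C" if "t \<in> {0..1}" for n t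
  proof -
    have "norm (P n 0) \<le> K" using K[of 0 n] grid[of 0 n] m(2) by simp
    moreover have "norm (P n t - P n 0) \<le> C"
      using that C0 by (intro order_trans[OF lip]) (auto intro: mult_left_le)
    ultimately show ?thesis using norm_triangle_sub[of "P n t" "P n 0"] by linarith
  qed
  have equi: "\<exists>d>0. \<forall>n y. y \<in> {0..1} \<and> norm (x - y) < d \<longrightarrow> norm (P n x - P n y) < \<epsilon>"
    if "x \<in> {0..1}" "\<epsilon> > 0" for x \<epsilon> :: real
  proof (intro exI[of _ "\<epsilon> / (C + 1)"] conjI allI impI)
    fix n y assume y: "y \<in> {0..1} \<and> norm (x - y) < \<epsilon> / (C + 1)"
    have "norm (P n x - P n y) \<le> C * \<bar>x - y\<bar>" using that y by (intro lip) auto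
    also have "\<dots> \<le> (C + 1) * \<bar>x - y\<bar>" by (intro mult_right_mono) auto
    also have "\<dots> < \<epsilon>" using y C0 by (simp add: field_simps)
    finally show "norm (P n x - P n y) < \<epsilon>" .
  qed (use that C0 in auto)
  obtain \<zeta> r where \<zeta>: "continuous_on {0..1} \<zeta>" "strict_mono (r :: nat \<Rightarrow> nat)"
    and conv: "\<And>\<epsilon>. 0 < \<epsilon> \<Longrightarrow> \<exists>N. \<forall>n x. n \<ge> N \<and> x \<in> {0..1} \<longrightarrow> norm (P (r n) x - \<zeta> x) < \<epsilon>"
    using Arzela_Ascoli[of "{0..1}" P "K + C"] PK equi by (metis (no_types, lifting) compact_Icc)
  have unif: "\<forall>\<^sub>F n in sequentially. \<forall>x\<in>{0..1}. norm (P (r n) x - \<zeta> x) < \<epsilon>" if "\<epsilon> > 0" for \<epsilon>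
    using conv[OF that] unfolding eventually_sequentially by blast
  have mr: "filterlim (\<lambda>n. m (r n)) at_top sequentially"
    using m(1) filterlim_subseq[OF \<zeta>(2)] by (rule filterlim_compose)
  have er: "(\<lambda>n. e (r n)) \<longlonglongrightarrow> 0"
    using LIMSEQ_subseq_LIMSEQ[OF e \<zeta>(2)] by (simp add: o_def)
  have lim: "(\<lambda>n. P (r n) t) \<longlonglongrightarrow> \<zeta> t" if "t \<in> {0..1}" for t
    unfolding tendsto_iff dist_norm
  proof (intro allI impI)
    fix \<epsilon> :: real assume "0 < \<epsilon>"
    from unif[OF this] show "\<forall>\<^sub>F n in sequentially. norm (P (r n) t - \<zeta> t) < \<epsilon>"
      by eventually_elim (use that in blast)
  qed
  show ?thesis
  proof (rule that[OF \<zeta>(2)])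
    show "\<forall>\<^sub>F n in sequentially. \<forall>i\<le>m (r n). norm (z (r n) i - \<zeta> (i / m (r n))) < \<epsilon>" if "\<epsilon> > 0" for \<epsilon>
      using unif[OF that]
    proof eventually_elim
      case (elim n)
      show ?case
      proof (intro allI impI)
        fix i assume i: "i \<le> m (r n)"
        have "real i / m (r n) \<in> {0..1}" using i m(2)[of "r n"] by simp
        then show "norm (z (r n) i - \<zeta> (i / m (r n))) < \<epsilon>" using elim grid[OF i] by metis
      qed
    qed
    show "integral_curve F {0..1} \<zeta>"
      unfolding integral_curve_def has_vector_derivative_def has_derivative_within_alt
    proof (intro ballI conjI allI impI)
      fix s \<epsilon> :: real assume s: "s \<in> {0..1}" and \<epsilon>: "0 < \<epsilon>"
      have "isCont F (\<zeta> s)" using F by (simp add: continuous_on_eq_continuous_at)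
      then obtain \<delta> where \<delta>: "\<delta> > 0" "\<And>u. norm (u - \<zeta> s) < \<delta> \<Longrightarrow> norm (F u - F (\<zeta> s)) < \<epsilon> / 2"
        using \<epsilon> unfolding continuous_at_eps_delta dist_norm by (metis half_gt_zero)
      show "\<exists>d>0. \<forall>t\<in>{0..1}. norm (t - s) < d \<longrightarrow> norm (\<zeta> t - \<zeta> s - (t - s) *\<^sub>R F (\<zeta> s)) \<le> \<epsilon> * norm (t - s)"
      \<comment> \<open>The nodes active between \<open>s\<close> and \<open>t\<close> are within
        \<open>C * \<bar>t - s\<bar> + C / m\<close> of the polygon at \<open>s\<close>, which is
        close to \<open>\<zeta> s\<close>. Each of these three distances is at most
        \<open>\<delta> / 4\<close>; the \<open>+ 1\<close> covers \<open>C = 0\<close>.\<close>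
      proof (intro exI[of _ "\<delta> / (4 * (C + 1))"] conjI ballI impI)
        fix t :: real assume t: "t \<in> {0..1}" "norm (t - s) < \<delta> / (4 * (C + 1))"
        have t': "C * \<bar>t - s\<bar> \<le> \<delta> / 4"
        proof -
          have "C * \<bar>t - s\<bar> \<le> (C + 1) * \<bar>t - s\<bar>" by (intro mult_right_mono) auto
          also have "\<dots> \<le> \<delta> / 4" using t C0 by (simp add: field_simps)
          finally show ?thesis .
        qed
        have "(\<lambda>n. C / m (r n)) \<longlonglongrightarrow> 0"
          by (intro real_tendsto_divide_at_top[OF tendsto_const] filterlim_compose[OF filterlim_real_sequentially mr])
        then have "\<forall>\<^sub>F n in sequentially. C / m (r n) < \<delta> / 4"
          using \<delta>(1) by (intro order_tendstoD) auto
        moreover have "\<forall>\<^sub>F n in sequentially. e (r n) < \<epsilon> / 2"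
          using \<epsilon> by (intro order_tendstoD[OF er]) auto
        moreover have "\<forall>\<^sub>F n in sequentially. \<forall>x\<in>{0..1}. norm (P (r n) x - \<zeta> x) < \<delta> / 4"
          using \<delta>(1) by (intro unif) auto
        ultimately have "\<forall>\<^sub>F n in sequentially. norm (P (r n) t - P (r n) s - (t - s) *\<^sub>R F (\<zeta> s)) \<le> \<epsilon> * norm (t - s)"
        proof eventually_elim
          case (elim n)
          let ?m = "m (r n)"
          have "norm (P (r n) t - P (r n) s - (t - s) *\<^sub>R F (\<zeta> s)) \<le> \<epsilon> * \<bar>t - s\<bar>"
            unfolding P_def
          proof (rule polygon_diff_le)
            fix k assume k: "k < ?m" "\<bar>k / ?m - s\<bar> \<le> \<bar>t - s\<bar> + 1 / ?m"
            have km: "real k / ?m \<in> {0..1}" using k by simp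
            have "norm (z (r n) k - P (r n) s) \<le> C * \<bar>k / ?m - s\<bar>"
              using lip[OF s km, of "r n"] grid[of k "r n"] k by simp
            also have "\<dots> \<le> C * (\<bar>t - s\<bar> + 1 / ?m)" using k C0 by (intro mult_left_mono) auto
            also have "\<dots> = C * \<bar>t - s\<bar> + C / ?m" by (simp add: distrib_left)
            also have "\<dots> \<le> \<delta> / 4 + \<delta> / 4" using t' elim(1) by linarith
            finally have "norm (z (r n) k - \<zeta> s) < \<delta>"
              using elim(3) s \<delta>(1) norm_triangle_ineq[of "z (r n) k - P (r n) s" "P (r n) s - \<zeta> s"] by fastforce
            then have "norm (F (z (r n) k) - F (\<zeta> s)) \<le> \<epsilon> / 2" using \<delta>(2) less_imp_le by blast
            then have 1: "norm ((1 / ?m) *\<^sub>R F (z (r n) k) - (1 / ?m) *\<^sub>R F (\<zeta> s)) \<le> (\<epsilon> / 2) / ?m"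
              unfolding scaleR_diff_right[symmetric] norm_scaleR
              using divide_right_mono[of "norm (F (z (r n) k) - F (\<zeta> s))" "\<epsilon> / 2" "real ?m"] by simp
            have "norm (z (r n) (Suc k) - z (r n) k - (1 / ?m) *\<^sub>R F (\<zeta> s)) \<le> e (r n) / ?m + (\<epsilon> / 2) / ?m"
              using norm_triangle_mono[OF step[OF k(1)] 1] by simp
            also have "\<dots> \<le> \<epsilon> / 2 / ?m + (\<epsilon> / 2) / ?m"
              using elim(2) by (intro add_mono divide_right_mono) auto
            finally show "norm (z (r n) (Suc k) - z (r n) k - (1 / ?m) *\<^sub>R F (\<zeta> s)) \<le> \<epsilon> / ?m"
              by (simp add: field_simps)
          qed (use s t m in auto)
          then show ?case by simp
        qed
        moreover have "(\<lambda>n. norm (P (r n) t - P (r n) s - (t - s) *\<^sub>R F (\<zeta> s))) \<longlonglongrightarrow>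
            norm (\<zeta> t - \<zeta> s - (t - s) *\<^sub>R F (\<zeta> s))"
          using s t by (intro tendsto_intros lim)
        ultimately show "norm (\<zeta> t - \<zeta> s - (t - s) *\<^sub>R F (\<zeta> s)) \<le> \<epsilon> * norm (t - s)"
          by (intro tendsto_upperbound) auto
      qed (use \<delta> C0 in auto)
    qed (simp add: bounded_linear_scaleR_left)
  qed
qed

text \<open>Explicit Euler with step \<open>1 / Suc n\<close> has consistency error 0, and the bound
  \<open>B\<close> keeps all its nodes in one ball.\<close>

theorem Peano_bounded:
  fixes F :: "'a::euclidean_space \<Rightarrow> 'a"
  assumes F: "continuous_on UNIV F" and B: "\<And>u. norm (F u) \<le> B"
  obtains \<zeta> where "integral_curve F {0..1} \<zeta>" "\<zeta> 0 = z0"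
proof -
  define z where "z n i = ((\<lambda>u. u + (1 / Suc n) *\<^sub>R F u) ^^ i) z0" for n i
  have B0: "B \<ge> 0" using order_trans[OF norm_ge_zero B] .
  have zB: "norm (z n i) \<le> norm z0 + real i / Suc n * B" for n i
  proof (induction i)
    case (Suc i)
    have "norm (z n (Suc i)) \<le> norm (z n i) + norm ((1 / Suc n) *\<^sub>R F (z n i))"
      unfolding z_def funpow.simps o_def by (rule norm_triangle_ineq)
    also have "\<dots> \<le> (norm z0 + real i / Suc n * B) + B / Suc n"
      using Suc B[of "z n i"] by (intro add_mono) (auto simp: divide_right_mono)
    finally show ?case by (simp add: add_divide_distrib distrib_right)
  qed (simp add: z_def)
  obtain \<zeta> r where \<zeta>: "strict_mono (r :: nat \<Rightarrow> nat)" "integral_curve F {0..1} \<zeta>"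
    and conv: "\<And>\<epsilon>. \<epsilon> > 0 \<Longrightarrow> \<forall>\<^sub>F n in sequentially. \<forall>i\<le>Suc (r n). norm (z (r n) i - \<zeta> (i / Suc (r n))) < \<epsilon>"
  proof (rule one_step_scheme_limit[OF F, of Suc z "norm z0 + B" "\<lambda>_. 0"])
    show "filterlim Suc at_top sequentially" by (rule filterlim_Suc)
    show "norm (z n i) \<le> norm z0 + B" if "i < Suc n" for n i
    proof -
      have "real i / Suc n * B \<le> 1 * B" using that B0 by (intro mult_right_mono) auto
      then show ?thesis using zB[of n i] by linarith
    qed
    show "norm (z n (Suc i) - z n i - (1 / real (Suc n)) *\<^sub>R F (z n i)) \<le> 0 / real (Suc n)" for n i
      by (simp add: z_def)
  qed auto
  have "\<zeta> 0 = z0"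
  proof (rule ccontr)
    assume "\<zeta> 0 \<noteq> z0"
    then have "\<forall>\<^sub>F n in sequentially. \<forall>i\<le>Suc (r n). norm (z (r n) i - \<zeta> (i / Suc (r n))) < norm (z0 - \<zeta> 0)"
      by (intro conv) auto
    then have "\<forall>\<^sub>F n in sequentially. False"
    proof eventually_elim
      case (elim n) then show ?case by (auto simp: z_def dest: spec[of _ 0])
    qed
    then show False by simp
  qed
  then show ?thesis using that \<zeta> by blast
qed

section \<open>Gluing and extending integral curves\<close>

lemma integral_curve_subset: "integral_curve F J \<zeta> \<Longrightarrow> I \<subseteq> J \<Longrightarrow> integral_curve F I \<zeta>"
  unfolding integral_curve_def by (meson has_vector_derivative_within_subset subsetD)

lemma integral_curve_shift:
  assumes "integral_curve F {a..b} \<zeta>"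
  shows "integral_curve F {a + c..b + c} (\<lambda>t. \<zeta> (t - c))"
  unfolding integral_curve_def
proof
  fix t assume t: "t \<in> {a + c..b + c}"
  have im: "(\<lambda>t. t - c) ` {a + c..b + c} = {a..b}" by force
  have "((\<lambda>t. t - c) has_vector_derivative 1) (at t within {a + c..b + c})"
    by (auto intro!: derivative_eq_intros)
  moreover have "(\<zeta> has_vector_derivative F (\<zeta> (t - c))) (at (t - c) within (\<lambda>t. t - c) ` {a + c..b + c})"
    unfolding im using assms t by (auto simp: integral_curve_def)
  ultimately show "((\<lambda>t. \<zeta> (t - c)) has_vector_derivative F (\<zeta> (t - c))) (at t within {a + c..b + c})"
    using vector_diff_chain_within[of "\<lambda>t. t - c" 1 t "{a + c..b + c}" \<zeta>] by (simp add: o_def)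
qed

lemma has_vector_derivative_join:
  assumes "\<And>t. t \<in> {a..b} \<Longrightarrow> (\<gamma> has_vector_derivative D t) (at t within {a..b})"
    and "\<And>t. t \<in> {b..c} \<Longrightarrow> (\<eta> has_vector_derivative E t) (at t within {b..c})"
    and "\<gamma> b = \<eta> b" "D b = E b" "a \<le> b" "b \<le> c" and t: "t \<in> {a..c}"
  shows "((\<lambda>t. if t \<le> b then \<gamma> t else \<eta> t) has_vector_derivative (if t \<le> b then D t else E t))
    (at t within {a..c})"
proof -
  have U: "{a..c} = {a..b} \<union> {b..c}" using assms by auto
  have "((\<lambda>x. if x \<in> {a..b} then \<gamma> x else \<eta> x) has_vector_derivative
      (if t \<in> {a..b} then D t else E t)) (at t within {a..c})"
  proof (rule has_vector_derivative_If_within_closures[where T = "{b..c}"])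
    have e: "{a..b} \<union> closure {a..b} \<inter> closure {b..c} = {a..b}"
        "{b..c} \<union> closure {a..b} \<inter> closure {b..c} = {b..c}"
      using assms by auto
    show "t \<in> {a..b} \<union> closure {a..b} \<inter> closure {b..c} \<Longrightarrow> (\<gamma> has_vector_derivative D t)
       (at t within {a..b} \<union> closure {a..b} \<inter> closure {b..c})"
      unfolding e using assms(1) .
    show "t \<in> {b..c} \<union> closure {a..b} \<inter> closure {b..c} \<Longrightarrow> (\<eta> has_vector_derivative E t)
       (at t within {b..c} \<union> closure {a..b} \<inter> closure {b..c})"
      unfolding e using assms(2) .
    show "t \<in> {a..b} \<union> {b..c}" using t U by simp
    show "t \<in> closure {a..b} \<Longrightarrow> t \<in> closure {b..c} \<Longrightarrow> \<gamma> t = \<eta> t"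
      "t \<in> closure {a..b} \<Longrightarrow> t \<in> closure {b..c} \<Longrightarrow> D t = E t"
      using assms by (auto dest: antisym)
  qed (rule U)
  then have "((\<lambda>x. if x \<le> b then \<gamma> x else \<eta> x) has_vector_derivative
      (if t \<in> {a..b} then D t else E t)) (at t within {a..c})"
    by (rule has_vector_derivative_transform[rotated 2]) (use t in auto)
  then show ?thesis using t by (auto split: if_splits)
qed

lemma integral_curve_join:
  assumes "integral_curve F {a..b} \<zeta>" "integral_curve F {b..c} \<eta>" "\<zeta> b = \<eta> b" "a \<le> b" "b \<le> c"
  shows "integral_curve F {a..c} (\<lambda>t. if t \<le> b then \<zeta> t else \<eta> t)"
proof -
  have "((\<lambda>t. if t \<le> b then \<zeta> t else \<eta> t) has_vector_derivative (if t \<le> b then F (\<zeta> t) else F (\<eta> t)))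
      (at t within {a..c})" if "t \<in> {a..c}" for t
    using assms that by (intro has_vector_derivative_join) (auto simp: integral_curve_def)
  then show ?thesis by (simp add: integral_curve_def if_distrib[of F])
qed

text \<open>Solutions may branch, so solutions chosen separately on growing intervals need not fit
  together; each is therefore chosen as an extension of its predecessor. The existence time 1 is the
  same for all starting points, so every stage gains a unit of time at both ends.\<close>

lemma integral_curve_global:
  fixes F :: "'a::real_normed_vector \<Rightarrow> 'a"
  assumes fwd: "\<And>u. \<exists>\<zeta>. integral_curve F {0..1} \<zeta> \<and> \<zeta> 0 = u"
    and bwd: "\<And>u. \<exists>\<zeta>. integral_curve F {-1..0} \<zeta> \<and> \<zeta> 0 = u"
  obtains \<zeta> where "integral_curve F UNIV \<zeta>" "\<zeta> 0 = z0"
proof -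
  let ?J = "\<lambda>n. {- real n..real n}"
  define Q where "Q n \<zeta> \<longleftrightarrow> integral_curve F (?J n) \<zeta> \<and> \<zeta> 0 = z0" for n \<zeta>
  have "\<exists>\<zeta>. \<forall>n. Q (Suc n) (\<zeta> n) \<and> (\<forall>t\<in>?J (Suc n). \<zeta> (Suc n) t = \<zeta> n t)"
  proof (rule dependent_nat_choice)
    obtain \<zeta> \<eta> where \<zeta>: "integral_curve F {0..1} \<zeta>" "\<zeta> 0 = z0"
      and \<eta>: "integral_curve F {-1..0} \<eta>" "\<eta> 0 = z0"
      using fwd bwd by metis
    have "integral_curve F {-1..1} (\<lambda>t. if t \<le> 0 then \<eta> t else \<zeta> t)"
      using \<zeta> \<eta> by (intro integral_curve_join) auto
    then show "\<exists>\<zeta>. Q (Suc 0) \<zeta>"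
      using \<eta> by (intro exI[of _ "\<lambda>t. if t \<le> 0 then \<eta> t else \<zeta> t"]) (auto simp: Q_def)
  next
    fix \<theta> n assume \<theta>: "Q (Suc n) \<theta>"
    define N where "N = real (Suc n)"
    have N: "N > 0" "integral_curve F {-N..N} \<theta>" "\<theta> 0 = z0" using \<theta> by (auto simp: Q_def N_def)
    obtain \<zeta> \<eta> where \<zeta>: "integral_curve F {0..1} \<zeta>" "\<zeta> 0 = \<theta> N"
      and \<eta>: "integral_curve F {-1..0} \<eta>" "\<eta> 0 = \<theta> (-N)"
      using fwd bwd by metis
    have 1: "integral_curve F {N..N+1} (\<lambda>t. \<zeta> (t - N))"
      using integral_curve_shift[OF \<zeta>(1), of N] by (simp add: add.commute)
    have 2: "integral_curve F {-(N+1)..-N} (\<lambda>t. \<eta> (t - (- N)))"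
      using integral_curve_shift[OF \<eta>(1), of "-N"] by (simp add: add.commute)
    define \<theta>1 where "\<theta>1 = (\<lambda>t. if t \<le> N then \<theta> t else \<zeta> (t - N))"
    have 3: "integral_curve F {-N..N+1} \<theta>1"
      unfolding \<theta>1_def using 1 N \<zeta> by (intro integral_curve_join) auto
    define \<theta>2 where "\<theta>2 = (\<lambda>t. if t \<le> -N then \<eta> (t - (-N)) else \<theta>1 t)"
    have 4: "integral_curve F {-(N+1)..N+1} \<theta>2"
      unfolding \<theta>2_def using 2 3 N \<eta> by (intro integral_curve_join) (auto simp: \<theta>1_def)
    have "Q (Suc (Suc n)) \<theta>2 \<and> (\<forall>t\<in>?J (Suc n). \<theta>2 t = \<theta> t)"
    proof
      have "real (Suc (Suc n)) = N + 1" by (simp add: N_def)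
      moreover have "\<theta>2 0 = z0" using N by (simp add: \<theta>2_def \<theta>1_def)
      ultimately show "Q (Suc (Suc n)) \<theta>2" unfolding Q_def using 4 by metis
      have "\<theta>2 t = \<theta> t" if "t \<in> {-N..N}" for t
        using that \<eta> N by (auto simp: \<theta>2_def \<theta>1_def)
      then show "\<forall>t\<in>?J (Suc n). \<theta>2 t = \<theta> t" by (simp add: N_def)
    qed
    then show "\<exists>\<theta>'. Q (Suc (Suc n)) \<theta>' \<and> (\<forall>t\<in>?J (Suc n). \<theta>' t = \<theta> t)" by blast
  qed
  then obtain \<zeta> where \<zeta>: "\<And>n. Q (Suc n) (\<zeta> n)" "\<And>n t. t \<in> ?J (Suc n) \<Longrightarrow> \<zeta> (Suc n) t = \<zeta> n t"
    by metis
  have agree: "\<zeta> (n + k) t = \<zeta> n t" if "t \<in> ?J (Suc n)" for n k t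
  proof (induction k)
    case (Suc k)
    have "t \<in> ?J (Suc (n + k))" using that by auto
    then show ?case using \<zeta>(2)[of t "n + k"] Suc by simp
  qed simp
  have agree': "\<zeta> i t = \<zeta> j t" if "t \<in> ?J (Suc i)" "t \<in> ?J (Suc j)" for i j t
    using agree[OF that(1), of "j - i"] agree[OF that(2), of "i - j"] by (cases "i \<le> j") auto
  define \<phi> where "\<phi> t = \<zeta> (nat \<lceil>\<bar>t\<bar>\<rceil>) t" for t
  have \<phi>: "\<phi> t = \<zeta> n t" if "t \<in> ?J (Suc n)" for t n
    unfolding \<phi>_def using that by (intro agree') (auto, linarith+)
  have "integral_curve F UNIV \<phi>"
    unfolding integral_curve_def
  proof
    fix t :: real
    define n where "n = nat \<lceil>\<bar>t\<bar>\<rceil>"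
    \<comment> \<open>Stage \<open>n\<close> lives on radius \<open>Suc n\<close>, so
      \<open>t\<close> is an interior point and the derivative within the interval is a full
      derivative.\<close>
    have t: "t \<in> {- real (Suc n)<..<real (Suc n)}" unfolding n_def by (auto; linarith)
    have "(\<zeta> n has_vector_derivative F (\<zeta> n t)) (at t within ?J (Suc n))"
      using \<zeta>(1)[of n] t by (auto simp: Q_def integral_curve_def)
    then have "(\<zeta> n has_vector_derivative F (\<zeta> n t)) (at t)"
      using t at_within_interior[of t "?J (Suc n)"] by (simp add: interior_cbox)
    then have "(\<phi> has_vector_derivative F (\<zeta> n t)) (at t)"
    proof (rule has_vector_derivative_transform_within_open[OF _ open_greaterThanLessThan t])
      show "\<zeta> n y = \<phi> y" if "y \<in> {- real (Suc n)<..<real (Suc n)}" for y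
        using that by (intro \<phi>[symmetric]) auto
    qed
    then show "(\<phi> has_vector_derivative F (\<phi> t)) (at t)"
      using \<phi>[of t n] t by simp
  qed
  moreover have "\<phi> 0 = z0" using \<phi>[of 0 0] \<zeta>(1)[of 0] by (simp add: Q_def)
  ultimately show ?thesis using that by blast
qed

subsection \<open>Curves, length and distance\<close>

text \<open>In contrast to \<open>C1_curve\<close> the derivative is named and \<open>a < b\<close>
  is not demanded, so pieces of a curve may shrink to a point.\<close>

definition has_velocity :: "real \<Rightarrow> real \<Rightarrow> (real \<Rightarrow> 'a::real_normed_vector) \<Rightarrow> (real \<Rightarrow> 'a) \<Rightarrow> bool" where
  "has_velocity a b \<gamma> D \<longleftrightarrow>
    (\<forall>t\<in>{a..b}. (\<gamma> has_vector_derivative D t) (at t within {a..b})) \<and> continuous_on {a..b} D"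

lemma C1_curve_iff: "C1_curve a b \<gamma> \<longleftrightarrow> a < b \<and> (\<exists>D. has_velocity a b \<gamma> D)"
  by (auto simp: C1_curve_def has_velocity_def)

lemma has_velocity_subset:
  assumes "has_velocity a b \<gamma> D" "a \<le> c" "d \<le> b"
  shows "has_velocity c d \<gamma> D"
proof -
  have "{c..d} \<subseteq> {a..b}" using assms by auto
  then show ?thesis using assms(1) unfolding has_velocity_def
    by (meson continuous_on_subset has_vector_derivative_within_subset subsetD)
qed

lemma has_velocity_continuous: "has_velocity a b \<gamma> D \<Longrightarrow> continuous_on {a..b} \<gamma>"
  unfolding has_velocity_def continuous_on_eq_continuous_within
  using has_vector_derivative_continuous by blast

lemma has_velocity_displacement:
  fixes \<gamma> :: "real \<Rightarrow> 'a::banach"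
  assumes "has_velocity a b \<gamma> D" "a \<le> b"
  shows "(D has_integral \<gamma> b - \<gamma> a) {a..b}"
  using assms by (intro fundamental_theorem_of_calculus) (auto simp: has_velocity_def)

lemma has_velocity_join:
  assumes "has_velocity a b \<gamma> D" "has_velocity b c \<eta> E" "\<gamma> b = \<eta> b" "D b = E b" "a \<le> b" "b \<le> c"
  shows "has_velocity a c (\<lambda>t. if t \<le> b then \<gamma> t else \<eta> t) (\<lambda>t. if t \<le> b then D t else E t)"
  unfolding has_velocity_def
proof (intro conjI ballI)
  fix t assume "t \<in> {a..c}"
  then show "((\<lambda>t. if t \<le> b then \<gamma> t else \<eta> t) has_vector_derivative (if t \<le> b then D t else E t))
    (at t within {a..c})"
    using assms by (intro has_vector_derivative_join) (auto simp: has_velocity_def)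
next
  have "continuous_on ({a..b} \<union> {b..c}) (\<lambda>t. if t \<le> b then D t else E t)"
    using assms by (intro continuous_on_cases) (auto simp: has_velocity_def)
  moreover have "{a..b} \<union> {b..c} = {a..c}" using assms by auto
  ultimately show "continuous_on {a..c} (\<lambda>t. if t \<le> b then D t else E t)" by simp
qed

text \<open>In a constant metric the straight segment is shortest: the velocity is paired with the
  displacement in the inner product of \<open>A\<close>, Cauchy-Schwarz is applied under the
  integral, and the norm of the displacement is cancelled. It is used with the metric frozen at a
  vertex of a chain.\<close>

lemma SPD_norm_displacement_le:
  assumes A: "A \<in> SPD" and v: "has_velocity a b \<gamma> D" "a \<le> b"
  shows "sqrt ((\<gamma> b - \<gamma> a) \<bullet> (A *v (\<gamma> b - \<gamma> a))) \<le> integral {a..b} (\<lambda>t. sqrt (D t \<bullet> (A *v D t)))"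
proof -
  define q where "q w = sqrt (w \<bullet> (A *v w))" for w
  define \<Delta> where "\<Delta> = \<gamma> b - \<gamma> a"
  have D: "continuous_on {a..b} D" using v by (simp add: has_velocity_def)
  have int: "(\<lambda>t. q (D t)) integrable_on {a..b}" unfolding q_def
    by (intro integrable_continuous_real continuous_intros D)
  have q0: "q w \<ge> 0" for w using SPD_nonneg[OF A] by (simp add: q_def)
  have "((\<lambda>t. \<Delta> \<bullet> (A *v D t)) has_integral \<Delta> \<bullet> (A *v \<Delta>)) {a..b}"
    using has_integral_linear[OF has_velocity_displacement[OF v], of "\<lambda>w. \<Delta> \<bullet> (A *v w)"]
    by (simp add: o_def \<Delta>_def bounded_linear_compose[OF bounded_linear_inner_right matrix_vector_mul_bounded_linear])
  moreover have "((\<lambda>t. q \<Delta> * q (D t)) has_integral q \<Delta> * integral {a..b} (\<lambda>t. q (D t))) {a..b}"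
    using has_integral_mult_right[OF integrable_integral[OF int]] .
  ultimately have "\<Delta> \<bullet> (A *v \<Delta>) \<le> q \<Delta> * integral {a..b} (\<lambda>t. q (D t))"
    by (rule has_integral_le) (simp add: q_def SPD_Cauchy_Schwarz[OF A])
  moreover have "\<Delta> \<bullet> (A *v \<Delta>) = q \<Delta> * q \<Delta>" using SPD_nonneg[OF A] by (simp add: q_def)
  moreover have "integral {a..b} (\<lambda>t. q (D t)) \<ge> 0" using q0 int by (intro integral_nonneg) auto
  ultimately have "q \<Delta> \<le> integral {a..b} (\<lambda>t. q (D t))"
    using q0[of \<Delta>] by (cases "q \<Delta> = 0") (auto simp: mult_le_cancel_left)
  then show ?thesis by (simp add: q_def \<Delta>_def)
qed

locale riemannian =
  fixes g :: "real ^ 'n \<Rightarrow> real ^ 'n ^ 'n"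
  assumes SPD: "g x \<in> SPD" and cont: "continuous_on UNIV g"
begin

lemma continuous_on_metric [continuous_intros]: "continuous_on S f \<Longrightarrow> continuous_on S (\<lambda>x. g (f x))"
  by (rule continuous_on_compose2[OF cont]) auto

definition speed :: "real ^ 'n \<Rightarrow> real ^ 'n \<Rightarrow> real" where
  "speed x w = sqrt (w \<bullet> (g x *v w))"

lemma speed_nonneg: "speed x w \<ge> 0"
  using SPD_nonneg[OF SPD] by (simp add: speed_def)

lemma speed_sq: "(speed x w)\<^sup>2 = w \<bullet> (g x *v w)"
  using SPD_nonneg[OF SPD] by (simp add: speed_def)

lemma speed_scale: "c \<ge> 0 \<Longrightarrow> speed x (c *\<^sub>R w) = c * speed x w"
  by (simp add: speed_def matrix_vector_mult_scaleR real_sqrt_mult)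

lemma speed_zero [simp]: "speed x 0 = 0"
  by (simp add: speed_def)

lemma continuous_on_speed [continuous_intros]:
  "continuous_on S f \<Longrightarrow> continuous_on S h \<Longrightarrow> continuous_on S (\<lambda>x. speed (f x) (h x))"
  unfolding speed_def by (intro continuous_intros)

lemma continuous_on_speed_curve:
  "has_velocity a b \<gamma> D \<Longrightarrow> continuous_on {a..b} (\<lambda>t. speed (\<gamma> t) (D t))"
  by (rule continuous_on_speed[OF has_velocity_continuous]) (simp_all add: has_velocity_def)

lemma speed_integrable:
  assumes "has_velocity a b \<gamma> D" "a \<le> c" "d \<le> b"
  shows "(\<lambda>t. speed (\<gamma> t) (D t)) integrable_on {c..d}"
  by (intro integrable_continuous_real continuous_on_speed_curve has_velocity_subset[OF assms])

lemma riem_length_eq: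
  assumes "has_velocity a b \<gamma> D"
  shows "riem_length g a b \<gamma> = integral {a..b} (\<lambda>t. speed (\<gamma> t) (D t))"
proof (cases "a < b")
  case True
  have "vector_derivative \<gamma> (at t within {a..b}) = D t" if "t \<in> {a..b}" for t
    using assms that True vector_derivative_within_cbox[of a b t \<gamma> "D t"] by (auto simp: has_velocity_def)
  then show ?thesis by (auto simp: riem_length_def Let_def speed_def intro!: integral_cong)
next
  case False
  \<comment> \<open>On a one-point interval \<open>vector_derivative\<close> need not be
    \<open>D\<close>, but integrals over a null set vanish.\<close>
  then have "measure lborel {a..b} = 0" by simp
  then have "integral {a..b} f = 0" for f :: "real \<Rightarrow> real"
    by (rule integral_unique[OF has_integral_null_real])
  then show ?thesis by (simp only: riem_length_def)
qed

lemma riem_length_nonneg: "has_velocity a b \<gamma> D \<Longrightarrow> riem_length g a b \<gamma> \<ge> 0"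
  unfolding riem_length_eq by (intro integral_nonneg speed_integrable) (auto simp: speed_nonneg)

lemma riem_length_combine:
  assumes "has_velocity a b \<gamma> D" "a \<le> c" "c \<le> b"
  shows "riem_length g a b \<gamma> = riem_length g a c \<gamma> + riem_length g c b \<gamma>"
proof -
  have v: "has_velocity a c \<gamma> D" "has_velocity c b \<gamma> D"
    using assms by (auto intro: has_velocity_subset)
  show ?thesis unfolding riem_length_eq[OF assms(1)] v[THEN riem_length_eq]
    using assms speed_integrable[OF assms(1)] by (intro Henstock_Kurzweil_Integration.integral_combine[symmetric]) auto
qed

lemma riem_length_subset_le:
  assumes v: "has_velocity a b \<gamma> D" and "a \<le> s" "s \<le> t" "t \<le> b"
  shows "riem_length g s t \<gamma> \<le> riem_length g a b \<gamma>"
proof -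
  have "riem_length g a b \<gamma> = riem_length g a s \<gamma> + (riem_length g s t \<gamma> + riem_length g t b \<gamma>)"
    using assms riem_length_combine[OF v, of s] riem_length_combine[OF has_velocity_subset[OF v, of s b], of t] by simp
  moreover have "riem_length g a s \<gamma> \<ge> 0" "riem_length g t b \<gamma> \<ge> 0"
    using assms by (auto intro!: riem_length_nonneg[OF has_velocity_subset[OF v]])
  ultimately show ?thesis by linarith
qed

lemma norm_displacement_le_length:
  assumes v: "has_velocity a b \<gamma> D" "a \<le> b" and c: "c > 0"
    "\<And>t w. t \<in> {a..b} \<Longrightarrow> c * (norm w)\<^sup>2 \<le> w \<bullet> (g (\<gamma> t) *v w)"
  shows "sqrt c * norm (\<gamma> b - \<gamma> a) \<le> riem_length g a b \<gamma>"
proof -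
  have "norm (integral {a..b} D) \<le> integral {a..b} (\<lambda>t. speed (\<gamma> t) (D t) / sqrt c)"
  proof (rule integral_norm_bound_integral)
    show "D integrable_on {a..b}" using has_velocity_displacement[OF v] by blast
    show "(\<lambda>t. speed (\<gamma> t) (D t) / sqrt c) integrable_on {a..b}"
      using speed_integrable[OF v(1)] by (auto intro: integrable_on_divide)
    show "norm (D t) \<le> speed (\<gamma> t) (D t) / sqrt c" if "t \<in> {a..b}" for t
    proof -
      have "sqrt (c * (norm (D t))\<^sup>2) \<le> speed (\<gamma> t) (D t)"
        unfolding speed_def by (rule real_sqrt_le_mono[OF c(2)[OF that]])
      then show ?thesis using c(1) by (simp add: real_sqrt_mult pos_le_divide_eq mult.commute)
    qed
  qed
  also have "\<dots> = riem_length g a b \<gamma> / sqrt c"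
    unfolding riem_length_eq[OF v(1)] by simp
  finally show ?thesis using c(1) integral_unique[OF has_velocity_displacement[OF v]]
    by (simp add: pos_le_divide_eq mult.commute)
qed

text \<open>The velocity is made to vanish at both ends, so that curves can be concatenated
  without leaving the class of \<open>C\<^sup>1\<close> curves.\<close>

lemma flat_reparametrization:
  assumes v: "has_velocity a b \<gamma> D" "a \<le> b"
  obtains \<eta> E where "has_velocity c (c + 1) \<eta> E" "\<eta> c = \<gamma> a" "\<eta> (c + 1) = \<gamma> b" "E c = 0" "E (c + 1) = 0"
    "riem_length g c (c + 1) \<eta> = riem_length g a b \<gamma>"
proof -
  \<comment> \<open>The cubic \<open>3 u^2 - 2 u^3\<close> increases from 0 to 1, and its derivative
    \<open>6 u (1 - u)\<close> vanishes at both ends.\<close>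
  define \<phi> where "\<phi> t = a + (b - a) * (3 * (t - c)\<^sup>2 - 2 * (t - c) ^ 3)" for t
  define \<phi>' where "\<phi>' t = (b - a) * (6 * (t - c) * (1 - (t - c)))" for t
  have \<phi>': "(\<phi> has_real_derivative \<phi>' t) (at t within S)" for t S
    unfolding \<phi>_def \<phi>'_def by (auto intro!: derivative_eq_intros simp: power2_eq_square algebra_simps)
  have pos: "\<phi>' t \<ge> 0" if "t \<in> {c..c + 1}" for t
    using that v(2) by (auto simp: \<phi>'_def)
  have \<phi>c: "\<phi> c = a" "\<phi> (c + 1) = b" by (auto simp: \<phi>_def)
  have mono: "\<phi> s \<le> \<phi> t" if "c \<le> s" "s \<le> t" "t \<le> c + 1" for s t
    using that pos \<phi>' by (intro DERIV_nonneg_imp_nondecreasing[of s t \<phi>]) (auto intro!: exI[of _ "\<phi>' _"])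
  have im: "\<phi> ` {c..c + 1} \<subseteq> {a..b}"
    using mono[of c] mono[of _ "c + 1"] by (auto simp: \<phi>c)
  have cont\<phi>: "continuous_on {c..c + 1} \<phi>" "continuous_on {c..c + 1} \<phi>'"
    unfolding \<phi>_def \<phi>'_def by (intro continuous_intros)+
  define \<eta> where "\<eta> = \<gamma> \<circ> \<phi>"
  define E where "E t = \<phi>' t *\<^sub>R D (\<phi> t)" for t
  have D: "continuous_on {a..b} D" using v by (simp add: has_velocity_def)
  have vel: "has_velocity c (c + 1) \<eta> E"
    unfolding has_velocity_def
  proof (intro conjI ballI)
    fix t assume t: "t \<in> {c..c + 1}"
    have "(\<gamma> has_vector_derivative D (\<phi> t)) (at (\<phi> t) within \<phi> ` {c..c + 1})"
      using v(1) im t unfolding has_velocity_def by (meson has_vector_derivative_within_subset imageI subsetD)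
    then show "(\<eta> has_vector_derivative E t) (at t within {c..c + 1})"
      unfolding \<eta>_def E_def using \<phi>' by (intro vector_diff_chain_within) (auto simp: has_real_derivative_iff_has_vector_derivative)
  next
    show "continuous_on {c..c + 1} E"
      unfolding E_def by (intro continuous_intros cont\<phi> continuous_on_compose2[OF D] im)
  qed
  have "((\<lambda>t. \<phi>' t *\<^sub>R speed (\<gamma> (\<phi> t)) (D (\<phi> t))) has_integral integral {\<phi> c..\<phi> (c + 1)} (\<lambda>t. speed (\<gamma> t) (D t))) {c..c + 1}"
    by (rule has_integral_substitution[OF _ _ im continuous_on_speed_curve[OF v(1)] \<phi>'])
      (use v in \<open>auto simp: \<phi>c\<close>)
  then have "integral {c..c + 1} (\<lambda>t. \<phi>' t *\<^sub>R speed (\<gamma> (\<phi> t)) (D (\<phi> t))) = riem_length g a b \<gamma>"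
    unfolding riem_length_eq[OF v(1)] \<phi>c by (rule integral_unique)
  moreover have "integral {c..c + 1} (\<lambda>t. \<phi>' t *\<^sub>R speed (\<gamma> (\<phi> t)) (D (\<phi> t))) = riem_length g c (c + 1) \<eta>"
    unfolding riem_length_eq[OF vel] using pos by (intro integral_cong) (simp add: E_def speed_scale \<eta>_def)
  ultimately have "riem_length g c (c + 1) \<eta> = riem_length g a b \<gamma>" by simp
  then show ?thesis using that[OF vel] by (simp add: \<eta>_def \<phi>c E_def \<phi>'_def)
qed

lemma concatenate:
  assumes 1: "has_velocity a b \<gamma> D" "a \<le> b" and 2: "has_velocity a' b' \<gamma>' D'" "a' \<le> b'" and eq: "\<gamma> b = \<gamma>' a'"
  obtains \<eta> where "C1_curve 0 2 \<eta>" "\<eta> 0 = \<gamma> a" "\<eta> 2 = \<gamma>' b'"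
    "riem_length g 0 2 \<eta> = riem_length g a b \<gamma> + riem_length g a' b' \<gamma>'"
proof -
  obtain \<eta> E where \<eta>: "has_velocity 0 1 \<eta> E" "\<eta> 0 = \<gamma> a" "\<eta> 1 = \<gamma> b" "E 1 = 0"
    "riem_length g 0 1 \<eta> = riem_length g a b \<gamma>"
    using flat_reparametrization[OF 1, of 0] by (metis add_0)
  obtain \<eta>' E' where \<eta>': "has_velocity 1 2 \<eta>' E'" "\<eta>' 1 = \<gamma>' a'" "\<eta>' 2 = \<gamma>' b'" "E' 1 = 0"
    "riem_length g 1 2 \<eta>' = riem_length g a' b' \<gamma>'"
    using flat_reparametrization[OF 2, of 1] by (metis one_add_one)
  define \<theta> where "\<theta> = (\<lambda>t. if t \<le> 1 then \<eta> t else \<eta>' t)"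
  define T where "T = (\<lambda>t. if t \<le> 1 then E t else E' t)"
  have \<theta>: "has_velocity 0 2 \<theta> T"
    unfolding \<theta>_def T_def using \<eta> \<eta>' eq by (intro has_velocity_join) auto
  then have \<theta>1: "has_velocity 0 1 \<theta> T" and \<theta>2: "has_velocity 1 2 \<theta> T"
    by (auto intro: has_velocity_subset)
  have "riem_length g 0 1 \<theta> = riem_length g 0 1 \<eta>"
    unfolding riem_length_eq[OF \<theta>1] riem_length_eq[OF \<eta>(1)] by (intro integral_cong) (auto simp: \<theta>_def T_def)
  moreover have "riem_length g 1 2 \<theta> = riem_length g 1 2 \<eta>'"
    unfolding riem_length_eq[OF \<theta>2] riem_length_eq[OF \<eta>'(1)] using \<eta> \<eta>' eq
    by (intro integral_cong) (auto simp: \<theta>_def T_def dest: antisym)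
  ultimately have "riem_length g 0 2 \<theta> = riem_length g a b \<gamma> + riem_length g a' b' \<gamma>'"
    using riem_length_combine[OF \<theta>, of 1] \<eta> \<eta>' by simp
  then show ?thesis using \<theta> that[of \<theta>] \<eta> \<eta>' by (auto simp: C1_curve_iff \<theta>_def)
qed

abbreviation lengths :: "real ^ 'n \<Rightarrow> real ^ 'n \<Rightarrow> real set" where
  "lengths x y \<equiv> {riem_length g a b \<gamma> | a b \<gamma>. C1_curve a b \<gamma> \<and> \<gamma> a = x \<and> \<gamma> b = y}"

lemma lengths_nonneg: "l \<in> lengths x y \<Longrightarrow> l \<ge> 0"
  by (auto simp: C1_curve_iff intro: riem_length_nonneg)

lemma bdd_below_lengths: "bdd_below (lengths x y)"
  using lengths_nonneg by (intro bdd_belowI[of _ 0]) blast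

lemma has_velocity_segment: "has_velocity a b (\<lambda>t. x + t *\<^sub>R w) (\<lambda>_. w)"
  by (auto simp: has_velocity_def intro!: derivative_eq_intros)

lemma lengths_nonempty: "lengths x y \<noteq> {}"
proof -
  have "C1_curve 0 1 (\<lambda>t. x + t *\<^sub>R (y - x))"
    using has_velocity_segment[of 0 1 x "y - x"] unfolding C1_curve_iff by (metis zero_less_one)
  then have "riem_length g 0 1 (\<lambda>t. x + t *\<^sub>R (y - x)) \<in> lengths x y"
    by (intro CollectI exI[of _ 0] exI[of _ 1] exI[of _ "\<lambda>t. x + t *\<^sub>R (y - x)"]) auto
  then show ?thesis by blast
qed

lemma riem_dist_le:
  assumes "has_velocity a b \<gamma> D" "a < b"
  shows "riem_dist g (\<gamma> a) (\<gamma> b) \<le> riem_length g a b \<gamma>"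
  unfolding riem_dist_def using assms by (intro cInf_lower bdd_below_lengths) (auto simp: C1_curve_iff)

lemma riem_dist_nonneg: "riem_dist g x y \<ge> 0"
  unfolding riem_dist_def by (intro cInf_greatest lengths_nonempty) (rule lengths_nonneg)

lemma riem_dist_approx:
  assumes "e > 0"
  obtains a b \<gamma> D where "has_velocity a b \<gamma> D" "a < b" "\<gamma> a = x" "\<gamma> b = y"
    "riem_length g a b \<gamma> < riem_dist g x y + e"
proof -
  have "\<exists>l\<in>lengths x y. l < riem_dist g x y + e"
    unfolding riem_dist_def using assms
    by (intro iffD1[OF cInf_less_iff[OF lengths_nonempty bdd_below_lengths]]) simp
  then obtain a b \<gamma> where "C1_curve a b \<gamma>" "\<gamma> a = x" "\<gamma> b = y" "riem_length g a b \<gamma> < riem_dist g x y + e"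
    by blast
  then show ?thesis using that unfolding C1_curve_iff by blast
qed

lemma riem_dist_refl: "riem_dist g x x = 0"
proof -
  have "riem_dist g x x \<le> riem_length g 0 1 (\<lambda>t. x + t *\<^sub>R 0)"
    using riem_dist_le[OF has_velocity_segment[of 0 1 x 0]] by simp
  also have "\<dots> = 0" unfolding riem_length_eq[OF has_velocity_segment] by simp
  finally show ?thesis using riem_dist_nonneg[of x x] by simp
qed

lemma riem_dist_triangle: "riem_dist g x z \<le> riem_dist g x y + riem_dist g y z"
proof (rule field_le_epsilon)
  fix e :: real assume e: "e > 0"
  then have e2: "e / 2 > 0" by simp
  obtain a b \<gamma> D where 1: "has_velocity a b \<gamma> D" "a < b" "\<gamma> a = x" "\<gamma> b = y"
    "riem_length g a b \<gamma> < riem_dist g x y + e / 2" by (rule riem_dist_approx[OF e2])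
  obtain a' b' \<gamma>' D' where 2: "has_velocity a' b' \<gamma>' D'" "a' < b'" "\<gamma>' a' = y" "\<gamma>' b' = z"
    "riem_length g a' b' \<gamma>' < riem_dist g y z + e / 2" by (rule riem_dist_approx[OF e2])
  obtain \<eta> where \<eta>: "C1_curve 0 2 \<eta>" "\<eta> 0 = x" "\<eta> 2 = z"
    "riem_length g 0 2 \<eta> = riem_length g a b \<gamma> + riem_length g a' b' \<gamma>'"
    by (rule concatenate[OF 1(1) _ 2(1)]) (use 1 2 in simp_all)
  have "riem_dist g (\<eta> 0) (\<eta> 2) \<le> riem_length g 0 2 \<eta>"
    using \<eta>(1) riem_dist_le unfolding C1_curve_iff by blast
  then show "riem_dist g x z \<le> riem_dist g x y + riem_dist g y z + e" using 1(5) 2(5) \<eta>(2-4) by simp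
qed

text \<open>Lengths add up along the curve while distances satisfy the triangle inequality, so
  minimality of the whole leaves no slack in any piece.\<close>

lemma length_minimizing_if_minimal:
  assumes v: "has_velocity a b \<gamma> D" "a < b" and min: "riem_length g a b \<gamma> \<le> riem_dist g (\<gamma> a) (\<gamma> b)"
  shows "length_minimizing g a b \<gamma>"
  unfolding length_minimizing_def
proof (intro allI impI)
  fix s t assume st: "a \<le> s \<and> s \<le> t \<and> t \<le> b"
  have le: "riem_dist g (\<gamma> s) (\<gamma> t) \<le> riem_length g s t \<gamma>" if "a \<le> s" "s \<le> t" "t \<le> b" for s t
  proof (cases "s = t")
    case True
    then show ?thesis using riem_length_nonneg[OF has_velocity_subset[OF v(1), of s t]] that by (simp add: riem_dist_refl)
  next
    case False
    then show ?thesis using riem_dist_le[OF has_velocity_subset[OF v(1), of s t]] that by auto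
  qed
  have "riem_length g a b \<gamma> = riem_length g a s \<gamma> + (riem_length g s t \<gamma> + riem_length g t b \<gamma>)"
    using st riem_length_combine[OF v(1), of s] riem_length_combine[OF has_velocity_subset[OF v(1), of s b], of t] by simp
  then show "riem_dist g (\<gamma> s) (\<gamma> t) = riem_length g s t \<gamma>"
    using min le[of s t] le[of a s] le[of t b] st
      riem_dist_triangle[of "\<gamma> a" "\<gamma> b" "\<gamma> s"] riem_dist_triangle[of "\<gamma> s" "\<gamma> b" "\<gamma> t"] by simp
qed

end

subsection \<open>The geodesic equations in Hamiltonian form\<close>

locale C1_metric = riemannian g for g :: "real ^ 'n \<Rightarrow> real ^ 'n ^ 'n" +
  fixes g' :: "real ^ 'n \<Rightarrow> (real ^ 'n) \<Rightarrow>\<^sub>L (real ^ 'n ^ 'n)"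
  assumes deriv: "(g has_derivative blinfun_apply (g' x)) (at x)"
    and cont_deriv: "continuous_on UNIV g'"
begin

lemma continuous_on_deriv [continuous_intros]: "continuous_on S f \<Longrightarrow> continuous_on S (\<lambda>x. g' (f x))"
  by (rule continuous_on_compose2[OF cont_deriv]) auto

definition inv_metric :: "real ^ 'n \<Rightarrow> real ^ 'n \<Rightarrow> real ^ 'n" where
  "inv_metric x p = matrix_inv (g x) *v p"

lemma inv_metric [simp]: "g x *v inv_metric x p = p" "inv_metric x (g x *v w) = w"
  by (simp_all add: inv_metric_def SPD)

lemma continuous_on_inv_metric [continuous_intros]:
  assumes "continuous_on S f" "continuous_on S h"
  shows "continuous_on S (\<lambda>x. inv_metric (f x) (h x))"
  using continuous_on_metric[OF assms(1)] assms(2) unfolding inv_metric_def continuous_on_def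
  by (intro ballI tendsto_SPD_inv) (auto simp: SPD)

text \<open>The gradient in \<open>x\<close> of the kinetic energy
  \<open>v \<bullet> (g x *v v) / 2\<close> at fixed velocity. It equals minus the
  \<open>x\<close>-gradient of the Hamiltonian at fixed momentum \<open>g x *v v\<close>, hence it
  drives the momentum.\<close>

definition force :: "real ^ 'n \<Rightarrow> real ^ 'n \<Rightarrow> real ^ 'n" where
  "force x v = (\<chi> l. (v \<bullet> (g' x (axis l 1) *v v)) / 2)"

lemma deriv_expand: "blinfun_apply (g' x) h = (\<Sum>l\<in>UNIV. h $ l *\<^sub>R blinfun_apply (g' x) (axis l 1))"
proof -
  have "blinfun_apply (g' x) h = blinfun_apply (g' x) (\<Sum>l\<in>UNIV. h $ l *\<^sub>R axis l 1)"
    using basis_expansion[of h] by (simp add: scalar_mult_eq_scaleR)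
  then show ?thesis by (simp add: blinfun.sum_right blinfun.scaleR_right)
qed

lemma sum_matrix_vector_mult:
  fixes A :: "'i \<Rightarrow> real ^ 'b ^ 'c"
  shows "(\<Sum>i\<in>I. A i) *v w = (\<Sum>i\<in>I. A i *v w)"
  by (rule bounded_bilinear.sum_left[OF bounded_bilinear_matrix_vector_mult])

lemma force_inner: "force x v \<bullet> h = (v \<bullet> (g' x h *v v)) / 2"
  by (subst deriv_expand) (simp add: force_def inner_vec_def[of _ h] sum_matrix_vector_mult inner_sum_right
      sum_divide_distrib mult.commute flip: scaleR_matrix_vector_assoc)

lemma continuous_on_force [continuous_intros]:
  assumes "continuous_on S f" "continuous_on S h"
  shows "continuous_on S (\<lambda>x. force (f x) (h x))"
  unfolding force_def by (intro continuous_intros assms) auto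

text \<open>Hamilton's equations for
  \<open>H (x, p) = p \<bullet> inv_metric x p / 2\<close>.\<close>

definition ham :: "(real ^ 'n) \<times> (real ^ 'n) \<Rightarrow> (real ^ 'n) \<times> (real ^ 'n)" where
  "ham z = (inv_metric (fst z) (snd z), force (fst z) (inv_metric (fst z) (snd z)))"

lemma continuous_on_ham [continuous_intros]: "continuous_on S f \<Longrightarrow> continuous_on S (\<lambda>x. ham (f x))"
  unfolding ham_def by (intro continuous_intros)

lemma partial_metric_eq: "partial_metric g x i j k = blinfun_apply (g' x) (axis i 1) $ j $ k"
proof -
  have "((\<lambda>y. g y $ j $ k) has_derivative (\<lambda>h. blinfun_apply (g' x) h $ j $ k)) (at x)"
    by (intro bounded_linear.has_derivative[OF bounded_linear_vec_nth] deriv)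
  then show ?thesis unfolding partial_metric_def by (simp add: frechet_derivative_at[symmetric])
qed

lemma partial_metric_sym: "partial_metric g x i j k = partial_metric g x i k j"
  unfolding partial_metric_def using SPD_nth_sym[OF SPD, of _ j k] by simp

text \<open>Contracted twice with \<open>v\<close>, the first two terms of the Christoffel symbol
  coincide and together give twice \<open>g' x v *v v\<close>; the third gives twice
  \<open>force x v\<close>. The division by 2 leaves their difference.\<close>

lemma christoffel_eq:
  "(\<Sum>i\<in>UNIV. \<Sum>j\<in>UNIV. christoffel g x k i j * v $ i * v $ j) =
    - (matrix_inv (g x) *v (force x v - blinfun_apply (g' x) v *v v)) $ k"
proof -
  let ?P = "partial_metric g x" and ?G = "matrix_inv (g x)"
  have f: "(force x v) $ l = (\<Sum>i\<in>UNIV. \<Sum>j\<in>UNIV. ?P l i j * v $ i * v $ j) / 2" for l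
    by (simp add: force_def inner_vec_def matrix_vector_mult_def partial_metric_eq sum_distrib_left ac_simps)
  have s: "(\<Sum>i\<in>UNIV. \<Sum>j\<in>UNIV. ?P j i l * v $ i * v $ j) = (\<Sum>i\<in>UNIV. \<Sum>j\<in>UNIV. ?P i j l * v $ i * v $ j)" for l
    by (subst sum.swap) (simp add: ac_simps)
  have q: "(blinfun_apply (g' x) v *v v) $ l = (\<Sum>i\<in>UNIV. \<Sum>j\<in>UNIV. ?P i j l * v $ i * v $ j)" for l
  proof -
    have "(blinfun_apply (g' x) v *v v) $ l = (\<Sum>j\<in>UNIV. \<Sum>i\<in>UNIV. ?P i l j * v $ i * v $ j)"
      by (subst deriv_expand) (simp add: partial_metric_eq matrix_vector_mult_def sum_component sum_distrib_right sum_distrib_left ac_simps)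
    also have "\<dots> = (\<Sum>i\<in>UNIV. \<Sum>j\<in>UNIV. ?P i l j * v $ i * v $ j)" by (rule sum.swap)
    finally show ?thesis by (simp only: partial_metric_sym[of x _ l])
  qed
  have "(\<Sum>i\<in>UNIV. \<Sum>j\<in>UNIV. christoffel g x k i j * v $ i * v $ j) =
     (\<Sum>i\<in>UNIV. \<Sum>j\<in>UNIV. \<Sum>l\<in>UNIV. ?G $ k $ l * ((?P i j l + ?P j i l - ?P l i j) * v $ i * v $ j / 2))"
    by (simp add: christoffel_def sum_distrib_left sum_divide_distrib ac_simps)
  also have "\<dots> = (\<Sum>l\<in>UNIV. \<Sum>i\<in>UNIV. \<Sum>j\<in>UNIV. ?G $ k $ l * ((?P i j l + ?P j i l - ?P l i j) * v $ i * v $ j / 2))"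
    by (subst sum.swap, subst (2) sum.swap) (rule refl)
  also have "\<dots> = (\<Sum>l\<in>UNIV. ?G $ k $ l * (((\<Sum>i\<in>UNIV. \<Sum>j\<in>UNIV. ?P i j l * v $ i * v $ j) +
      (\<Sum>i\<in>UNIV. \<Sum>j\<in>UNIV. ?P j i l * v $ i * v $ j) - (\<Sum>i\<in>UNIV. \<Sum>j\<in>UNIV. ?P l i j * v $ i * v $ j)) / 2))"
    by (simp only: sum_distrib_left sum_divide_distrib sum.distrib sum_subtractf left_diff_distrib distrib_right right_diff_distrib distrib_left
        add_divide_distrib diff_divide_distrib)
  also have "\<dots> = (\<Sum>l\<in>UNIV. - (?G $ k $ l * (force x v - blinfun_apply (g' x) v *v v) $ l))"
    unfolding s f q[symmetric] vector_minus_component by (intro sum.cong) (auto simp: field_simps)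
  finally show ?thesis by (simp add: matrix_vector_mult_def sum_negf)
qed

lemma ham_curve_derivatives:
  assumes "integral_curve ham J z" "t \<in> J"
  defines "v \<equiv> \<lambda>t. inv_metric (fst (z t)) (snd (z t))"
  shows "((\<lambda>t. fst (z t)) has_vector_derivative v t) (at t within J)"
    and "((\<lambda>t. snd (z t)) has_vector_derivative force (fst (z t)) (v t)) (at t within J)"
    and "(v has_vector_derivative inv_metric (fst (z t)) (force (fst (z t)) (v t) - blinfun_apply (g' (fst (z t))) (v t) *v v t))
       (at t within J)"
proof -
  have z: "(z has_vector_derivative ham (z t)) (at t within J)"
    using assms by (simp add: integral_curve_def)
  show 1: "((\<lambda>t. fst (z t)) has_vector_derivative v t) (at t within J)"
    using bounded_linear.has_vector_derivative[OF bounded_linear_fst z] by (simp add: ham_def v_def)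
  show 2: "((\<lambda>t. snd (z t)) has_vector_derivative force (fst (z t)) (v t)) (at t within J)"
    using bounded_linear.has_vector_derivative[OF bounded_linear_snd z] by (simp add: ham_def v_def)
  have "((\<lambda>t. g (fst (z t))) has_vector_derivative blinfun_apply (g' (fst (z t))) (v t)) (at t within J)"
    using has_derivative_compose[OF 1[unfolded has_vector_derivative_def] deriv]
    by (simp add: has_vector_derivative_def blinfun.scaleR_right)
  from SPD_inv_has_vector_derivative[OF this SPD 2]
  show "(v has_vector_derivative inv_metric (fst (z t)) (force (fst (z t)) (v t) - blinfun_apply (g' (fst (z t))) (v t) *v v t))
       (at t within J)"
    unfolding v_def inv_metric_def .
qed

lemma geodesic_on_ham_curve:
  assumes "integral_curve ham J z"
  shows "geodesic_on g J (\<lambda>t. fst (z t))"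
  unfolding geodesic_on_def
proof (intro exI ballI conjI)
  fix t assume t: "t \<in> J"
  let ?v = "\<lambda>t. inv_metric (fst (z t)) (snd (z t))"
  show "((\<lambda>t. fst (z t)) has_vector_derivative ?v t) (at t within J)"
    by (rule ham_curve_derivatives[OF assms t])
  have "inv_metric (fst (z t)) (force (fst (z t)) (?v t) - blinfun_apply (g' (fst (z t))) (?v t) *v ?v t) =
    (\<chi> k. - (\<Sum>i\<in>UNIV. \<Sum>j\<in>UNIV. christoffel g (fst (z t)) k i j * ?v t $ i * ?v t $ j))"
    unfolding christoffel_eq by (simp add: inv_metric_def vec_eq_iff)
  then show "(?v has_vector_derivative
          (\<chi> k. - (\<Sum>i\<in>UNIV. \<Sum>j\<in>UNIV. christoffel g (fst (z t)) k i j * ?v t $ i * ?v t $ j)))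
        (at t within J)"
    using ham_curve_derivatives(3)[OF assms t] by simp
qed

text \<open>Conservation of \<open>p \<bullet> v\<close>, the squared speed: the change of the
  metric along the curve enters with \<open>- v \<bullet> (g' x v *v v) / 2\<close> through the
  derivative of \<open>v\<close> and with the opposite sign through that of
  \<open>p\<close>.\<close>

lemma ham_curve_constant_speed:
  assumes z: "integral_curve ham J z" "convex J" "s \<in> J" "t \<in> J"
  shows "speed (fst (z s)) (inv_metric (fst (z s)) (snd (z s))) = speed (fst (z t)) (inv_metric (fst (z t)) (snd (z t)))"
proof -
  let ?v = "\<lambda>t. inv_metric (fst (z t)) (snd (z t))"
  have "((\<lambda>t. snd (z t) \<bullet> ?v t) has_vector_derivative 0) (at t within J)" if "t \<in> J" for t
  proof -
    let ?x = "fst (z t)" and ?f = "force (fst (z t)) (?v t)" and ?D = "blinfun_apply (g' (fst (z t))) (?v t)"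
    let ?v' = "inv_metric ?x (?f - ?D *v ?v t)"
    note d = ham_curve_derivatives[OF z(1) that]
    have "snd (z t) \<bullet> ?v' = (g ?x *v ?v t) \<bullet> ?v'" by simp
    also have "\<dots> = ?v t \<bullet> (g ?x *v ?v')" by (simp only: SPD_sym[OF SPD])
    also have "\<dots> = - (?v t \<bullet> (?D *v ?v t)) / 2"
      using force_inner[of ?x "?v t" "?v t"] by (simp add: inner_diff_right inner_commute)
    finally have "snd (z t) \<bullet> ?v' + ?f \<bullet> ?v t = 0" by (simp add: force_inner)
    moreover have "((\<lambda>t. snd (z t) \<bullet> ?v t) has_vector_derivative snd (z t) \<bullet> ?v' + ?f \<bullet> ?v t) (at t within J)"
      by (rule bounded_bilinear.has_vector_derivative[OF bounded_bilinear_inner d(2,3)])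
    ultimately show ?thesis by simp
  qed
  then have "\<exists>c. \<forall>t\<in>J. snd (z t) \<bullet> ?v t = c"
    by (rule has_vector_derivative_zero_constant[OF z(2)]) auto
  then have "snd (z s) \<bullet> ?v s = snd (z t) \<bullet> ?v t" using z by metis
  then show ?thesis by (simp add: speed_def inner_commute)
qed

lemma has_velocity_ham_curve:
  assumes "integral_curve ham {a..b} z"
  shows "has_velocity a b (\<lambda>t. fst (z t)) (\<lambda>t. inv_metric (fst (z t)) (snd (z t)))"
proof -
  have "continuous_on {a..b} z"
    using assms has_vector_derivative_continuous unfolding integral_curve_def continuous_on_eq_continuous_within by blast
  then show ?thesis
    unfolding has_velocity_def using ham_curve_derivatives(1)[OF assms] by (auto intro!: continuous_intros)
qed

lemma riem_length_ham_curve: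
  assumes z: "integral_curve ham {a..b} z" and t: "t \<in> {a..b}"
  shows "riem_length g a b (\<lambda>t. fst (z t)) = (b - a) * speed (fst (z t)) (inv_metric (fst (z t)) (snd (z t)))"
proof -
  have "riem_length g a b (\<lambda>t. fst (z t)) = integral {a..b} (\<lambda>_. speed (fst (z t)) (inv_metric (fst (z t)) (snd (z t))))"
    unfolding riem_length_eq[OF has_velocity_ham_curve[OF z]]
    using t by (intro integral_cong ham_curve_constant_speed[OF z]) auto
  then show ?thesis using t by simp
qed

text \<open>Time reversal: flipping the momentum turns the flow around, so backward solutions can be
  read off from forward ones.\<close>

lemma ham_reflect: "ham (fst z, - snd z) = (- fst (ham z), snd (ham z))"
  by (simp add: ham_def inv_metric_def force_def matrix_vector_mult_minus)

end

subsection \<open>Minimizing geodesics of uniformly elliptic metrics\<close>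

lemma exists_equidistribution:
  fixes s :: "real \<Rightarrow> real"
  assumes s: "continuous_on {a..b} s" "\<And>t u. a \<le> t \<Longrightarrow> t \<le> u \<Longrightarrow> u \<le> b \<Longrightarrow> s t \<le> s u"
    and ab: "a \<le> b" and m: "m > (0::nat)"
  obtains \<tau> where "\<tau> 0 = a" "\<tau> m = b" "\<And>i. i \<le> m \<Longrightarrow> \<tau> i \<in> {a..b}" "\<And>i. i < m \<Longrightarrow> \<tau> i \<le> \<tau> (Suc i)"
    "\<And>i. i < m \<Longrightarrow> s (\<tau> (Suc i)) - s (\<tau> i) = (s b - s a) / m"
proof (cases "s a = s b")
  case True
  show ?thesis
    by (rule that[of "\<lambda>i. if i < m then a else b"]) (use ab m True in auto)
next
  case False
  then have lt: "s a < s b" using s(2)[of a b] ab by auto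
  define q where "q = (s b - s a) / m"
  have q: "q > 0" "m * q = s b - s a" using lt m by (auto simp: q_def)
  have "\<exists>t. t \<in> {a..b} \<and> s t = s a + real i * q" if "i \<le> m" for i :: nat
  proof -
    have "real i * q \<le> m * q" using that q by (intro mult_right_mono) auto
    then have "s a + real i * q \<le> s b" using q by simp
    moreover have "s a \<le> s a + real i * q" using q by simp
    ultimately show ?thesis using IVT'[OF _ _ ab s(1), of "s a + real i * q"] by auto
  qed
  then obtain \<theta> where \<theta>: "\<And>i. i \<le> m \<Longrightarrow> \<theta> i \<in> {a..b} \<and> s (\<theta> i) = s a + real i * q"
    by metis
  \<comment> \<open>The endpoints are prescribed because \<open>s\<close> may be constant near them,
    in which case a preimage of an extreme value need not be \<open>a\<close> or
    \<open>b\<close>.\<close>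
  define \<tau> where "\<tau> i = (if i = 0 then a else if i = m then b else \<theta> i)" for i
  have \<tau>: "\<tau> i \<in> {a..b} \<and> s (\<tau> i) = s a + real i * q" if "i \<le> m" for i
    using \<theta>[OF that] q(2) ab by (auto simp: \<tau>_def)
  have step: "s (\<tau> (Suc i)) - s (\<tau> i) = q" if "i < m" for i
    using \<tau>[of i] \<tau>[of "Suc i"] that by (simp add: distrib_right)
  show ?thesis
  proof (rule that[of \<tau>])
    show "\<tau> i \<le> \<tau> (Suc i)" if "i < m" for i
    proof (rule ccontr)
      assume "\<not> \<tau> i \<le> \<tau> (Suc i)"
      then have "s (\<tau> (Suc i)) \<le> s (\<tau> i)" using \<tau>[of i] \<tau>[of "Suc i"] that by (intro s(2)) auto
      then show False using step[OF that] q(1) by linarith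
    qed
    show "s (\<tau> (Suc i)) - s (\<tau> i) = (s b - s a) / m" if "i < m" for i
      using step[OF that] by (simp add: q_def)
    show "\<tau> i \<in> {a..b}" if "i \<le> m" for i using \<tau>[OF that] by simp
  qed (use m in \<open>auto simp: \<tau>_def\<close>)
qed

context riemannian
begin

text \<open>The factor \<open>m\<close> appears because each of the \<open>m\<close> steps takes time \<open>1 / m\<close>.\<close>

definition energy :: "nat \<Rightarrow> (nat \<Rightarrow> real ^ 'n) \<Rightarrow> real" where
  "energy m X = (\<Sum>i<m. real m * (speed (X i) (X (Suc i) - X i))\<^sup>2)"

end

locale elliptic_metric = C1_metric g g' for g :: "real ^ 'n \<Rightarrow> real ^ 'n ^ 'n" and g' +
  fixes c :: real
  assumes c_pos: "c > 0" and lower: "c * (norm w)\<^sup>2 \<le> w \<bullet> (g x *v w)"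
begin

lemma speed_sq_ge: "c * (norm w)\<^sup>2 \<le> (speed x w)\<^sup>2"
  by (simp add: lower speed_sq)

text \<open>Freezing the metric at the start of a short piece changes speeds by a factor of at most
  \<open>sqrt (1 + \<eta>)\<close>, and in a frozen metric a displacement is no longer than the
  curve. Pieces of equal length are the equality case of Cauchy-Schwarz, so the sum of squares gives
  no more than the squared total length.\<close>

lemma energy_sampling:
  assumes v: "has_velocity a b \<sigma> D" "a < b" and \<eta>: "\<eta> > 0"
  shows "\<forall>\<^sub>F m in sequentially. \<exists>X. X 0 = \<sigma> a \<and> X m = \<sigma> b \<and> energy m X \<le> (1 + \<eta>) * (riem_length g a b \<sigma>)\<^sup>2"
proof -
  define L where "L = riem_length g a b \<sigma>"
  define s where "s t = riem_length g a t \<sigma>" for t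
  have sub: "has_velocity u t \<sigma> D" if "a \<le> u" "t \<le> b" for u t
    using has_velocity_subset[OF v(1) that] .
  have len: "riem_length g u t \<sigma> = s t - s u" if "a \<le> u" "u \<le> t" "t \<le> b" for u t
    unfolding s_def using riem_length_combine[OF sub, of a t u] that by simp
  have s_mono: "s u \<le> s t" if "a \<le> u" "u \<le> t" "t \<le> b" for u t
    using riem_length_nonneg[OF sub, of u t] len[OF that] that by simp
  have sa: "s a = 0" using len[of a a] v by (simp add: s_def)
  have sb: "s b = L" by (simp add: s_def L_def)
  have s_cont: "continuous_on {a..b} s"
  proof (rule continuous_on_eq)
    show "continuous_on {a..b} (\<lambda>t. integral {a..t} (\<lambda>u. speed (\<sigma> u) (D u)))"
      by (rule indefinite_integral_continuous_1[OF speed_integrable[OF v(1)]]) auto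
    show "integral {a..t} (\<lambda>u. speed (\<sigma> u) (D u)) = s t" if "t \<in> {a..b}" for t
      unfolding s_def using riem_length_eq[OF sub, of a t] that by simp
  qed
  have "compact (\<sigma> ` {a..b})"
    by (intro compact_continuous_image has_velocity_continuous[OF v(1)] compact_Icc)
  then have "uniformly_continuous_on (\<sigma> ` {a..b}) g"
    by (intro compact_uniformly_continuous continuous_on_subset[OF cont]) auto
  \<comment> \<open>A change of \<open>g\<close> below \<open>\<eta> * c\<close> alters the
    quadratic form by at most \<open>\<eta>\<close> times its own value, by ellipticity.\<close>
  then obtain \<delta> where \<delta>: "\<delta> > 0"
    "\<And>u t. u \<in> {a..b} \<Longrightarrow> t \<in> {a..b} \<Longrightarrow> dist (\<sigma> u) (\<sigma> t) < \<delta> \<Longrightarrow> dist (g (\<sigma> u)) (g (\<sigma> t)) < \<eta> * c"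
    using \<eta> c_pos unfolding uniformly_continuous_on_def by (metis imageI mult_pos_pos)
  have "(\<lambda>m. L / real m) \<longlonglongrightarrow> 0"
    by (intro real_tendsto_divide_at_top[OF tendsto_const] filterlim_real_sequentially)
  \<comment> \<open>By ellipticity a piece of length below \<open>sqrt c * \<delta>\<close> stays
    within Euclidean distance \<open>\<delta>\<close> of its start.\<close>
  then have "\<forall>\<^sub>F m in sequentially. L / real m < sqrt c * \<delta>"
    using c_pos \<delta> by (intro order_tendstoD) auto
  moreover have "\<forall>\<^sub>F m in sequentially. (0::nat) < m" by (rule eventually_gt_at_top)
  ultimately show ?thesis
  proof eventually_elim
    case (elim m)
    obtain \<tau> where \<tau>: "\<tau> 0 = a" "\<tau> m = b" "\<And>i. i \<le> m \<Longrightarrow> \<tau> i \<in> {a..b}" "\<And>i. i < m \<Longrightarrow> \<tau> i \<le> \<tau> (Suc i)"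
      "\<And>i. i < m \<Longrightarrow> s (\<tau> (Suc i)) - s (\<tau> i) = (s b - s a) / m"
      using exists_equidistribution[OF s_cont s_mono less_imp_le[OF v(2)] elim(2)] by blast
    define X where "X i = \<sigma> (\<tau> i)" for i
    have bound: "(speed (X i) (X (Suc i) - X i))\<^sup>2 \<le> (1 + \<eta>) * (L / m)\<^sup>2" if i: "i < m" for i
    proof -
      let ?u = "\<tau> i" and ?t = "\<tau> (Suc i)"
      have ut: "a \<le> ?u" "?u \<le> ?t" "?t \<le> b" using \<tau>(3)[of i] \<tau>(3)[of "Suc i"] \<tau>(4) i by auto
      have st: "riem_length g ?u ?t \<sigma> = L / m" using \<tau>(5)[OF i] len[OF ut] by (simp add: sa sb)
      have ptw: "speed (X i) (D r) \<le> sqrt (1 + \<eta>) * speed (\<sigma> r) (D r)" if r: "r \<in> {?u..?t}" for r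
      proof -
        have "sqrt c * norm (\<sigma> r - \<sigma> ?u) \<le> riem_length g ?u r \<sigma>"
          using ut r by (intro norm_displacement_le_length[OF sub _ c_pos lower]) auto
        also have "\<dots> \<le> L / m" unfolding st[symmetric] using r
          by (intro riem_length_subset_le[OF sub]) (use ut in auto)
        also have "\<dots> < sqrt c * \<delta>" by (rule elim)
        finally have "dist (\<sigma> ?u) (\<sigma> r) < \<delta>" using c_pos by (simp add: dist_norm norm_minus_commute)
        then have d: "norm (g (X i) - g (\<sigma> r)) \<le> \<eta> * c"
          using \<delta>(2)[of ?u r] ut r by (auto simp: X_def dist_norm)
        have "D r \<bullet> ((g (X i) - g (\<sigma> r)) *v D r) \<le> norm (D r) * (norm (g (X i) - g (\<sigma> r)) * norm (D r))"
          by (intro order_trans[OF norm_cauchy_schwarz] mult_left_mono norm_matrix_vector_mult_le) auto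
        also have "\<dots> \<le> norm (D r) * (\<eta> * c * norm (D r))"
          by (intro mult_left_mono mult_right_mono d) auto
        also have "\<dots> = \<eta> * (c * (norm (D r))\<^sup>2)" by (simp add: power2_eq_square)
        also have "\<dots> \<le> \<eta> * (speed (\<sigma> r) (D r))\<^sup>2" using \<eta> by (intro mult_left_mono speed_sq_ge) auto
        finally have "(speed (X i) (D r))\<^sup>2 \<le> (1 + \<eta>) * (speed (\<sigma> r) (D r))\<^sup>2"
          by (simp add: matrix_vector_mult_diff_rdistrib inner_diff_right speed_sq distrib_right)
        then have "sqrt ((speed (X i) (D r))\<^sup>2) \<le> sqrt ((1 + \<eta>) * (speed (\<sigma> r) (D r))\<^sup>2)"
          by (rule real_sqrt_le_mono)
        then show ?thesis using speed_nonneg by (simp add: real_sqrt_mult)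
      qed
      have "speed (X i) (X (Suc i) - X i) \<le> integral {?u..?t} (\<lambda>r. speed (X i) (D r))"
        using SPD_norm_displacement_le[OF SPD sub, of "\<tau> i" "\<tau> (Suc i)" "X i"] ut by (simp add: X_def speed_def)
      also have "\<dots> \<le> integral {?u..?t} (\<lambda>r. sqrt (1 + \<eta>) * speed (\<sigma> r) (D r))"
      proof (rule integral_le[OF _ _ ptw])
        have "continuous_on {?u..?t} D" using sub[of ?u ?t] ut by (simp add: has_velocity_def)
        then show "(\<lambda>r. speed (X i) (D r)) integrable_on {?u..?t}"
          by (intro integrable_continuous_real continuous_on_speed continuous_on_const)
        show "(\<lambda>r. sqrt (1 + \<eta>) * speed (\<sigma> r) (D r)) integrable_on {?u..?t}"
          using ut by (intro integrable_on_mult_right speed_integrable[OF v(1)]) auto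
      qed
      also have "\<dots> = sqrt (1 + \<eta>) * (L / m)"
        using st riem_length_eq[OF sub, of "\<tau> i" "\<tau> (Suc i)"] ut by simp
      finally have "(speed (X i) (X (Suc i) - X i))\<^sup>2 \<le> (sqrt (1 + \<eta>) * (L / m))\<^sup>2"
        by (intro power_mono speed_nonneg)
      then show ?thesis using \<eta> by (simp add: power_mult_distrib power_divide)
    qed
    have "energy m X \<le> (\<Sum>i<m. real m * ((1 + \<eta>) * (L / m)\<^sup>2))"
      unfolding energy_def by (intro sum_mono mult_left_mono bound) auto
    also have "\<dots> = (1 + \<eta>) * L\<^sup>2" using elim(2) by (simp add: power2_eq_square)
    finally have "energy m X \<le> (1 + \<eta>) * L\<^sup>2" .
    then show ?case using \<tau> by (intro exI[of _ X]) (simp add: X_def L_def)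
  qed
qed

lemma sum_norm_sq_le_energy: "c * (m * (\<Sum>i<m. (norm (X (Suc i) - X i))\<^sup>2)) \<le> energy m X"
proof -
  have "c * (m * (\<Sum>i<m. (norm (X (Suc i) - X i))\<^sup>2)) = (\<Sum>i<m. m * (c * (norm (X (Suc i) - X i))\<^sup>2))"
    by (simp add: sum_distrib_left mult.left_commute)
  also have "\<dots> \<le> energy m X"
    unfolding energy_def by (intro sum_mono mult_left_mono speed_sq_ge) auto
  finally show ?thesis .
qed

text \<open>Cauchy-Schwarz over the steps. The factor \<open>m\<close> in \<open>energy\<close>
  absorbs the number of steps, which makes the bound independent of \<open>m\<close>.\<close>

lemma chain_displacement:
  assumes "i \<le> m"
  shows "c * (norm (X i - X 0))\<^sup>2 \<le> energy m X"
proof -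
  have "norm (X i - X 0) = norm (\<Sum>j<i. X (Suc j) - X j)" by (simp add: sum_lessThan_telescope)
  also have "\<dots> \<le> (\<Sum>j<i. norm (X (Suc j) - X j))" by (rule norm_sum)
  also have "\<dots> \<le> (\<Sum>j<m. norm (X (Suc j) - X j))" using assms by (intro sum_mono2) auto
  finally have "(norm (X i - X 0))\<^sup>2 \<le> (\<Sum>j<m. norm (X (Suc j) - X j))\<^sup>2" by (intro power_mono) auto
  also have "\<dots> \<le> m * (\<Sum>j<m. (norm (X (Suc j) - X j))\<^sup>2)"
    using sum_squared_le_sum_of_squares[of "\<lambda>j. norm (X (Suc j) - X j)" "{..<m}"] by (simp add: mult.commute)
  finally have "c * (norm (X i - X 0))\<^sup>2 \<le> c * (m * (\<Sum>j<m. (norm (X (Suc j) - X j))\<^sup>2))"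
    using c_pos by (intro mult_left_mono) auto
  then show ?thesis using sum_norm_sq_le_energy[of m X] by linarith
qed

lemma continuous_on_energy: "continuous_on S (energy m)"
  unfolding energy_def
  by (intro continuous_on_sum continuous_on_mult continuous_on_const continuous_on_power continuous_on_speed
      continuous_on_diff continuous_on_subset[OF continuous_on_product_coordinates] subset_UNIV)

text \<open>Chains are functions on all naturals, so compactness is Tychonoff's theorem for a
  product of balls. By \<open>chain_displacement\<close> a chain with at most the energy of the
  competitor \<open>X0\<close> stays within \<open>\<rho>\<close> of \<open>x\<close>, so
  restricting to these balls loses nothing.\<close>

lemma exists_energy_minimizer:
  assumes m: "m > 0"
  obtains X where "X 0 = x" "X m = y" "\<And>Y. Y 0 = x \<Longrightarrow> Y m = y \<Longrightarrow> energy m X \<le> energy m Y"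
proof -
  define X0 where "X0 = (\<lambda>i::nat. if i = m then y else x)"
  define \<rho> where "\<rho> = sqrt (energy m X0 / c)"
  define T where "T i = (if i = 0 then {x} else if i = m then {y} else cball x \<rho>)" for i
  have "compactin (product_topology (\<lambda>i. euclidean) UNIV) (PiE UNIV T)"
    unfolding compactin_PiE by (auto simp: T_def)
  then have comp: "compact (PiE UNIV T)"
    by (simp add: euclidean_product_topology)
  have e0: "energy m X0 \<ge> 0" unfolding energy_def by (intro sum_nonneg) auto
  have \<rho>0: "\<rho> \<ge> 0" using e0 c_pos by (simp add: \<rho>_def)
  have X0: "X0 \<in> PiE UNIV T" using m \<rho>0 by (auto simp: X0_def T_def)
  have "\<exists>X\<in>PiE UNIV T. \<forall>Y\<in>PiE UNIV T. energy m X \<le> energy m Y"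
    by (rule continuous_attains_inf[OF comp _ continuous_on_energy]) (use X0 in blast)
  then obtain X where X: "X \<in> PiE UNIV T" "\<And>Y. Y \<in> PiE UNIV T \<Longrightarrow> energy m X \<le> energy m Y"
    by blast
  show ?thesis
  proof (rule that)
    have "X i \<in> T i" for i using X(1) by auto
    from this[of 0] this[of m] show "X 0 = x" "X m = y" using m by (auto simp: T_def)
    fix Y assume Y: "Y 0 = x" "Y m = y"
    show "energy m X \<le> energy m Y"
    proof (rule ccontr)
      assume "\<not> energy m X \<le> energy m Y"
      then have le: "energy m Y \<le> energy m X0" using X(2)[OF X0] by simp
      \<comment> \<open>Coordinates beyond \<open>m\<close> are reset so that the chain lies in the
        compact product; \<open>energy m\<close> does not read them.\<close>
      define Z where "Z i = (if i \<le> m then Y i else x)" for i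
      have "Z i \<in> T i" for i
      proof (cases "i \<le> m")
        case True
        have "c * (norm (Y i - x))\<^sup>2 \<le> energy m X0"
          using chain_displacement[OF True, of Y] le Y by simp
        then have "(norm (Y i - x))\<^sup>2 \<le> energy m X0 / c" using c_pos by (simp add: field_simps)
        then have "norm (Y i - x) \<le> \<rho>" unfolding \<rho>_def by (rule real_le_rsqrt)
        then show ?thesis using Y True by (auto simp: Z_def T_def dist_norm norm_minus_commute)
      qed (use \<rho>0 in \<open>auto simp: Z_def T_def\<close>)
      then have "energy m X \<le> energy m Z" by (intro X(2)) auto
      also have "\<dots> = energy m Y" unfolding energy_def Z_def by (intro sum.cong) auto
      finally show False using \<open>\<not> energy m X \<le> energy m Y\<close> by simp
    qed
  qed
qed

text \<open>Moving the vertex \<open>X (Suc i)\<close> affects two summands. In the first the metric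
  is frozen at \<open>X i\<close>, in the second it moves with the vertex; hence the force appears
  at index \<open>Suc i\<close>, that is, the momentum is updated with the force at the new
  point.\<close>

lemma discrete_Euler_Lagrange:
  assumes min: "\<And>Y. Y 0 = X 0 \<Longrightarrow> Y m = X m \<Longrightarrow> energy m X \<le> energy m Y" and i: "Suc i < m"
  defines "v \<equiv> \<lambda>i. real m *\<^sub>R (X (Suc i) - X i)"
  shows "g (X (Suc i)) *v v (Suc i) - g (X i) *v v i = (1 / m) *\<^sub>R force (X (Suc i)) (v (Suc i))"
proof -
  let ?a = "X i" and ?\<xi> = "X (Suc i)" and ?b = "X (Suc (Suc i))"
  let ?A = "g (X i)"
  define f where "f \<xi> = (\<xi> - ?a) \<bullet> (?A *v (\<xi> - ?a)) + (?b - \<xi>) \<bullet> (g \<xi> *v (?b - \<xi>))" for \<xi>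
  have m0: "real m > 0" using i by simp
  have fmin: "f ?\<xi> \<le> f \<xi>" for \<xi>
  proof -
    define Y where "Y = X(Suc i := \<xi>)"
    have split: "energy m Z = real m * ((speed (Z i) (Z (Suc i) - Z i))\<^sup>2 + (speed (Z (Suc i)) (Z (Suc (Suc i)) - Z (Suc i)))\<^sup>2)
      + (\<Sum>j\<in>{..<m} - {i} - {Suc i}. real m * (speed (Z j) (Z (Suc j) - Z j))\<^sup>2)" for Z
      unfolding energy_def using i
      by (subst sum.remove[of _ i], simp, simp, subst sum.remove[of _ "Suc i"]) (auto simp: distrib_left)
    have "energy m X \<le> energy m Y" using i by (intro min) (auto simp: Y_def)
    moreover have "(\<Sum>j\<in>{..<m} - {i} - {Suc i}. real m * (speed (Y j) (Y (Suc j) - Y j))\<^sup>2) =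
       (\<Sum>j\<in>{..<m} - {i} - {Suc i}. real m * (speed (X j) (X (Suc j) - X j))\<^sup>2)"
      by (intro sum.cong) (auto simp: Y_def)
    ultimately have "real m * f ?\<xi> \<le> real m * f \<xi>"
      unfolding split[of X] split[of Y] f_def by (simp add: Y_def speed_sq)
    then show ?thesis using m0 by simp
  qed
  define f' where "f' h = h \<bullet> (?A *v (?\<xi> - ?a)) + (?\<xi> - ?a) \<bullet> (?A *v h) +
     ((- h) \<bullet> (g ?\<xi> *v (?b - ?\<xi>)) + (?b - ?\<xi>) \<bullet> (blinfun_apply (g' ?\<xi>) h *v (?b - ?\<xi>) + g ?\<xi> *v (- h)))" for h
  have "(f has_derivative f') (at ?\<xi>)"
    unfolding f_def f'_def
    by (auto intro!: derivative_eq_intros deriv bounded_bilinear.FDERIV[OF bounded_bilinear_matrix_vector_mult]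
        simp: fun_eq_iff algebra_simps matrix_vector_mult_minus)
  then have f'0: "f' = (\<lambda>h. 0)"
    by (rule differential_zero_maxmin[OF UNIV_I open_UNIV]) (use fmin in auto)
  have "(g ?\<xi> *v v (Suc i) - ?A *v v i) \<bullet> h = ((1 / m) *\<^sub>R force ?\<xi> (v (Suc i))) \<bullet> h" for h
  proof -
    have "0 = f' h" using f'0 by simp
    also have "\<dots> = 2 * (h \<bullet> (?A *v (?\<xi> - ?a))) - 2 * (h \<bullet> (g ?\<xi> *v (?b - ?\<xi>))) +
      (?b - ?\<xi>) \<bullet> (blinfun_apply (g' ?\<xi>) h *v (?b - ?\<xi>))"
      unfolding f'_def SPD_comm[OF SPD, of "?\<xi> - ?a"]
      using SPD_comm[OF SPD[of ?\<xi>], of "?b - ?\<xi>" h]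
      by (simp add: inner_add_right inner_diff_right matrix_vector_mult_minus)
    finally have *: "2 * (h \<bullet> (g ?\<xi> *v (?b - ?\<xi>))) - 2 * (h \<bullet> (?A *v (?\<xi> - ?a))) =
      (?b - ?\<xi>) \<bullet> (blinfun_apply (g' ?\<xi>) h *v (?b - ?\<xi>))" by simp
    have "2 * ((g ?\<xi> *v v (Suc i) - ?A *v v i) \<bullet> h) =
       m * (2 * (h \<bullet> (g ?\<xi> *v (?b - ?\<xi>))) - 2 * (h \<bullet> (?A *v (?\<xi> - ?a))))"
      by (simp add: v_def matrix_vector_mult_scaleR inner_diff_left inner_diff_right inner_commute[of _ h] right_diff_distrib)
    also have "\<dots> = 2 * ((1 / m) * (force ?\<xi> (v (Suc i)) \<bullet> h))"
      unfolding * force_inner v_def using m0 by (simp add: matrix_vector_mult_scaleR)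
    finally show ?thesis by simp
  qed
  then show ?thesis using vector_eq_rdot by blast
qed

end

context C1_metric begin

lemma norm_force_le: "norm (force x v) \<le> norm (g' x) * (norm v)\<^sup>2 / 2"
proof -
  let ?f = "force x v"
  have "norm ?f * norm ?f = (v \<bullet> (blinfun_apply (g' x) ?f *v v)) / 2"
    by (simp add: force_inner[symmetric] power2_norm_eq_inner[symmetric] power2_eq_square)
  also have "\<dots> \<le> (norm v * ((norm (g' x) * norm ?f) * norm v)) / 2"
    by (intro divide_right_mono order_trans[OF norm_cauchy_schwarz] mult_left_mono
        order_trans[OF norm_matrix_vector_mult_le] mult_right_mono norm_blinfun) auto
  finally have "norm ?f * norm ?f \<le> norm ?f * (norm (g' x) * (norm v)\<^sup>2 / 2)"
    by (simp add: power2_eq_square mult.commute mult.left_commute)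
  then show ?thesis by (cases "norm ?f = 0") (auto simp: mult_le_cancel_left)
qed

end

context elliptic_metric begin

text \<open>Since the mean of the squared velocities is at most \<open>E / c\<close>, some step
  \<open>j\<close> has speed at most \<open>sqrt (E / c)\<close>. Away from \<open>j\<close> the
  momentum changes by forces quadratic in the velocity, whose total is controlled by the same
  mean.\<close>

lemma discrete_momentum_bound:
  fixes X m
  defines "v \<equiv> \<lambda>i. real m *\<^sub>R (X (Suc i) - X i)"
  assumes min: "\<And>Y. Y 0 = X 0 \<Longrightarrow> Y m = X m \<Longrightarrow> energy m X \<le> energy m Y"
    and E: "energy m X \<le> E"
    and bound: "\<And>u. norm (u - X 0) \<le> sqrt (E / c) \<Longrightarrow> norm (g u) \<le> \<Lambda> \<and> norm (g' u) \<le> B"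
    and i: "i < m"
  shows "norm (g (X i) *v v i) \<le> \<Lambda> * sqrt (E / c) + B / 2 * (E / c)"
proof -
  define p where "p i = g (X i) *v v i" for i
  have m: "real m > 0" using i by simp
  have ball: "norm (X i - X 0) \<le> sqrt (E / c)" if "i \<le> m" for i
    using chain_displacement[OF that, of X] E c_pos by (intro real_le_rsqrt) (simp add: field_simps)
  have "energy m X \<ge> 0" unfolding energy_def by (intro sum_nonneg) auto
  then have E0: "E / c \<ge> 0" using E c_pos by simp
  have \<Lambda>B: "norm (g (X i)) \<le> \<Lambda>" "norm (g' (X i)) \<le> B" if "i \<le> m" for i
    using bound[OF ball[OF that]] by auto
  have \<Lambda>0: "\<Lambda> \<ge> 0" "B \<ge> 0" using \<Lambda>B[of 0] norm_ge_zero order_trans by blast+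
  have "c * (\<Sum>i<m. (norm (v i))\<^sup>2) = m * (c * (m * (\<Sum>i<m. (norm (X (Suc i) - X i))\<^sup>2)))"
    by (simp add: v_def power2_eq_square sum_distrib_left ac_simps)
  also have "\<dots> \<le> m * E" using sum_norm_sq_le_energy[of m X] E m by (intro mult_left_mono) auto
  finally have sum_v: "(\<Sum>i<m. (norm (v i))\<^sup>2) \<le> m * (E / c)" using c_pos by (simp add: field_simps)
  have "\<exists>j<m. (norm (v j))\<^sup>2 \<le> E / c"
  proof (rule ccontr)
    assume "\<not> ?thesis"
    then have "(\<Sum>i<m. E / c) < (\<Sum>i<m. (norm (v i))\<^sup>2)" using i by (intro sum_strict_mono) auto
    then show False using sum_v by simp
  qed
  then obtain j where j: "j < m" "norm (v j) \<le> sqrt (E / c)" using real_le_rsqrt by blast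
  have "norm (p j) \<le> norm (g (X j)) * norm (v j)" unfolding p_def by (rule norm_matrix_vector_mult_le)
  also have "\<dots> \<le> \<Lambda> * sqrt (E / c)" using j \<Lambda>B[of j] \<Lambda>0 E0 by (intro mult_mono) auto
  finally have pj: "norm (p j) \<le> \<Lambda> * sqrt (E / c)" .
  have inc: "norm (p (Suc k) - p k) \<le> (B / 2 / m) * (norm (v (Suc k)))\<^sup>2" if "Suc k < m" for k
  proof -
    have "p (Suc k) - p k = (1 / m) *\<^sub>R force (X (Suc k)) (v (Suc k))"
      unfolding p_def v_def by (rule discrete_Euler_Lagrange[OF min that]) auto
    then have "norm (p (Suc k) - p k) = norm (force (X (Suc k)) (v (Suc k))) / m" by simp
    also have "\<dots> \<le> (norm (g' (X (Suc k))) * (norm (v (Suc k)))\<^sup>2 / 2) / m"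
      by (intro divide_right_mono norm_force_le) auto
    also have "\<dots> \<le> (B * (norm (v (Suc k)))\<^sup>2 / 2) / m"
      using \<Lambda>B[of "Suc k"] that by (intro divide_right_mono mult_right_mono) auto
    finally show ?thesis by simp
  qed
  have diff: "norm (p l - p k) \<le> B / 2 * (E / c)" if "k \<le> l" "l < m" for k l
  proof -
    have "p l - p k = (\<Sum>i=k..<l. p (Suc i) - p i)" using that by (simp add: sum_Suc_diff')
    also have "norm \<dots> \<le> (\<Sum>i=k..<l. (B / 2 / m) * (norm (v (Suc i)))\<^sup>2)"
      using that by (intro sum_norm_le inc) auto
    also have "\<dots> = (\<Sum>i\<in>Suc ` {k..<l}. (B / 2 / m) * (norm (v i))\<^sup>2)"
      by (simp add: sum.reindex del: image_Suc_atLeastLessThan)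
    also have "\<dots> \<le> (\<Sum>i<m. (B / 2 / m) * (norm (v i))\<^sup>2)"
      using that \<Lambda>0 by (intro sum_mono2) auto
    also have "\<dots> \<le> (B / 2 / m) * (m * (E / c))"
      unfolding sum_distrib_left[symmetric] using sum_v \<Lambda>0 by (intro mult_left_mono) auto
    finally show ?thesis using m by simp
  qed
  have "norm (p i - p j) \<le> B / 2 * (E / c)"
    using diff[of i j] diff[of j i] i j by (cases "i \<le> j") (auto simp: norm_minus_commute)
  then have "norm (p i) \<le> \<Lambda> * sqrt (E / c) + B / 2 * (E / c)"
    using pj norm_triangle_sub[of "p i" "p j"] by linarith
  then show ?thesis by (simp add: p_def)
qed

text \<open>The energies of the minimal chains are squeezed: asymptotically they are at least the
  squared length of the limit curve, and at most the squared length of any competitor, sampled with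
  the same number of steps.\<close>

theorem exists_minimizing_ham_curve:
  obtains z where "integral_curve ham {0..1} z" "fst (z 0) = x" "fst (z 1) = y"
    "\<And>a b \<sigma> D. has_velocity a b \<sigma> D \<Longrightarrow> a < b \<Longrightarrow> \<sigma> a = x \<Longrightarrow> \<sigma> b = y \<Longrightarrow>
      riem_length g 0 1 (\<lambda>t. fst (z t)) \<le> riem_length g a b \<sigma>"
proof -
  \<comment> \<open>Sampling the straight segment with \<open>\<eta> = 1\<close> bounds the energy
    of all minimal chains with sufficiently many steps.\<close>
  define E where "E = 2 * (riem_length g 0 1 (\<lambda>t. x + t *\<^sub>R (y - x)))\<^sup>2"
  have seg: "has_velocity 0 1 (\<lambda>t. x + t *\<^sub>R (y - x)) (\<lambda>_. y - x)" by (rule has_velocity_segment)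
  obtain N where N: "\<And>m. m \<ge> N \<Longrightarrow> \<exists>X. X 0 = x \<and> X m = y \<and> energy m X \<le> E"
    using energy_sampling[OF seg, of 1] unfolding eventually_sequentially E_def by auto
  define m where "m n = n + Suc N" for n
  have m_pos: "m n > 0" for n by (simp add: m_def)
  have m_lim: "filterlim m at_top sequentially"
    unfolding m_def by (intro filterlim_at_top_mono[OF filterlim_ident]) auto
  have "\<exists>X. X 0 = x \<and> X (m n) = y \<and> (\<forall>Y. Y 0 = x \<longrightarrow> Y (m n) = y \<longrightarrow> energy (m n) X \<le> energy (m n) Y)" for n
    using exists_energy_minimizer[OF m_pos[of n], of x y] by metis
  then obtain X where X: "\<And>n. X n 0 = x" "\<And>n. X n (m n) = y"
    and min: "\<And>n Y. Y 0 = x \<Longrightarrow> Y (m n) = y \<Longrightarrow> energy (m n) (X n) \<le> energy (m n) Y" by metis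
  have E: "energy (m n) (X n) \<le> E" for n
  proof -
    obtain Y where "Y 0 = x" "Y (m n) = y" "energy (m n) Y \<le> E" using N[of "m n"] by (auto simp: m_def)
    then show ?thesis using min[of Y n] by linarith
  qed
  define K where "K = cball x (sqrt (E / c))"
  have "compact K" by (simp add: K_def)
  then have "bounded (g ` K)" "bounded (g' ` K)"
    by (auto intro!: compact_imp_bounded compact_continuous_image continuous_on_subset[OF cont] continuous_on_subset[OF cont_deriv])
  then obtain \<Lambda> B where \<Lambda>B: "\<And>u. u \<in> K \<Longrightarrow> norm (g u) \<le> \<Lambda>" "\<And>u. u \<in> K \<Longrightarrow> norm (g' u) \<le> B"
    unfolding bounded_iff by (metis imageI)
  define P where "P = \<Lambda> * sqrt (E / c) + B / 2 * (E / c)"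
  define v where "v n i = real (m n) *\<^sub>R (X n (Suc i) - X n i)" for n i
  define f where "f n i = force (X n i) (v n i)" for n i
  \<comment> \<open>The last vertex starts no step and has no velocity; its momentum is defined by
    an explicit Euler step, so that this step carries no error.\<close>
  define p where "p n i = (if i < m n then g (X n i) *v v n i else
     g (X n (m n - 1)) *v v n (m n - 1) + (1 / m n) *\<^sub>R f n (m n - 1))" for n i
  define z where "z n i = (X n i, p n i)" for n i
  have XK: "X n i \<in> K" if "i \<le> m n" for n i
  proof -
    have "c * (norm (X n i - x))\<^sup>2 \<le> E"
      using chain_displacement[OF that, of "X n"] E[of n] X(1) by (metis order_trans)
    then have "(norm (X n i - x))\<^sup>2 \<le> E / c" using c_pos by (simp add: field_simps)
    then show ?thesis unfolding K_def by (simp add: dist_norm norm_minus_commute real_le_rsqrt)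
  qed
  have pP: "norm (p n i) \<le> P" if "i < m n" for n i
  proof -
    have "norm (g (X n i) *v (real (m n) *\<^sub>R (X n (Suc i) - X n i))) \<le> P"
      unfolding P_def
    proof (rule discrete_momentum_bound[OF _ E _ that])
      show "norm (g u) \<le> \<Lambda> \<and> norm (g' u) \<le> B" if "norm (u - X n 0) \<le> sqrt (E / c)" for u
        using that \<Lambda>B[of u] by (simp add: K_def X dist_norm norm_minus_commute)
    qed (simp add: X min)
    then show ?thesis using that by (simp add: p_def v_def)
  qed
  have ham_z: "ham (z n i) = (v n i, f n i)" if "i < m n" for n i
    using that by (simp add: ham_def z_def p_def f_def)
  define K' where "K' = K \<times> cball (0 :: real ^ 'n) P"
  have zK': "z n i \<in> K'" if "i < m n" for n i
    using XK[of i n] pP[OF that] that by (auto simp: z_def K'_def)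
  have K': "compact K'" unfolding K'_def by (intro compact_Times \<open>compact K\<close> compact_cball)
  have "bounded (ham ` K')"
    by (intro compact_imp_bounded compact_continuous_image continuous_on_ham continuous_on_id K')
  then obtain C where "\<And>u. u \<in> K' \<Longrightarrow> norm (ham u) \<le> C" by (auto simp: bounded_iff)
  then have C: "norm (v n i) \<le> C" "norm (f n i) \<le> C" if "i < m n" for n i
    using ham_z[OF that] zK'[OF that] norm_fst_le[of "v n i" "f n i"] norm_snd_le[of "f n i" "v n i"] order_trans
    by metis+
  have X_step: "X n (Suc i) - X n i = (1 / m n) *\<^sub>R v n i" for n i
    using m_pos[of n] by (simp add: v_def)
  have p_step: "p n (Suc i) - p n i = (1 / m n) *\<^sub>R f n (Suc i)" if "Suc i < m n" for n i
    using discrete_Euler_Lagrange[of "X n" "m n" i] that by (simp add: p_def f_def v_def X min)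
  have p_last: "p n (Suc i) - p n i = (1 / m n) *\<^sub>R f n i" if "Suc i = m n" for n i
    using that[symmetric] by (simp add: p_def)
  \<comment> \<open>The chain uses the force at \<open>Suc i\<close>, whereas the scheme for
    \<open>ham\<close> evaluates it at \<open>i\<close>; \<open>e n\<close> is the worst
    discrepancy. The inserted 0 covers a chain with a single step.\<close>
  define e where "e n = Max (insert 0 ((\<lambda>i. norm (f n (Suc i) - f n i)) ` {i. Suc i < m n}))" for n
  have fin: "finite {i. Suc i < k}" for k by (rule finite_subset[of _ "{..<k}"]) auto
  have e_ge: "norm (f n (Suc i) - f n i) \<le> e n" if "Suc i < m n" for n i
    unfolding e_def using that fin by (intro Max_ge) auto
  have e0: "e n \<ge> 0" for n unfolding e_def using fin by (intro Max_ge) auto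
  have step: "norm (z n (Suc i) - z n i - (1 / m n) *\<^sub>R ham (z n i)) \<le> e n / m n" if i: "i < m n" for n i
  proof -
    have "z n (Suc i) - z n i - (1 / m n) *\<^sub>R ham (z n i) = (0, p n (Suc i) - p n i - (1 / m n) *\<^sub>R f n i)"
      unfolding ham_z[OF i] by (simp add: z_def X_step)
    also have "norm \<dots> \<le> e n / m n"
    proof (cases "Suc i < m n")
      case True
      have "p n (Suc i) - p n i - (1 / m n) *\<^sub>R f n i = (1 / m n) *\<^sub>R (f n (Suc i) - f n i)"
        unfolding p_step[OF True] by (simp add: scaleR_right_diff_distrib)
      then show ?thesis using e_ge[OF True] by (simp add: norm_Pair divide_right_mono)
    next
      case False
      then have "Suc i = m n" using i by simp
      then show ?thesis using p_last[of i n] e0[of n] by (simp add: norm_Pair)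
    qed
    finally show ?thesis .
  qed
  have ucont: "uniformly_continuous_on K' ham"
    by (intro compact_uniformly_continuous continuous_on_ham continuous_on_id K')
  \<comment> \<open>Consecutive phase points are at most \<open>2 * C / m n\<close> apart, and
    \<open>ham\<close> is uniformly continuous on \<open>K'\<close>.\<close>
  have e_lim: "e \<longlonglongrightarrow> 0"
  proof (rule LIMSEQ_I)
    fix \<epsilon> :: real assume \<epsilon>: "0 < \<epsilon>"
    obtain \<delta> where \<delta>: "\<delta> > 0" "\<And>u w. u \<in> K' \<Longrightarrow> w \<in> K' \<Longrightarrow> dist w u < \<delta> \<Longrightarrow> dist (ham w) (ham u) < \<epsilon>"
      using ucont \<epsilon> unfolding uniformly_continuous_on_def by metis
    have "(\<lambda>n. (2 * C) / real (m n)) \<longlonglongrightarrow> 0"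
      by (intro real_tendsto_divide_at_top[OF tendsto_const] filterlim_compose[OF filterlim_real_sequentially m_lim])
    then have "\<forall>\<^sub>F n in sequentially. (2 * C) / real (m n) < \<delta>" using \<delta> by (intro order_tendstoD)
    then have "\<forall>\<^sub>F n in sequentially. norm (e n - 0) < \<epsilon>"
    proof eventually_elim
      case (elim n)
      have "norm (f n (Suc i) - f n i) < \<epsilon>" if i: "Suc i < m n" for i
      proof -
        have "z n (Suc i) - z n i = ((1 / m n) *\<^sub>R v n i, (1 / m n) *\<^sub>R f n (Suc i))"
          by (simp add: z_def X_step p_step[OF i])
        then have "norm (z n (Suc i) - z n i) \<le> norm ((1 / m n) *\<^sub>R v n i) + norm ((1 / m n) *\<^sub>R f n (Suc i))"
          by (simp only: norm_Pair_le)
        also have "\<dots> \<le> C / m n + C / m n"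
          using C[of i n] C[of "Suc i" n] i by (intro add_mono) (auto simp: divide_right_mono)
        also have "\<dots> < \<delta>" using elim by simp
        finally have "dist (ham (z n (Suc i))) (ham (z n i)) < \<epsilon>"
          using i by (intro \<delta>(2) zK') (auto simp: dist_norm)
        then have "norm (v n (Suc i) - v n i, f n (Suc i) - f n i) < \<epsilon>"
          using i ham_z[of i n] ham_z[of "Suc i" n] by (simp add: dist_norm)
        then show ?thesis using norm_snd_le order.strict_trans1 by blast
      qed
      then have "e n < \<epsilon>" unfolding e_def using fin \<epsilon> by (subst Max_less_iff) auto
      then show ?case using e0[of n] by simp
    qed
    then show "\<exists>no. \<forall>n\<ge>no. norm (e n - 0) < \<epsilon>" by (simp add: eventually_sequentially)
  qed
  obtain R where R: "\<And>u. u \<in> K' \<Longrightarrow> norm u \<le> R"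
    using compact_imp_bounded[OF K'] by (auto simp: bounded_iff)
  obtain \<zeta> r where r: "strict_mono (r :: nat \<Rightarrow> nat)" and \<zeta>: "integral_curve ham {0..1} \<zeta>"
    and conv: "\<And>\<epsilon>. \<epsilon> > 0 \<Longrightarrow> \<forall>\<^sub>F n in sequentially. \<forall>i\<le>m (r n). norm (z (r n) i - \<zeta> (i / m (r n))) < \<epsilon>"
    using one_step_scheme_limit[where F = ham and m = m and z = z and e = e and K = R, OF continuous_on_ham[OF continuous_on_id] m_lim m_pos R[OF zK'] step e_lim] by blast
  have endpoint: "fst (\<zeta> t) = w"
    if w: "\<And>n. \<exists>i\<le>m n. i / m n = t \<and> X n i = w" for t w
  proof (rule ccontr)
    assume "fst (\<zeta> t) \<noteq> w"
    then have "norm (w - fst (\<zeta> t)) > 0" by simp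
    from conv[OF this] have "\<forall>\<^sub>F n in sequentially. False"
    proof eventually_elim
      case (elim n)
      obtain i where i: "i \<le> m (r n)" "i / m (r n) = t" "X (r n) i = w" using w by blast
      have "norm (w - fst (\<zeta> t)) \<le> norm (z (r n) i - \<zeta> t)"
        using norm_fst_le[of "w - fst (\<zeta> t)" "snd (z (r n) i - \<zeta> t)"] i by (simp add: z_def minus_prod_def)
      moreover have "norm (z (r n) i - \<zeta> (i / m (r n))) < norm (w - fst (\<zeta> t))" using elim i(1) by blast
      ultimately show ?case unfolding i(2) by simp
    qed
    then show False by simp
  qed
  have ends: "fst (\<zeta> 0) = x" "fst (\<zeta> 1) = y"
    using X m_pos by (intro endpoint; force)+
  \<comment> \<open>Twice the Hamiltonian, that is, the squared speed. It is constant along the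
    limit, and the energy of a chain is its average over the first \<open>m n\<close> nodes.\<close>
  define H where "H u = snd u \<bullet> inv_metric (fst u) (snd u)" for u :: "(real ^ 'n) \<times> (real ^ 'n)"
  define s0 where "s0 = riem_length g 0 1 (\<lambda>t. fst (\<zeta> t))"
  have H_const: "H (\<zeta> t) = s0\<^sup>2" if "t \<in> {0..1}" for t
    using riem_length_ham_curve[OF \<zeta> that] by (simp add: H_def s0_def speed_sq inner_commute)
  have energy_H: "energy (m n) (X n) = (\<Sum>i<m n. H (z n i) / m n)" for n
    unfolding energy_def
  proof (intro sum.cong refl)
    fix i assume i: "i \<in> {..<m n}"
    have "H (z n i) = (speed (X n i) (v n i))\<^sup>2" using i by (simp add: H_def z_def p_def speed_sq inner_commute)
    also have "\<dots> = (real (m n))\<^sup>2 * (speed (X n i) (X n (Suc i) - X n i))\<^sup>2"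
      unfolding v_def by (subst speed_scale) (auto simp: power_mult_distrib)
    finally show "real (m n) * (speed (X n i) (X n (Suc i) - X n i))\<^sup>2 = H (z n i) / m n"
      using m_pos[of n] by (simp add: power2_eq_square)
  qed
  have lower_lim: "\<forall>\<^sub>F n in sequentially. s0\<^sup>2 - \<epsilon> \<le> energy (m (r n)) (X (r n))" if \<epsilon>: "\<epsilon> > 0" for \<epsilon>
  proof -
    \<comment> \<open>Nodes have norm at most \<open>R\<close>, and the limit curve is eventually
      within 1 of them.\<close>
    let ?K = "cball (0 :: (real ^ 'n) \<times> (real ^ 'n)) (R + 1)"
    have "uniformly_continuous_on ?K H"
      unfolding H_def by (intro compact_uniformly_continuous continuous_intros compact_cball)
    then obtain \<delta> where \<delta>: "\<delta> > 0" "\<And>u w. u \<in> ?K \<Longrightarrow> w \<in> ?K \<Longrightarrow> dist w u < \<delta> \<Longrightarrow> dist (H w) (H u) < \<epsilon>"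
      using \<epsilon> unfolding uniformly_continuous_on_def by metis
    have "\<forall>\<^sub>F n in sequentially. \<forall>i\<le>m (r n). norm (z (r n) i - \<zeta> (i / m (r n))) < min \<delta> 1"
      using \<delta> by (intro conv) auto
    then show ?thesis
    proof eventually_elim
      case (elim n)
      let ?m = "m (r n)"
      have "(s0\<^sup>2 - \<epsilon>) / ?m \<le> H (z (r n) i) / ?m" if i: "i < ?m" for i
      proof -
        have t: "real i / ?m \<in> {0..1}" using i by simp
        have d: "norm (z (r n) i - \<zeta> (i / ?m)) < min \<delta> 1" using elim i by simp
        have zR: "norm (z (r n) i) \<le> R" by (intro R zK' i)
        have "norm (\<zeta> (i / ?m)) \<le> R + 1"
          using d zR norm_triangle_sub[of "\<zeta> (i / ?m)" "z (r n) i"] by (simp add: norm_minus_commute)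
        then have "dist (H (z (r n) i)) (H (\<zeta> (i / ?m))) < \<epsilon>"
          using d zR by (intro \<delta>(2)) (auto simp: dist_norm)
        then have "s0\<^sup>2 - \<epsilon> \<le> H (z (r n) i)" using H_const[OF t] by (simp add: dist_real_def)
        then show ?thesis by (intro divide_right_mono) auto
      qed
      then have "(\<Sum>i<?m. (s0\<^sup>2 - \<epsilon>) / ?m) \<le> energy ?m (X (r n))"
        unfolding energy_H by (intro sum_mono) auto
      then show ?case using m_pos[of "r n"] by simp
    qed
  qed
  show ?thesis
  proof (rule that[OF \<zeta> ends])
    fix a b \<sigma> D assume \<sigma>: "has_velocity a b \<sigma> D" "a < b" "\<sigma> a = x" "\<sigma> b = y"
    define L where "L = riem_length g a b \<sigma>"
    have L0: "L \<ge> 0" unfolding L_def by (rule riem_length_nonneg[OF \<sigma>(1)])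
    have mr: "filterlim (\<lambda>n. m (r n)) at_top sequentially"
      using m_lim filterlim_subseq[OF r] by (rule filterlim_compose)
    have "s0\<^sup>2 \<le> L\<^sup>2 + \<epsilon>" if \<epsilon>: "\<epsilon> > 0" for \<epsilon>
    proof -
      \<comment> \<open>The 1 is added because \<open>L\<close> may vanish.\<close>
      define K where "K = L\<^sup>2 + 1"
      define \<eta> where "\<eta> = \<epsilon> / 2 / K"
      have K: "K > 0" by (simp add: K_def add_nonneg_pos)
      have \<eta>: "\<eta> > 0" using \<epsilon> K by (simp add: \<eta>_def)
      have "\<eta> * L\<^sup>2 \<le> \<eta> * K" using \<eta> by (intro mult_left_mono) (auto simp: K_def)
      also have "\<dots> = \<epsilon> / 2" using K by (simp add: \<eta>_def)
      finally have \<eta>L: "(1 + \<eta>) * L\<^sup>2 \<le> L\<^sup>2 + \<epsilon> / 2" by (simp add: distrib_right)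
      have "\<forall>\<^sub>F n in sequentially. \<exists>Y. Y 0 = \<sigma> a \<and> Y (m (r n)) = \<sigma> b \<and> energy (m (r n)) Y \<le> (1 + \<eta>) * (riem_length g a b \<sigma>)\<^sup>2"
        using energy_sampling[OF \<sigma>(1,2) \<eta>] mr by (rule eventually_compose_filterlim)
      moreover have "\<forall>\<^sub>F n in sequentially. s0\<^sup>2 - \<epsilon> / 2 \<le> energy (m (r n)) (X (r n))"
        using \<epsilon> by (intro lower_lim) auto
      ultimately have "\<forall>\<^sub>F n in sequentially. s0\<^sup>2 \<le> L\<^sup>2 + \<epsilon>"
      proof eventually_elim
        case (elim n)
        then obtain Y where Y: "Y 0 = x" "Y (m (r n)) = y" "energy (m (r n)) Y \<le> (1 + \<eta>) * L\<^sup>2"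
          using \<sigma> by (auto simp: L_def)
        have "energy (m (r n)) (X (r n)) \<le> L\<^sup>2 + \<epsilon> / 2" using min[OF Y(1,2)] Y(3) \<eta>L by linarith
        then show ?case using elim(2) by linarith
      qed
      then show ?thesis by simp
    qed
    then have "s0\<^sup>2 \<le> L\<^sup>2" by (rule field_le_epsilon)
    then show "riem_length g 0 1 (\<lambda>t. fst (\<zeta> t)) \<le> riem_length g a b \<sigma>"
      unfolding s0_def[symmetric] L_def[symmetric] using L0 by (rule power2_le_imp_le)
  qed
qed

end

text \<open>Equivalently, balls of the Riemannian distance are bounded, as in the Hopf-Rinow
  theorem. Phrased with curves it also applies to every initial piece, and so confines a short curve
  as a whole.\<close>

definition length_proper :: "(real ^ 'n \<Rightarrow> real ^ 'n ^ 'n) \<Rightarrow> bool" where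
  "length_proper g \<longleftrightarrow> (\<forall>x M. \<exists>r. \<forall>a b \<gamma>. C1_curve a b \<gamma> \<longrightarrow> \<gamma> a = x \<longrightarrow> riem_length g a b \<gamma> \<le> M \<longrightarrow> norm (\<gamma> b) \<le> r)"

subsection \<open>Geodesic completeness\<close>

lemma continuous_first_hit:
  fixes f :: "real \<Rightarrow> real"
  assumes f: "continuous_on {a..b} f" "a \<le> b" "f a \<le> y" "y \<le> f b"
  obtains t where "t \<in> {a..b}" "f t = y" "\<And>s. s \<in> {a..t} \<Longrightarrow> f s \<le> y"
proof -
  define S where "S = {a..b} \<inter> f -` {y}"
  have "closed S" unfolding S_def by (intro continuous_closed_preimage f) auto
  moreover have "bounded S" by (rule bounded_subset[of "{a..b}"]) (auto simp: S_def)
  ultimately have "compact S" by (simp add: compact_eq_bounded_closed)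
  moreover have "S \<noteq> {}" using IVT'[OF f(3,4,2,1)] by (auto simp: S_def)
  ultimately obtain t where t: "t \<in> S" "\<And>s. s \<in> S \<Longrightarrow> t \<le> s"
    using compact_attains_inf[of S] by auto
  show ?thesis
  proof (rule that[of t])
    show "t \<in> {a..b}" "f t = y" using t(1) by (auto simp: S_def)
    fix s assume s: "s \<in> {a..t}"
    show "f s \<le> y"
    proof (rule ccontr)
      assume gt: "\<not> f s \<le> y"
      have "continuous_on {a..s} f" using s t(1) by (intro continuous_on_subset[OF f(1)]) (auto simp: S_def)
      then obtain u where u: "a \<le> u" "u \<le> s" "f u = y"
        using IVT'[of f a y s] gt s f(3) by auto
      then have "u \<in> S" using s t(1) by (auto simp: S_def)
      then have "u = s" using t(2) s u by force
      then show False using gt u by simp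
    qed
  qed
qed

context C1_metric begin

text \<open>Peano's theorem is applied to a bounded field, \<open>ham\<close> composed with the
  projection to a ball. Until the first exit from the ball its solution is a true one of constant
  speed \<open>H\<close>; within time 1 its length is at most \<open>H\<close>, so
  \<open>length_proper\<close> bounds the position and ellipticity on \<open>cball 0 r\<close> the
  momentum, which excludes an exit.\<close>

lemma ham_curve_forward:
  assumes "length_proper g"
  obtains \<zeta> where "integral_curve ham {0..1} \<zeta>" "\<zeta> 0 = z0"
proof -
  define H where "H = speed (fst z0) (inv_metric (fst z0) (snd z0))"
  have H0: "H \<ge> 0" by (simp add: H_def speed_nonneg)
  obtain r where r: "\<And>a b \<gamma>. C1_curve a b \<gamma> \<Longrightarrow> \<gamma> a = fst z0 \<Longrightarrow> riem_length g a b \<gamma> \<le> H \<Longrightarrow> norm (\<gamma> b) \<le> r"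
    using assms unfolding length_proper_def by meson
  obtain c where c: "c > 0" "\<And>x v. x \<in> cball 0 r \<Longrightarrow> c * (norm v)\<^sup>2 \<le> v \<bullet> (g x *v v)"
    using SPD_uniform_lower[OF continuous_on_subset[OF cont subset_UNIV] SPD compact_cball] by metis
  have "bounded (g ` cball 0 r)"
    by (intro compact_imp_bounded compact_continuous_image continuous_on_subset[OF cont]) auto
  then obtain \<Lambda> where \<Lambda>: "\<And>x. x \<in> cball 0 r \<Longrightarrow> norm (g x) \<le> \<Lambda>" unfolding bounded_iff by (metis imageI)
  \<comment> \<open>\<open>r\<close> bounds the position and \<open>\<Lambda> * (H / sqrt c)\<close>
    the momentum.\<close>
  define \<rho> where "\<rho> = max (norm z0) (r + \<Lambda> * (H / sqrt c)) + 1"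
  let ?B = "cball (0 :: (real ^ 'n) \<times> (real ^ 'n)) \<rho>"
  have \<rho>: "norm z0 < \<rho>" "r + \<Lambda> * (H / sqrt c) < \<rho>" by (auto simp: \<rho>_def)
  then have \<rho>0: "\<rho> \<ge> 0" using norm_ge_zero[of z0] by linarith
  then have ne: "?B \<noteq> {}" by simp
  define F where "F = ham \<circ> closest_point ?B"
  have F_cont: "continuous_on UNIV F"
    unfolding F_def o_def by (intro continuous_on_ham continuous_on_closest_point convex_cball closed_cball ne)
  have "bounded (ham ` ?B)"
    by (intro compact_imp_bounded compact_continuous_image continuous_on_ham continuous_on_id compact_cball)
  then obtain C where "\<And>u. u \<in> ?B \<Longrightarrow> norm (ham u) \<le> C" unfolding bounded_iff by (metis imageI)
  then have "norm (F u) \<le> C" for u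
    unfolding F_def o_def using closest_point_in_set[OF closed_cball ne] by blast
  then obtain \<zeta> where \<zeta>: "integral_curve F {0..1} \<zeta>" "\<zeta> 0 = z0"
    using Peano_bounded[OF F_cont] by metis
  have F_ham: "F u = ham u" if "norm u \<le> \<rho>" for u
    using that by (simp add: F_def closest_point_self)
  have \<zeta>_cont: "continuous_on {0..1} \<zeta>"
    using \<zeta>(1) has_vector_derivative_continuous unfolding integral_curve_def continuous_on_eq_continuous_within by blast
  have inside: "norm (\<zeta> t) < \<rho>" if "t \<in> {0..1}" for t
  proof (rule ccontr)
    assume "\<not> norm (\<zeta> t) < \<rho>"
    then have ge: "\<rho> \<le> norm (\<zeta> t)" by simp
    have cont_t: "continuous_on {0..t} (\<lambda>u. norm (\<zeta> u))"
      using that by (intro continuous_intros continuous_on_subset[OF \<zeta>_cont]) auto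
    have "0 \<le> t" using that by simp
    then obtain s where s: "s \<in> {0..t}" "norm (\<zeta> s) = \<rho>" "\<And>u. u \<in> {0..s} \<Longrightarrow> norm (\<zeta> u) \<le> \<rho>"
      by (rule continuous_first_hit[OF cont_t _ _ ge]) (use \<rho>(1) \<zeta>(2) in auto)
    have "s \<noteq> 0" using s(2) \<zeta>(2) \<rho>(1) by auto
    then have s01: "0 < s" "s \<le> 1" using s(1) that by auto
    have "integral_curve F {0..s} \<zeta>" using \<zeta>(1) s01 by (intro integral_curve_subset[OF \<zeta>(1)]) auto
    moreover have "F (\<zeta> u) = ham (\<zeta> u)" if "u \<in> {0..s}" for u
      using that by (intro F_ham s(3))
    ultimately have h: "integral_curve ham {0..s} \<zeta>" by (simp add: integral_curve_def)
    have "riem_length g 0 s (\<lambda>t. fst (\<zeta> t)) = s * H"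
      using riem_length_ham_curve[OF h, of 0] s01 by (simp add: H_def \<zeta>(2))
    also have "\<dots> \<le> H" using s01 H0 by (simp add: mult_left_le_one_le)
    finally have "norm (fst (\<zeta> s)) \<le> r"
      using has_velocity_ham_curve[OF h] s01 \<zeta>(2) by (intro r[of 0 s]) (auto simp: C1_curve_iff)
    then have sr: "fst (\<zeta> s) \<in> cball 0 r" by simp
    let ?v = "inv_metric (fst (\<zeta> s)) (snd (\<zeta> s))"
    have "speed (fst (\<zeta> s)) ?v = H"
      using ham_curve_constant_speed[OF h, of s 0] s01 by (simp add: H_def \<zeta>(2))
    then have "c * (norm ?v)\<^sup>2 \<le> H\<^sup>2" using c(2)[OF sr, of ?v] speed_sq[of "fst (\<zeta> s)" ?v] by simp
    then have "sqrt (c * (norm ?v)\<^sup>2) \<le> sqrt (H\<^sup>2)" by (rule real_sqrt_le_mono)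
    then have vH: "norm ?v \<le> H / sqrt c" using H0 c(1) by (simp add: real_sqrt_mult pos_le_divide_eq mult.commute)
    have "norm (snd (\<zeta> s)) = norm (g (fst (\<zeta> s)) *v ?v)" by simp
    also have "\<dots> \<le> norm (g (fst (\<zeta> s))) * norm ?v" by (rule norm_matrix_vector_mult_le)
    also have "\<dots> \<le> \<Lambda> * (H / sqrt c)"
      using \<Lambda>[OF sr] by (intro mult_mono vH) (auto intro: order_trans[OF norm_ge_zero])
    finally have "norm (snd (\<zeta> s)) \<le> \<Lambda> * (H / sqrt c)" .
    then have "norm (\<zeta> s) \<le> r + \<Lambda> * (H / sqrt c)"
      using norm_Pair_le[of "fst (\<zeta> s)" "snd (\<zeta> s)"] sr by simp
    then show False using s(2) \<rho>(2) by simp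
  qed
  have "integral_curve ham {0..1} \<zeta>"
    using \<zeta>(1) F_ham inside unfolding integral_curve_def by (metis less_imp_le)
  then show ?thesis using that \<zeta>(2) by blast
qed

lemma ham_curve_backward:
  assumes "length_proper g"
  obtains \<zeta> where "integral_curve ham {-1..0} \<zeta>" "\<zeta> 0 = z0"
proof -
  let ?R = "\<lambda>z :: (real ^ 'n) \<times> (real ^ 'n). (fst z, - snd z)"
  obtain \<eta> where \<eta>: "integral_curve ham {0..1} \<eta>" "\<eta> 0 = ?R z0"
    using ham_curve_forward[OF assms] by blast
  have R: "bounded_linear ?R"
    by (intro bounded_linear_Pair bounded_linear_fst bounded_linear_minus bounded_linear_snd)
  have "integral_curve ham {-1..0} (\<lambda>t. ?R (\<eta> (- t)))"
    unfolding integral_curve_def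
  proof
    fix t :: real assume t: "t \<in> {-1..0}"
    have "(uminus has_vector_derivative - 1) (at t within {-1..0})"
      by (auto intro!: derivative_eq_intros)
    moreover have "(\<eta> has_vector_derivative ham (\<eta> (- t))) (at (- t) within uminus ` {-1..0})"
      using \<eta>(1) t by (simp add: integral_curve_def)
    ultimately have "((\<lambda>t. \<eta> (- t)) has_vector_derivative - ham (\<eta> (- t))) (at t within {-1..0})"
      using vector_diff_chain_within[of uminus "- 1" t "{-1..0}" \<eta>] by (simp add: o_def)
    then have "((\<lambda>t. ?R (\<eta> (- t))) has_vector_derivative ?R (- ham (\<eta> (- t)))) (at t within {-1..0})"
      by (rule bounded_linear.has_vector_derivative[OF R])
    then show "((\<lambda>t. ?R (\<eta> (- t))) has_vector_derivative ham (?R (\<eta> (- t)))) (at t within {-1..0})"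
      by (simp add: ham_reflect)
  qed
  then show ?thesis using that[of "\<lambda>t. ?R (\<eta> (- t))"] \<eta>(2) by simp
qed

theorem geodesically_complete_if_length_proper:
  assumes "length_proper g"
  shows "geodesically_complete g"
  unfolding geodesically_complete_def
proof (intro allI)
  fix x v
  have "\<exists>\<zeta>. integral_curve ham {0..1} \<zeta> \<and> \<zeta> 0 = u" "\<exists>\<zeta>. integral_curve ham {-1..0} \<zeta> \<and> \<zeta> 0 = u" for u
    using ham_curve_forward[OF assms] ham_curve_backward[OF assms] by metis+
  then obtain z where z: "integral_curve ham UNIV z" "z 0 = (x, g x *v v)"
    by (rule integral_curve_global)
  show "\<exists>\<gamma>. geodesic_on g UNIV \<gamma> \<and> \<gamma> 0 = x \<and> (\<gamma> has_vector_derivative v) (at 0)"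
    using geodesic_on_ham_curve[OF z(1)] ham_curve_derivatives(1)[OF z(1), of 0] z(2)
    by (intro exI[of _ "\<lambda>t. fst (z t)"]) simp
qed

end

subsection \<open>Existence of minimizing geodesics\<close>

text \<open>For nonnegative \<open>r\<close> it vanishes on the ball of radius \<open>r\<close> and
  is at least 1 beyond radius \<open>sqrt (r^2 + 1)\<close>. The outer square makes it continuously
  differentiable, so the perturbed metric and its derivative agree with the original on the closed
  ball.\<close>

definition bump :: "real \<Rightarrow> real ^ 'n \<Rightarrow> real" where
  "bump r x = (max 0 (x \<bullet> x - r\<^sup>2))\<^sup>2"

lemma has_real_derivative_max_0_sq:
  "((\<lambda>s :: real. (max 0 s)\<^sup>2) has_real_derivative 2 * max 0 s) (at s)"
proof -
  consider "s < 0" | "s > 0" | "s = 0" by linarith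
  then show ?thesis
  proof cases
    case 1
    have "((\<lambda>s :: real. 0) has_real_derivative 2 * max 0 s) (at s)" using 1 by simp
    then show ?thesis
      by (rule has_field_derivative_transform_within_open[of _ _ _ "{..<0}"]) (use 1 in auto)
  next
    case 2
    have "((\<lambda>s :: real. s\<^sup>2) has_real_derivative 2 * max 0 s) (at s)"
      using 2 by (auto intro!: derivative_eq_intros)
    then show ?thesis
      by (rule has_field_derivative_transform_within_open[of _ _ _ "{0<..}"]) (use 2 in auto)
  next
    case 3
    have "((\<lambda>h :: real. (max 0 h)\<^sup>2 / h) \<longlongrightarrow> 0) (at 0)"
    proof (rule Lim_null_comparison[of _ abs])
      have "norm ((max 0 h)\<^sup>2 / h) \<le> \<bar>h\<bar>" for h :: real
        by (cases "h \<le> 0") (auto simp: power2_eq_square max_def)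
      then show "\<forall>\<^sub>F h :: real in at 0. norm ((max 0 h)\<^sup>2 / h) \<le> \<bar>h\<bar>" by simp
      show "(abs \<longlongrightarrow> (0 :: real)) (at 0)" by (intro tendsto_rabs_zero tendsto_ident_at)
    qed
    then show ?thesis using 3 by (simp add: DERIV_def)
  qed
qed

lemma has_derivative_bump:
  fixes x :: "real ^ 'n"
  shows "(bump r has_derivative (\<lambda>h. 4 * max 0 (x \<bullet> x - r\<^sup>2) * (x \<bullet> h))) (at x)"
proof -
  have "((\<lambda>x :: real ^ 'n. x \<bullet> x - r\<^sup>2) has_derivative (\<lambda>h. 2 * (x \<bullet> h))) (at x)"
    by (auto intro!: derivative_eq_intros simp: inner_commute)
  from has_derivative_compose[OF this has_real_derivative_max_0_sq[unfolded has_field_derivative_def]]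
  show ?thesis by (simp add: bump_def[abs_def] mult_ac)
qed

context C1_metric begin

text \<open>Adding to \<open>g\<close> instead of cutting it off can only increase lengths, and
  leaves the lengths of curves inside the ball unchanged.\<close>

definition confined :: "real \<Rightarrow> real ^ 'n \<Rightarrow> real ^ 'n ^ 'n" where
  "confined r x = g x + bump r x *\<^sub>R mat 1"

definition confined' :: "real \<Rightarrow> real ^ 'n \<Rightarrow> (real ^ 'n) \<Rightarrow>\<^sub>L (real ^ 'n ^ 'n)" where
  "confined' r x = g' x + (4 * max 0 (x \<bullet> x - r\<^sup>2)) *\<^sub>R (blinfun_scaleR_left (mat 1) o\<^sub>L blinfun_inner_right x)"

lemma confined_quadratic: "v \<bullet> (confined r x *v v) = v \<bullet> (g x *v v) + bump r x * (norm v)\<^sup>2"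
  by (simp add: confined_def matrix_vector_mult_add_rdistrib inner_add_right power2_norm_eq_inner
      flip: scaleR_matrix_vector_assoc)

lemma inside_iff: "r \<ge> 0 \<Longrightarrow> x \<bullet> x - r\<^sup>2 \<le> 0 \<longleftrightarrow> norm x \<le> r"
  by (simp add: power2_norm_eq_inner[symmetric] abs_le_square_iff[symmetric])

lemma confined_inside:
  assumes "norm x \<le> r"
  shows "confined r x = g x" "confined' r x = g' x"
proof -
  have "r \<ge> 0" using assms norm_ge_zero order_trans by blast
  then have "max 0 (x \<bullet> x - r\<^sup>2) = 0" using inside_iff[of r x] assms by simp
  then show "confined r x = g x" "confined' r x = g' x"
    by (simp_all add: confined_def confined'_def bump_def)
qed

lemma confined_SPD: "confined r x \<in> SPD"
proof -
  have "transpose (confined r x) = confined r x"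
    using SPD[of x] by (auto simp: SPD_def confined_def transpose_def mat_def vec_eq_iff)
  moreover have "v \<bullet> (confined r x *v v) > 0" if "v \<noteq> 0" for v
    unfolding confined_quadratic using SPD_pos[OF SPD that] by (simp add: bump_def add_pos_nonneg)
  ultimately show ?thesis by (simp add: SPD_def)
qed

text \<open>Up to radius \<open>\<rho>\<close> compactness gives a constant for \<open>g\<close>
  itself; beyond it \<open>bump\<close> is at least 1.\<close>

lemma confined_elliptic: obtains c where "elliptic_metric (confined r) (confined' r) c"
proof -
  define \<rho> where "\<rho> = sqrt (r\<^sup>2 + 1)"
  obtain c where c: "c > 0" "\<And>x v. x \<in> cball 0 \<rho> \<Longrightarrow> c * (norm v)\<^sup>2 \<le> v \<bullet> (g x *v v)"
    using SPD_uniform_lower[OF continuous_on_subset[OF cont subset_UNIV] SPD compact_cball] by metis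
  have deriv: "(confined r has_derivative blinfun_apply (confined' r x)) (at x)" for x
    unfolding confined_def[abs_def] confined'_def
    by (auto intro!: derivative_eq_intros deriv has_derivative_bump simp: blinfun.add_left blinfun.scaleR_left fun_eq_iff)
  have "elliptic_metric (confined r) (confined' r) (min c 1)"
  proof
    show "continuous_on UNIV (confined r)"
      using deriv by (intro continuous_at_imp_continuous_on ballI has_derivative_continuous) blast
    show "continuous_on UNIV (confined' r)"
      unfolding confined'_def
      by (intro continuous_intros cont_deriv bounded_bilinear.continuous_on[OF bounded_bilinear_blinfun_compose]
          bounded_linear.continuous_on[OF bounded_linear_blinfun_inner_right])
    show "min c 1 * (norm w)\<^sup>2 \<le> w \<bullet> (confined r x *v w)" for w x
    proof (cases "x \<bullet> x \<le> r\<^sup>2 + 1")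
      case True
      then have "norm x \<le> \<rho>" unfolding \<rho>_def by (intro real_le_rsqrt) (simp add: power2_norm_eq_inner)
      then have "c * (norm w)\<^sup>2 \<le> w \<bullet> (g x *v w)" by (intro c) simp
      moreover have "min c 1 * (norm w)\<^sup>2 \<le> c * (norm w)\<^sup>2" by (intro mult_right_mono) auto
      moreover have "bump r x * (norm w)\<^sup>2 \<ge> 0" by (simp add: bump_def)
      ultimately show ?thesis unfolding confined_quadratic by linarith
    next
      case False
      then have "1 ^ 2 \<le> (max 0 (x \<bullet> x - r\<^sup>2))\<^sup>2" by (intro power_mono) auto
      then have "1 \<le> bump r x" by (simp add: bump_def)
      then have "1 * (norm w)\<^sup>2 \<le> bump r x * (norm w)\<^sup>2" by (intro mult_right_mono) auto
      moreover have "min c 1 * (norm w)\<^sup>2 \<le> 1 * (norm w)\<^sup>2" by (intro mult_right_mono) auto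
      moreover have "w \<bullet> (g x *v w) \<ge> 0" by (rule SPD_nonneg[OF SPD])
      ultimately show ?thesis unfolding confined_quadratic by linarith
    qed
  qed (use c confined_SPD deriv in auto)
  then show ?thesis by (rule that)
qed

text \<open>Curves from \<open>x\<close> of \<open>g\<close>-length at most \<open>d + 1\<close>
  stay in the ball of radius \<open>r\<close>, so nearly minimal ones have the same length in both
  metrics, and the confined minimizer has confined length at most \<open>d + e\<close>. Its
  \<open>g\<close>-length is no larger, so it too stays in the ball, where both metrics have the
  same geodesic equations.\<close>

theorem exists_minimizing_geodesic:
  assumes proper: "length_proper g"
  shows "\<exists>a b \<gamma>. a < b \<and> geodesic_on g {a..b} \<gamma> \<and> \<gamma> a = x \<and> \<gamma> b = y \<and>
      finite_curve a b \<gamma> \<and> length_minimizing g a b \<gamma> \<and> riem_dist g x y = riem_length g a b \<gamma>"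
proof -
  define d where "d = riem_dist g x y"
  have d0: "d \<ge> 0" unfolding d_def by (rule riem_dist_nonneg)
  obtain r where r: "\<And>a b \<gamma>. C1_curve a b \<gamma> \<Longrightarrow> \<gamma> a = x \<Longrightarrow> riem_length g a b \<gamma> \<le> d + 1 \<Longrightarrow> norm (\<gamma> b) \<le> r"
    using proper unfolding length_proper_def by meson
  have x_r: "norm x \<le> r"
  proof -
    have "riem_length g 0 1 (\<lambda>t. x + t *\<^sub>R 0) = 0"
      unfolding riem_length_eq[OF has_velocity_segment] by simp
    then show ?thesis
      using r[of 0 1 "\<lambda>t. x + t *\<^sub>R 0"] has_velocity_segment[of 0 1 x 0] d0 by (auto simp: C1_curve_iff)
  qed
  have in_ball: "norm (\<sigma> t) \<le> r"
    if "has_velocity a b \<sigma> D" "\<sigma> a = x" "riem_length g a b \<sigma> \<le> d + 1" "t \<in> {a..b}" for a b \<sigma> D t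
  proof (cases "t = a")
    case False
    then have "C1_curve a t \<sigma>" using that has_velocity_subset[OF that(1), of a t] by (auto simp: C1_curve_iff)
    then show ?thesis
      using that riem_length_subset_le[OF that(1), of a t] by (intro r) auto
  qed (use that x_r in simp)
  obtain c where "elliptic_metric (confined r) (confined' r) c" by (rule confined_elliptic)
  then interpret G: elliptic_metric "confined r" "confined' r" c .
  obtain z where z: "integral_curve G.ham {0..1} z" "fst (z 0) = x" "fst (z 1) = y"
    and min: "\<And>a b \<sigma> D. has_velocity a b \<sigma> D \<Longrightarrow> a < b \<Longrightarrow> \<sigma> a = x \<Longrightarrow> \<sigma> b = y \<Longrightarrow>
      riem_length (confined r) 0 1 (\<lambda>t. fst (z t)) \<le> riem_length (confined r) a b \<sigma>"
    using G.exists_minimizing_ham_curve[of x y] by metis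
  let ?\<gamma> = "\<lambda>t. fst (z t)"
  obtain D where D: "has_velocity 0 1 ?\<gamma> D" using G.has_velocity_ham_curve[OF z(1)] by blast
  have same: "riem_length (confined r) a b \<sigma> = riem_length g a b \<sigma>"
    if "has_velocity a b \<sigma> D" "\<And>t. t \<in> {a..b} \<Longrightarrow> norm (\<sigma> t) \<le> r" for a b \<sigma> D
    unfolding riem_length_eq[OF that(1)] G.riem_length_eq[OF that(1)] speed_def G.speed_def
    using that(2) by (intro integral_cong) (simp add: confined_inside)
  have confined_le: "riem_length (confined r) 0 1 ?\<gamma> \<le> d + e" if e: "0 < e" "e \<le> 1" for e
  proof -
    obtain a b \<sigma> D where \<sigma>: "has_velocity a b \<sigma> D" "a < b" "\<sigma> a = x" "\<sigma> b = y" "riem_length g a b \<sigma> < d + e"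
      unfolding d_def by (rule riem_dist_approx[OF e(1)])
    have "riem_length (confined r) 0 1 ?\<gamma> \<le> riem_length (confined r) a b \<sigma>"
      using \<sigma> by (intro min)
    also have "\<dots> = riem_length g a b \<sigma>"
      using \<sigma> e by (intro same[OF \<sigma>(1)] in_ball[OF \<sigma>(1)]) auto
    finally show ?thesis using \<sigma>(5) by simp
  qed
  have g_le: "riem_length g 0 1 ?\<gamma> \<le> riem_length (confined r) 0 1 ?\<gamma>"
    unfolding riem_length_eq[OF D] G.riem_length_eq[OF D]
  proof (rule integral_le[OF speed_integrable[OF D] G.speed_integrable[OF D]])
    show "speed (?\<gamma> t) (D t) \<le> G.speed (?\<gamma> t) (D t)" for t
      unfolding speed_def G.speed_def confined_quadratic by (intro real_sqrt_le_mono) (simp add: bump_def)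
  qed auto
  have "riem_length g 0 1 ?\<gamma> \<le> d + 1" using g_le confined_le[of 1] by simp
  then have inside: "norm (?\<gamma> t) \<le> r" if "t \<in> {0..1}" for t
    using z(2) that by (intro in_ball[OF D]) auto
  have len: "riem_length g 0 1 ?\<gamma> \<le> d"
  proof (rule field_le_epsilon)
    fix e :: real assume "e > 0"
    then have "riem_length g 0 1 ?\<gamma> \<le> d + min e 1"
      using g_le confined_le[of "min e 1"] by simp
    then show "riem_length g 0 1 ?\<gamma> \<le> d + e" by linarith
  qed
  have "integral_curve ham {0..1} z"
    using z(1) inside unfolding integral_curve_def ham_def G.ham_def inv_metric_def G.inv_metric_def force_def G.force_def
    by (simp add: confined_inside)
  then have geo: "geodesic_on g {0..1} ?\<gamma>" by (rule geodesic_on_ham_curve)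
  have "length_minimizing g 0 1 ?\<gamma>"
    using len by (intro length_minimizing_if_minimal[OF D]) (auto simp: z d_def)
  moreover have "riem_dist g x y = riem_length g 0 1 ?\<gamma>"
    using riem_dist_le[OF D] len by (simp add: z d_def)
  moreover have "finite_curve 0 1 ?\<gamma>"
    unfolding finite_curve_def
  proof (rule integrable_eq)
    show "(\<lambda>t. norm (D t)) integrable_on {0..1}"
      using D by (intro integrable_continuous_real continuous_intros) (simp add: has_velocity_def)
    show "norm (D t) = norm (vector_derivative ?\<gamma> (at t within {0..1}))" if "t \<in> {0..1}" for t
      using D that vector_derivative_within_cbox[of 0 1 t ?\<gamma> "D t"] by (simp add: has_velocity_def)
  qed
  ultimately show ?thesis using geo z by (intro exI[of _ 0] exI[of _ 1] exI[of _ ?\<gamma>]) auto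
qed

end

subsection \<open>Crossing annuli\<close>

definition generators :: "(real ^ 'n) set \<Rightarrow> (real ^ 'n \<Rightarrow> real ^ 'n ^ 'n) set set" where
  "generators A = {{g \<in> Omega. g x \<in> S} | x S. x \<in> A \<and> S \<in> sets borel}"

lemma generatorsI: "x \<in> A \<Longrightarrow> S \<in> sets borel \<Longrightarrow> {g \<in> Omega. g x \<in> S} \<in> generators A"
  by (auto simp: generators_def)

lemma generators_Pow: "generators A \<subseteq> Pow Omega"
  by (auto simp: generators_def)

lemma field_events_eq: "field_events A = sigma_sets Omega (generators A)"
  by (simp add: field_events_def generators_def)

lemma sigma_algebra_field_events: "sigma_algebra Omega (field_events A)"
  unfolding field_events_eq by (rule sigma_algebra_sigma_sets[OF generators_Pow])

lemma field_events_mono: "A \<subseteq> B \<Longrightarrow> field_events A \<subseteq> field_events B"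
  unfolding field_events_eq by (intro sigma_sets_subseteq) (auto simp: generators_def)

lemma field_events_Pow: "field_events A \<subseteq> Pow Omega"
  using sigma_sets_into_sp[OF generators_Pow] unfolding field_events_eq by blast

lemma space_Omega_space: "space Omega_space = Omega"
  by (simp add: Omega_space_def space_measure_of_conv)

lemma sets_Omega_space: "sets Omega_space = field_events UNIV"
  unfolding Omega_space_def sets_measure_of[OF field_events_Pow]
  unfolding field_events_eq by (rule sigma_sets_sigma_sets_eq[OF generators_Pow])

lemma shift_in_Omega: "g \<in> Omega \<Longrightarrow> (\<lambda>x. g (x + z)) \<in> Omega"
  unfolding Omega_def by (auto intro!: continuous_on_compose2[of UNIV g] continuous_intros)

lemma measurable_shift: "(\<lambda>g x. g (x + z)) \<in> measurable Omega_space Omega_space"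
proof (rule measurable_sigma_sets)
  show "sets Omega_space = sigma_sets Omega (generators UNIV)" by (simp add: sets_Omega_space field_events_eq)
  show "(\<lambda>g x. g (x + z)) \<in> space Omega_space \<rightarrow> Omega" by (simp add: space_Omega_space shift_in_Omega)
  fix y :: "(real ^ 'a \<Rightarrow> real ^ 'a ^ 'a) set" assume "y \<in> generators UNIV"
  then obtain x S where y: "y = {g \<in> Omega. g x \<in> S}" "S \<in> sets borel" by (auto simp: generators_def)
  have "(\<lambda>g x. g (x + z)) -` y \<inter> space Omega_space = {g \<in> Omega. g (x + z) \<in> S}"
    by (auto simp: y space_Omega_space shift_in_Omega)
  also have "\<dots> \<in> sets Omega_space"
    unfolding sets_Omega_space field_events_eq using y by (intro sigma_sets.Basic) (auto simp: generators_def)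
  finally show "(\<lambda>g x. g (x + z)) -` y \<inter> space Omega_space \<in> sets Omega_space" .
qed (rule generators_Pow)

definition thin :: "real \<Rightarrow> real \<Rightarrow> real ^ 'n \<Rightarrow> (real ^ 'n \<Rightarrow> real ^ 'n ^ 'n) set" where
  "thin \<epsilon> \<rho> x = {g \<in> Omega. \<exists>q\<in>ball x \<rho>. \<exists>v. v \<bullet> (g q *v v) < \<epsilon> * (norm v)\<^sup>2}"

text \<open>The ball is open, the inequality strict and \<open>g\<close> continuous, so the
  witnesses \<open>q\<close> and \<open>v\<close> can be taken from a countable dense set.\<close>

lemma thin_in_field_events:
  fixes x :: "real ^ 'n"
  shows "thin \<epsilon> \<rho> x \<in> field_events (ball x \<rho>)"
proof -
  obtain D :: "(real ^ 'n) set" where D: "countable D" "\<And>X. open X \<Longrightarrow> X \<noteq> {} \<Longrightarrow> \<exists>d\<in>D. d \<in> X"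
    using countable_dense_exists by blast
  interpret sigma_algebra Omega "field_events (ball x \<rho>)" by (rule sigma_algebra_field_events)
  have "thin \<epsilon> \<rho> x = (\<Union>q\<in>D \<inter> ball x \<rho>. \<Union>v\<in>D. {g \<in> Omega. g q \<in> {A. v \<bullet> (A *v v) < \<epsilon> * (norm v)\<^sup>2}})" (is "_ = ?U")
  proof
    show "thin \<epsilon> \<rho> x \<subseteq> ?U"
    proof
      fix g assume "g \<in> thin \<epsilon> \<rho> x"
      then obtain q v where g: "g \<in> Omega" and q: "q \<in> ball x \<rho>" "v \<bullet> (g q *v v) < \<epsilon> * (norm v)\<^sup>2"
        by (auto simp: thin_def)
      have cont: "continuous_on UNIV g" using g by (simp add: Omega_def)
      have "open (ball x \<rho> \<inter> {q. v \<bullet> (g q *v v) < \<epsilon> * (norm v)\<^sup>2})"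
        by (intro open_Int open_ball open_Collect_less continuous_intros cont)
      then obtain q' where q': "q' \<in> D" "q' \<in> ball x \<rho>" "v \<bullet> (g q' *v v) < \<epsilon> * (norm v)\<^sup>2"
        using D(2)[of "ball x \<rho> \<inter> {q. v \<bullet> (g q *v v) < \<epsilon> * (norm v)\<^sup>2}"] q by blast
      have "open {v. v \<bullet> (g q' *v v) < \<epsilon> * (norm v)\<^sup>2}"
        by (intro open_Collect_less continuous_intros)
      then obtain v' where "v' \<in> D" "v' \<bullet> (g q' *v v') < \<epsilon> * (norm v')\<^sup>2"
        using D(2)[of "{v. v \<bullet> (g q' *v v) < \<epsilon> * (norm v)\<^sup>2}"] q' by blast
      then show "g \<in> ?U" using q' g by blast
    qed
    show "?U \<subseteq> thin \<epsilon> \<rho> x" by (auto simp: thin_def)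
  qed
  also have "\<dots> \<in> field_events (ball x \<rho>)"
  proof (intro countable_UN'' ballI)
    fix q v assume qv: "q \<in> D \<inter> ball x \<rho>" "v \<in> D"
    have "open {A :: real ^ 'n ^ 'n. v \<bullet> (A *v v) < \<epsilon> * (norm v)\<^sup>2}"
      by (intro open_Collect_less continuous_intros)
    then show "{g \<in> Omega. g q \<in> {A. v \<bullet> (A *v v) < \<epsilon> * (norm v)\<^sup>2}} \<in> field_events (ball x \<rho>)"
      unfolding field_events_eq using qv by (intro sigma_sets.Basic generatorsI borel_open) auto
  qed (use D in auto)
  finally show ?thesis .
qed

lemma thin_sets: "thin \<epsilon> \<rho> x \<in> sets Omega_space"
  unfolding sets_Omega_space by (rule subsetD[OF field_events_mono[OF subset_UNIV] thin_in_field_events])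

section \<open>Renormalization of annulus crossings\<close>

context
  fixes F :: "(real ^ 'n) set" and \<epsilon> R :: real
begin

text \<open>Origin of 12, in units of the smaller scale: far centres are 7 apart and each
  approximates a point of the curve up to 1, so these points must be 9 apart. The second crossing
  starts at 3 before the outer radius, so that 2 remain after an error of 1. A start radius
  \<open>s\<close> with outer radius \<open>2 s\<close> thus needs
  \<open>2 s - 3 - s \<ge> 9\<close>.\<close>

definition scale :: "nat \<Rightarrow> real" where "scale k = 12 ^ k * R"

definition far_pairs :: "((real ^ 'n) \<times> (real ^ 'n)) set" where
  "far_pairs = {(a, b) \<in> F \<times> F. norm (a - b) \<ge> 7}"

text \<open>Off the event \<open>blocked k x\<close>, crossing from distance \<open>scale k\<close> to distance \<open>2 * scale k\<close>
  of \<open>x\<close> has length at least \<open>sqrt \<epsilon> * R\<close>. The event depends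
  on \<open>g\<close> only in \<open>ball x (3 * scale k)\<close>, and centres \<open>7 * scale k\<close> apart leave a gap of
  \<open>scale k \<ge> R\<close> between two such balls.\<close>

primrec blocked :: "nat \<Rightarrow> real ^ 'n \<Rightarrow> (real ^ 'n \<Rightarrow> real ^ 'n ^ 'n) set" where
  "blocked 0 x = thin \<epsilon> (3 * R) x"
| "blocked (Suc k) x = (\<Union>(a, b)\<in>far_pairs. blocked k (x + scale k *\<^sub>R a) \<inter> blocked k (x + scale k *\<^sub>R b))"

context
  assumes F: "finite F" "F \<subseteq> cball 0 25" and R: "R > 0"
begin

lemma scale_pos: "scale k > 0" by (simp add: scale_def R)

lemma scale_Suc: "scale (Suc k) = 12 * scale k" by (simp add: scale_def)

lemma scale_ge: "scale k \<ge> R"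
  using R by (simp add: scale_def)

lemma finite_far_pairs: "finite far_pairs"
  unfolding far_pairs_def by (rule finite_subset[of _ "F \<times> F"]) (use F in auto)

lemma blocked_in_field_events: "blocked k x \<in> field_events (ball x (3 * scale k))"
proof (induction k arbitrary: x)
  case 0
  then show ?case by (simp add: scale_def thin_in_field_events)
next
  case (Suc k)
  interpret sigma_algebra Omega "field_events (ball x (3 * scale (Suc k)))" by (rule sigma_algebra_field_events)
  have "blocked k (x + scale k *\<^sub>R a) \<in> field_events (ball x (3 * scale (Suc k)))" if "a \<in> F" for a
  proof -
    have a: "norm a \<le> 25" using F that by auto
    have "ball (x + scale k *\<^sub>R a) (3 * scale k) \<subseteq> ball x (3 * scale (Suc k))"
    proof
      fix y assume "y \<in> ball (x + scale k *\<^sub>R a) (3 * scale k)"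
      then have "dist (x + scale k *\<^sub>R a) y < 3 * scale k" by simp
      moreover have "dist x (x + scale k *\<^sub>R a) \<le> scale k * 25"
        using a scale_pos[of k] by (simp add: dist_norm)
      \<comment> \<open>28 = 25 + 3, within the 36 = 3 * 12 available at the next scale.\<close>
      ultimately have "dist x y < 28 * scale k" using dist_triangle[of x y "x + scale k *\<^sub>R a"] by linarith
      then show "y \<in> ball x (3 * scale (Suc k))" using scale_pos[of k] by (simp add: scale_Suc)
    qed
    then show ?thesis using Suc field_events_mono by blast
  qed
  then show ?case
    unfolding blocked.simps by (intro finite_UN finite_far_pairs) (auto simp: far_pairs_def)
qed

lemma blocked_sets: "blocked k x \<in> sets Omega_space"
  using blocked_in_field_events field_events_mono[OF subset_UNIV] by (auto simp: sets_Omega_space)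

text \<open>Multiplying the recursion by \<open>C\<close> turns it into squaring:
  \<open>q (Suc k) \<le> (q k)^2\<close> for \<open>q k = C * p k\<close>, starting from 1/2. The
  weaker geometric bound kept here is preserved by squaring because
  \<open>2 * Suc k \<ge> Suc (Suc k)\<close>, and it is summable.\<close>

lemma prob_blocked_le:
  fixes P :: "(real ^ 'n \<Rightarrow> real ^ 'n ^ 'n) measure" and C :: real
  assumes P: "prob_space P" "sets P = sets Omega_space"
    and indep: "\<And>A B. (\<forall>x\<in>A. \<forall>y\<in>B. norm (x - y) \<ge> R) \<Longrightarrow> prob_space.indep_set P (field_events A) (field_events B)"
    and C: "card far_pairs \<le> C" "C > 0"
    and base: "\<And>x. measure P (thin \<epsilon> (3 * R) x) \<le> 1 / (2 * C)"
  shows "C * measure P (blocked k x) \<le> (1 / 2) ^ Suc k"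
proof (induction k arbitrary: x)
  case 0
  then show ?case using base[of x] C(2) by (simp add: field_simps)
next
  case (Suc k)
  interpret prob_space P by (rule P)
  have sets: "blocked k y \<in> sets P" for y using blocked_sets P by simp
  have pair: "C\<^sup>2 * prob (blocked k (x + scale k *\<^sub>R a) \<inter> blocked k (x + scale k *\<^sub>R b)) \<le> (1 / 2) ^ (2 * Suc k)"
    if "(a, b) \<in> far_pairs" for a b
  proof -
    let ?y = "x + scale k *\<^sub>R a" and ?z = "x + scale k *\<^sub>R b"
    have ab: "norm (a - b) \<ge> 7" using that by (simp add: far_pairs_def)
    have "?y - ?z = scale k *\<^sub>R (a - b)" by (simp add: scaleR_diff_right)
    then have "norm (?y - ?z) = scale k * norm (a - b)" using scale_pos[of k] by simp
    then have yz: "norm (?y - ?z) \<ge> scale k * 7" using ab scale_pos[of k] by simp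
    have "norm (u - w) \<ge> R" if "u \<in> ball ?y (3 * scale k)" "w \<in> ball ?z (3 * scale k)" for u w
    proof -
      have "dist ?y ?z \<le> dist ?y u + dist u w + dist w ?z"
        using dist_triangle[of ?y ?z u] dist_triangle[of u ?z w] by linarith
      then show ?thesis using that yz scale_ge[of k] by (simp add: dist_norm norm_minus_commute)
    qed
    then have "indep_set (field_events (ball ?y (3 * scale k))) (field_events (ball ?z (3 * scale k)))"
      by (intro indep) blast
    from indep_setD[OF this blocked_in_field_events blocked_in_field_events]
    have "C\<^sup>2 * prob (blocked k ?y \<inter> blocked k ?z) = (C * prob (blocked k ?y)) * (C * prob (blocked k ?z))"
      by (simp add: power2_eq_square)
    also have "\<dots> \<le> (1 / 2) ^ Suc k * (1 / 2) ^ Suc k"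
      using C by (intro mult_mono Suc) auto
    finally show ?thesis by (simp add: power_add[symmetric] mult_2)
  qed
  have "prob (blocked (Suc k) x) \<le> (\<Sum>(a, b)\<in>far_pairs. prob (blocked k (x + scale k *\<^sub>R a) \<inter> blocked k (x + scale k *\<^sub>R b)))"
    unfolding blocked.simps case_prod_unfold
    using sets by (intro finite_measure_subadditive_finite finite_far_pairs) auto
  then have "C\<^sup>2 * prob (blocked (Suc k) x) \<le> C\<^sup>2 * (\<Sum>(a, b)\<in>far_pairs. prob (blocked k (x + scale k *\<^sub>R a) \<inter> blocked k (x + scale k *\<^sub>R b)))"
    by (intro mult_left_mono) auto
  also have "\<dots> \<le> (\<Sum>ab\<in>far_pairs. (1 / 2) ^ (2 * Suc k))"
    unfolding sum_distrib_left using pair by (intro sum_mono) auto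
  also have "\<dots> = real (card far_pairs) * (1 / 2) ^ (2 * Suc k)" by simp
  also have "\<dots> \<le> C * (1 / 2) ^ (2 * Suc k)" using C by (intro mult_right_mono) auto
  also have "\<dots> \<le> C * (1 / 2) ^ Suc (Suc k)" using C by (intro mult_left_mono power_decreasing) auto
  finally have "C * (C * prob (blocked (Suc k) x)) \<le> C * (1 / 2) ^ Suc (Suc k)"
    by (simp add: power2_eq_square mult.assoc)
  then show ?case using C(2) by (rule mult_left_le_imp_le)
qed

text \<open>A crossing contains crossings of smaller annuli around both centres of a far pair, at
  least one of which is not blocked. Only that one is counted, so the constant is inherited
  unchanged by all scales.\<close>

lemma crossing_length:
  assumes g: "g \<in> Omega" "g \<notin> blocked k x" and \<epsilon>: "\<epsilon> > 0"
    and net: "cball 0 24 \<subseteq> (\<Union>a\<in>F. ball a 1)"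
    and v: "has_velocity a b \<gamma> D" "a \<le> b"
    and ends: "norm (\<gamma> a - x) \<le> scale k" "norm (\<gamma> b - x) \<ge> 2 * scale k"
  shows "sqrt \<epsilon> * R \<le> riem_length g a b \<gamma>"
  using g(2) v ends
proof (induction k arbitrary: x a b)
  case (0 x a b)
  interpret riemannian g using g(1) by unfold_locales (auto simp: Omega_def)
  have cont: "continuous_on {a..b} (\<lambda>t. norm (\<gamma> t - x))"
    by (intro continuous_intros has_velocity_continuous[OF 0(2)])
  have ends0: "norm (\<gamma> a - x) \<le> R" "2 * R \<le> norm (\<gamma> b - x)" using 0 by (auto simp: scale_def)
  \<comment> \<open>Until the first time at distance \<open>2 * R\<close> the curve stays in
    \<open>ball x (3 * R)\<close>, where \<open>g\<close> is elliptic with constant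
    \<open>\<epsilon>\<close>.\<close>
  obtain t where t: "t \<in> {a..b}" "norm (\<gamma> t - x) = 2 * R" "\<And>s. s \<in> {a..t} \<Longrightarrow> norm (\<gamma> s - x) \<le> 2 * R"
    using continuous_first_hit[OF cont 0(3), of "2 * R"] ends0 R by auto
  have low: "\<epsilon> * (norm w)\<^sup>2 \<le> w \<bullet> (g (\<gamma> s) *v w)" if "s \<in> {a..t}" for s w
  proof -
    have "\<gamma> s \<in> ball x (3 * R)" using t(3)[OF that] R by (simp add: dist_norm norm_minus_commute)
    then show ?thesis using 0(1) g(1) by (force simp: thin_def not_less[symmetric])
  qed
  have "R \<le> norm (\<gamma> t - \<gamma> a)"
    using norm_triangle_ineq[of "\<gamma> t - \<gamma> a" "\<gamma> a - x"] t(2) ends0 by simp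
  then have "sqrt \<epsilon> * R \<le> sqrt \<epsilon> * norm (\<gamma> t - \<gamma> a)" using \<epsilon> by (intro mult_left_mono) auto
  also have "\<dots> \<le> riem_length g a t \<gamma>"
    using t by (intro norm_displacement_le_length[OF has_velocity_subset[OF 0(2)] _ \<epsilon> low]) auto
  also have "\<dots> \<le> riem_length g a b \<gamma>"
    using t by (intro riem_length_subset_le[OF 0(2)]) auto
  finally show ?case .
next
  case (Suc k x a b)
  interpret riemannian g using g(1) by unfold_locales (auto simp: Omega_def)
  let ?L = "scale k"
  have L: "?L > 0" by (rule scale_pos)
  have cont: "continuous_on {a..b} (\<lambda>t. norm (\<gamma> t - x))"
    by (intro continuous_intros has_velocity_continuous[OF Suc(3)])
  have ends1: "norm (\<gamma> a - x) \<le> 12 * ?L" "24 * ?L \<le> norm (\<gamma> b - x)" using Suc by (auto simp: scale_Suc)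
  \<comment> \<open>Radius 21 is 9 beyond the start, which leaves the centres 7 apart, and 3 before
    the end, which leaves 2 for the second crossing.\<close>
  obtain t where t: "a \<le> t" "t \<le> b" "norm (\<gamma> t - x) = 21 * ?L"
    using IVT'[OF _ _ Suc(4) cont, of "21 * ?L"] ends1 L by auto
  have near: "\<exists>e\<in>F. norm (u - (x + ?L *\<^sub>R e)) \<le> ?L" if "norm (u - x) \<le> 24 * ?L" for u
  proof -
    have "norm ((u - x) /\<^sub>R ?L) \<le> 24" unfolding norm_scaleR using that L by (simp add: field_simps)
    then obtain e where e: "e \<in> F" "norm (e - (u - x) /\<^sub>R ?L) < 1"
      using net by (force simp: dist_norm)
    have "u - (x + ?L *\<^sub>R e) = - (?L *\<^sub>R (e - (u - x) /\<^sub>R ?L))" using L by (simp add: scaleR_diff_right)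
    then have "norm (u - (x + ?L *\<^sub>R e)) = ?L * norm (e - (u - x) /\<^sub>R ?L)" using L by simp
    also have "\<dots> \<le> ?L" using e L by (simp add: mult_left_le)
    finally show ?thesis using e by blast
  qed
  obtain e where e: "e \<in> F" "norm (\<gamma> a - (x + ?L *\<^sub>R e)) \<le> ?L" using near[of "\<gamma> a"] ends1 L by auto
  obtain e' where e': "e' \<in> F" "norm (\<gamma> t - (x + ?L *\<^sub>R e')) \<le> ?L" using near[of "\<gamma> t"] t L by auto
  let ?y = "x + ?L *\<^sub>R e" and ?z = "x + ?L *\<^sub>R e'"
  have ta: "norm (\<gamma> t - \<gamma> a) \<ge> 9 * ?L"
    using norm_triangle_ineq[of "\<gamma> t - \<gamma> a" "\<gamma> a - x"] t ends1 by simp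
  have "norm (\<gamma> t - \<gamma> a) \<le> norm (\<gamma> t - ?z) + norm (?z - ?y) + norm (\<gamma> a - ?y)"
    using dist_triangle[of "\<gamma> t" "\<gamma> a" ?z] dist_triangle[of ?z "\<gamma> a" ?y] by (simp add: dist_norm norm_minus_commute)
  then have "7 * ?L \<le> norm (?z - ?y)" using ta e e' by simp
  also have "?z - ?y = ?L *\<^sub>R (e' - e)" by (simp add: scaleR_diff_right)
  finally have "7 \<le> norm (e - e')" using L by (simp add: norm_minus_commute)
  then have "(e, e') \<in> far_pairs" using e e' by (simp add: far_pairs_def)
  then consider "g \<notin> blocked k ?y" | "g \<notin> blocked k ?z" using Suc(2) by auto
  then show ?case
  proof cases
    case 1
    have "norm (\<gamma> t - \<gamma> a) \<le> norm (\<gamma> t - ?y) + norm (\<gamma> a - ?y)"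
      using dist_triangle[of "\<gamma> t" "\<gamma> a" ?y] by (simp add: dist_norm norm_minus_commute)
    then have "norm (\<gamma> t - ?y) \<ge> 2 * ?L" using ta e L by simp
    then have "sqrt \<epsilon> * R \<le> riem_length g a t \<gamma>"
      using 1 e t by (intro Suc(1)[of ?y] has_velocity_subset[OF Suc(3)]) auto
    also have "\<dots> \<le> riem_length g a b \<gamma>" using t by (intro riem_length_subset_le[OF Suc(3)]) auto
    finally show ?thesis .
  next
    case 2
    have "norm (\<gamma> b - x) \<le> norm (\<gamma> b - ?z) + norm (\<gamma> t - ?z) + norm (\<gamma> t - x)"
      using dist_triangle[of "\<gamma> b" x ?z] dist_triangle[of ?z x "\<gamma> t"] by (simp add: dist_norm norm_minus_commute)
    then have "norm (\<gamma> b - ?z) \<ge> 2 * ?L" using t ends1 e' by simp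
    then have "sqrt \<epsilon> * R \<le> riem_length g t b \<gamma>"
      using 2 e' t by (intro Suc(1)[of ?z] has_velocity_subset[OF Suc(3)]) auto
    also have "\<dots> \<le> riem_length g a b \<gamma>" using t by (intro riem_length_subset_le[OF Suc(3)]) auto
    finally show ?thesis .
  qed
qed

text \<open>Concentric annuli between consecutive scales are crossed one after the other, so their
  costs add up: beyond the last blocked scale, \<open>j\<close> annuli cost
  \<open>j * \<delta>\<close>, and a curve of length \<open>M\<close> passes at most about
  \<open>M / \<delta>\<close> of them.\<close>

lemma length_proper_if_not_blocked:
  assumes g: "g \<in> Omega" and \<epsilon>: "\<epsilon> > 0" and net: "cball 0 24 \<subseteq> (\<Union>a\<in>F. ball a 1)"
    and ev: "\<forall>\<^sub>F k in sequentially. g \<notin> blocked k 0"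
  shows "length_proper g"
  unfolding length_proper_def
proof (intro allI)
  interpret riemannian g using g by unfold_locales (auto simp: Omega_def)
  fix x :: "real ^ 'n" and M :: real
  define \<delta> where "\<delta> = sqrt \<epsilon> * R"
  have \<delta>: "\<delta> > 0" using \<epsilon> R by (simp add: \<delta>_def)
  have mono: "scale j \<le> scale k" if "j \<le> k" for j k
    using R that by (simp add: scale_def)
  obtain K1 where K1: "\<And>k. k \<ge> K1 \<Longrightarrow> g \<notin> blocked k 0"
    using ev unfolding eventually_sequentially by auto
  obtain K2 where "norm x / R < 12 ^ K2" using real_arch_pow[of 12] by auto
  then have "norm x \<le> scale K2" using R by (simp add: scale_def field_simps)
  then obtain K where K: "\<And>k. k \<ge> K \<Longrightarrow> g \<notin> blocked k 0" "norm x \<le> scale K"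
    using K1 mono[of K2 "max K1 K2"] that[of "max K1 K2"] by auto
  have many: "j * \<delta> \<le> riem_length g a b \<gamma>"
    if "has_velocity a b \<gamma> D" "a \<le> b" "norm (\<gamma> a) \<le> scale K" "norm (\<gamma> b) \<ge> scale (K + j)" for j a b \<gamma> D
    using that
  proof (induction j arbitrary: b)
    case 0
    then show ?case by (simp add: riem_length_nonneg)
  next
    case (Suc j)
    have cont: "continuous_on {a..b} (\<lambda>t. norm (\<gamma> t))"
      by (intro continuous_intros has_velocity_continuous[OF Suc(2)])
    have "norm (\<gamma> a) \<le> scale (K + j)" "scale (K + j) \<le> norm (\<gamma> b)"
      using Suc(4,5) mono[of K "K + j"] mono[of "K + j" "K + Suc j"] by linarith+
    then obtain t where t: "a \<le> t" "t \<le> b" "norm (\<gamma> t) = scale (K + j)"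
      using IVT'[OF _ _ Suc(3) cont] by blast
    have "j * \<delta> \<le> riem_length g a t \<gamma>"
      using t Suc(4) by (intro Suc(1) has_velocity_subset[OF Suc(2)]) auto
    moreover have "\<delta> \<le> riem_length g t b \<gamma>"
      unfolding \<delta>_def
    proof (rule crossing_length[OF g K(1)[of "K + j"] \<epsilon> net has_velocity_subset[OF Suc(2)]])
      show "2 * scale (K + j) \<le> norm (\<gamma> b - 0)"
        using Suc(5) scale_pos[of "K + j"] by (simp add: scale_Suc)
    qed (use t in auto)
    ultimately show ?case using riem_length_combine[OF Suc(2) t(1,2)] by (simp add: distrib_right)
  qed
  obtain j :: nat where j: "M < j * \<delta>" using reals_Archimedean3[OF \<delta>] by blast
  have "norm (\<gamma> b) \<le> scale (K + j)"
    if \<gamma>: "C1_curve a b \<gamma>" "\<gamma> a = x" "riem_length g a b \<gamma> \<le> M" for a b \<gamma>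
  proof (rule ccontr)
    assume "\<not> norm (\<gamma> b) \<le> scale (K + j)"
    moreover obtain D where "has_velocity a b \<gamma> D" "a < b" using \<gamma>(1) by (auto simp: C1_curve_iff)
    ultimately have "j * \<delta> \<le> riem_length g a b \<gamma>" using \<gamma>(2) K(2) by (intro many) auto
    then show False using \<gamma>(3) j by simp
  qed
  then show "\<exists>r. \<forall>a b \<gamma>. C1_curve a b \<gamma> \<longrightarrow> \<gamma> a = x \<longrightarrow> riem_length g a b \<gamma> \<le> M \<longrightarrow> norm (\<gamma> b) \<le> r"
    by blast
qed

end

end

section \<open>Probability of thin balls and Borel-Cantelli\<close>

lemma measure_thin_translate:
  assumes P: "sets P = sets Omega_space" and stat: "translation_invariant P"
  shows "measure P (thin \<epsilon> \<rho> x) = measure P (thin \<epsilon> \<rho> 0)"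
proof -
  have space: "space P = Omega" using sets_eq_imp_space_eq[OF P] by (simp add: space_Omega_space)
  have "thin \<epsilon> \<rho> 0 \<in> sets Omega_space" by (rule thin_sets)
  moreover have "(\<lambda>g y. g (y + x)) \<in> measurable P Omega_space"
    using measurable_shift measurable_cong_sets[OF P refl] by blast
  ultimately have "measure (distr P Omega_space (\<lambda>g y. g (y + x))) (thin \<epsilon> \<rho> 0) =
      measure P ((\<lambda>g y. g (y + x)) -` thin \<epsilon> \<rho> 0 \<inter> space P)"
    by (intro measure_distr)
  moreover have "distr P Omega_space (\<lambda>g y. g (y + x)) = P"
    using stat by (simp add: translation_invariant_def)
  moreover have "(\<lambda>g y. g (y + x)) -` thin \<epsilon> \<rho> 0 \<inter> space P = thin \<epsilon> \<rho> x"
  proof -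
    have "(\<exists>q\<in>ball 0 \<rho>. \<exists>v. v \<bullet> (g (q + x) *v v) < \<epsilon> * (norm v)\<^sup>2) \<longleftrightarrow>
        (\<exists>q\<in>ball x \<rho>. \<exists>v. v \<bullet> (g q *v v) < \<epsilon> * (norm v)\<^sup>2)" for g :: "real ^ 'a \<Rightarrow> real ^ 'a ^ 'a"
    proof -
      have "ball x \<rho> = (\<lambda>q. q + x) ` ball 0 \<rho>"
        using ball_translation[of x 0 \<rho>] by (simp add: add.commute)
      then show ?thesis by auto
    qed
    then show ?thesis by (auto simp: thin_def space shift_in_Omega)
  qed
  ultimately show ?thesis by simp
qed

text \<open>Continuity of the measure from above: the events shrink with \<open>\<epsilon>\<close>,
  and their intersection is empty because each continuous positive definite metric is elliptic on
  the closed ball.\<close>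

lemma measure_thin_small:
  assumes P: "prob_space P" "sets P = sets Omega_space" and \<eta>: "\<eta> > 0"
  obtains \<epsilon> where "\<epsilon> > 0" "measure P (thin \<epsilon> \<rho> (0 :: real ^ 'n)) < \<eta>"
proof -
  interpret prob_space P by (rule P)
  define A where "A n = thin (1 / real (Suc n)) \<rho> (0 :: real ^ 'n)" for n
  have "range A \<subseteq> sets P"
    by (auto simp: A_def P thin_sets)
  moreover have "decseq A"
  proof (rule decseq_SucI, rule subsetI)
    fix n g assume "g \<in> A (Suc n)"
    then obtain q v where gqv: "g \<in> Omega" "q \<in> ball 0 \<rho>" "v \<bullet> (g q *v v) < 1 / real (Suc (Suc n)) * (norm v)\<^sup>2"
      by (auto simp: A_def thin_def)
    have "1 / real (Suc (Suc n)) * (norm v)\<^sup>2 \<le> 1 / real (Suc n) * (norm v)\<^sup>2"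
      by (intro mult_right_mono divide_left_mono) auto
    then have "v \<bullet> (g q *v v) < 1 / real (Suc n) * (norm v)\<^sup>2" using gqv(3) by linarith
    then show "g \<in> A n" unfolding A_def thin_def using gqv(1,2) by blast
  qed
  ultimately have "(\<lambda>n. prob (A n)) \<longlonglongrightarrow> prob (\<Inter>n. A n)" by (rule finite_Lim_measure_decseq)
  moreover have "(\<Inter>n. A n) = {}"
  proof (rule equals0I)
    fix g assume g: "g \<in> (\<Inter>n. A n)"
    then have "g \<in> Omega" by (auto simp: A_def thin_def)
    then have "continuous_on UNIV g" "\<And>x. g x \<in> SPD" by (auto simp: Omega_def)
    then obtain c where c: "c > 0" "\<And>x v. x \<in> cball 0 \<rho> \<Longrightarrow> c * (norm v)\<^sup>2 \<le> v \<bullet> (g x *v v)"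
      using SPD_uniform_lower[of "cball 0 \<rho>" g] continuous_on_subset by (metis compact_cball subset_UNIV)
    obtain n where n: "1 / real (Suc n) < c" using c(1) reals_Archimedean by (auto simp: inverse_eq_divide)
    have "g \<in> A n" using g by blast
    then obtain q v where q: "q \<in> ball 0 \<rho>" "v \<bullet> (g q *v v) < 1 / real (Suc n) * (norm v)\<^sup>2"
      unfolding A_def thin_def by blast
    have "c * (norm v)\<^sup>2 \<le> v \<bullet> (g q *v v)" using q by (intro c) auto
    moreover have "1 / real (Suc n) * (norm v)\<^sup>2 \<le> c * (norm v)\<^sup>2" using n by (intro mult_right_mono) auto
    ultimately show False using q by linarith
  qed
  ultimately have "(\<lambda>n. prob (A n)) \<longlonglongrightarrow> 0" by simp
  then have "\<forall>\<^sub>F n in sequentially. prob (A n) < \<eta>" using \<eta> by (rule order_tendstoD)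
  then obtain n where "prob (A n) < \<eta>" by (auto simp: eventually_sequentially)
  then show ?thesis using that[of "1 / real (Suc n)"] by (simp add: A_def)
qed

theorem AE_length_proper:
  fixes P :: "(real ^ 'n \<Rightarrow> real ^ 'n ^ 'n) measure"
  assumes P: "prob_space P" "sets P = sets Omega_space"
    and stat: "translation_invariant P" and fr: "finite_range_dependence P"
  shows "AE g in P. g \<in> Omega \<and> length_proper g"
proof -
  interpret prob_space P by (rule P)
  have space: "space P = Omega" using sets_eq_imp_space_eq[OF P(2)] by (simp add: space_Omega_space)
  obtain R where R: "R > 0"
    "\<And>A B. (\<forall>x\<in>A. \<forall>y\<in>B. norm (x - y) \<ge> R) \<Longrightarrow> indep_set (field_events A) (field_events B)"
    using fr unfolding finite_range_dependence_def by blast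
  obtain F0 :: "(real ^ 'n) set" where F0: "finite F0" "cball 0 24 \<subseteq> (\<Union>a\<in>F0. ball a 1)"
    using compact_cball[of "0 :: real ^ 'n" 24] unfolding compact_eq_totally_bounded by (meson zero_less_one)
  \<comment> \<open>A centre within 1 of a point of \<open>cball 0 24\<close> has norm below 25, so
    the net property survives.\<close>
  define F where "F = F0 \<inter> cball 0 25"
  have F: "finite F" "F \<subseteq> cball 0 25" using F0 by (auto simp: F_def)
  have net: "cball 0 24 \<subseteq> (\<Union>a\<in>F. ball a 1)"
  proof
    fix u :: "real ^ 'n" assume u: "u \<in> cball 0 24"
    then obtain a where a: "a \<in> F0" "dist a u < 1" using F0 by auto
    have "norm a \<le> 25" using u a norm_triangle_sub[of a u] by (simp add: dist_norm)
    then show "u \<in> (\<Union>a\<in>F. ball a 1)" using a by (auto simp: F_def)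
  qed
  \<comment> \<open>\<open>\<epsilon>\<close> enters \<open>blocked\<close> only in its base case,
    so the net and \<open>C\<close> can be fixed first and \<open>\<epsilon>\<close> chosen
    afterwards; the added 1 makes \<open>C\<close> positive.\<close>
  define C where "C = real (card (far_pairs F)) + 1"
  have C: "C > 0" "card (far_pairs F) \<le> C" by (auto simp: C_def)
  obtain \<epsilon> where \<epsilon>: "\<epsilon> > 0" "prob (thin \<epsilon> (3 * R) 0) < 1 / (2 * C)"
    using measure_thin_small[OF P, of "1 / (2 * C)"] C by auto
  let ?A = "\<lambda>k. blocked F \<epsilon> R k 0"
  have base: "prob (thin \<epsilon> (3 * R) x) \<le> 1 / (2 * C)" for x
    using measure_thin_translate[OF P(2) stat, of \<epsilon> "3 * R" x] \<epsilon>(2) by simp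
  have small: "C * prob (?A k) \<le> (1 / 2) ^ Suc k" for k
    by (rule prob_blocked_le[OF F R(1) P R(2) C(2,1) base])
  have "prob (?A k) \<le> (1 / 2) ^ k / (2 * C)" for k
    using small[of k] C by (simp add: field_simps)
  then have "summable (\<lambda>k. prob (?A k))"
    by (intro summable_comparison_test[OF _ summable_divide[OF summable_geometric]]) auto
  then have "AE g in P. \<forall>\<^sub>F k in sequentially. g \<in> space P - ?A k"
    using blocked_sets[OF F R(1)] P(2) by (intro borel_cantelli_AE1) (auto simp: emeasure_eq_measure)
  then show ?thesis
  proof eventually_elim
    case (elim g)
    then have "g \<in> Omega" using space by (auto simp: eventually_sequentially)
    moreover have "\<forall>\<^sub>F k in sequentially. g \<notin> ?A k" using elim by eventually_elim simp
    ultimately show ?case using length_proper_if_not_blocked[OF F R(1) _ \<epsilon>(1) net] by blast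
  qed
qed

theorem corollary3p5:
  fixes P :: "(real ^ 'n \<Rightarrow> real ^ 'n ^ 'n) measure"
  assumes dim: "CARD('n) \<ge> 2"
    and prob: "prob_space P"
    and sets: "sets P = sets Omega_space"
    and stationary: "translation_invariant P"
    and finite_range: "finite_range_dependence P"
    and exp_moments: "\<forall>r::real. integrable P (\<lambda>g. exp (r * Lambda0 g))"
    and smooth: "AE g in P. C2_map g"
  shows "AE g in P. geodesically_complete g \<and>
    (\<forall>x y. \<exists>a b \<gamma>. a < b \<and> geodesic_on g {a..b} \<gamma> \<and> \<gamma> a = x \<and> \<gamma> b = y \<and>
      finite_curve a b \<gamma> \<and> length_minimizing g a b \<gamma> \<and>
      riem_dist g x y = riem_length g a b \<gamma>)"
  using AE_length_proper[OF prob sets stationary finite_range] smooth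
proof eventually_elim
  case (elim g)
  obtain g' where g': "\<And>x. (g has_derivative blinfun_apply (g' x)) (at x)" "C1_map g'"
    using elim(2) unfolding C2_map_def by blast
  then have "continuous_on UNIV g'"
    unfolding C1_map_def by (meson continuous_at_imp_continuous_on has_derivative_continuous)
  then interpret C1_metric g g'
    using elim(1) g'(1) by unfold_locales (auto simp: Omega_def)
  show ?case
    using geodesically_complete_if_length_proper exists_minimizing_geodesic elim(1) by blast
qed

end
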